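(* Let $\zeta=e^{2\pi i/5}$, $F=\mathbb{Q}(\zeta)$ and $\mathcal O$ its ring of integers. In the Voronoi decomposition for binary Hermitian forms over $F$, there is exactly $1$ $\mathrm{GL}_2(\mathcal O)$-class of $8$-dimensional Voronoi cones, $5$ classes of $7$-dimensional cones, $10$ classes of $6$-dimensional cones, $11$ classes of $5$-dimensional cones, $9$ classes of $4$-dimensional cones, $4$ classes of $3$-dimensional cones, and $2$ classes of $2$-dimensional cones.
   Context: Let $\iota_1,\iota_2:F\to\mathbb C$ be the embeddings $\zeta\mapsto\zeta$, $\zeta\mapsto\zeta^3$, applied entrywise. Let $\mathcal V$ be the $8$-dimensional real vector space of pairs $(A_1,A_2)$ of $2\times2$ complex Hermitian matrices and $\bar{\mathcal C}\subset\mathcal V$ the pairs of positive semidefinite matrices. For $v\in F^2$ let $q(v)=(\iota_1(v)\iota_1(v)^*,\iota_2(v)\iota_2(v)^* )$. Let $\Lambda$ be the lattice generated by $q(\mathcal O^2)$, and $\mathcal C_1$ the union of the rays $\mathbb R_{>0}q(v)$ for $v\in F^2\setminus\{0\}$. The Voronoi polyhedron $\Pi$ is the closed convex hull in $\bar{\mathcal C}$ of $(\mathcal C_1\cap\Lambda)\setminus\{0\}$. The Voronoi cones are the cones $\mathbb R_{\ge0}\cdot\mathcal F$ over the faces $\mathcal F$ of $\Pi$; an $n$-dimensional such cone is called an $n$-cone. $\mathrm{GL}_2(\mathcal O)$ acts on $\mathcal V$ by $g\cdot(A_1,A_2)=(\iota_1(g)A_1\iota_1(g)^*,\iota_2(g)A_2\iota_2(g)^*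 )$, preserving $\Pi$ and permuting the Voronoi cones.
   Formalization: "Faces of the Voronoi polyhedron" is taken to mean its nonempty bounded (polytopal) faces; the polyhedron itself and its unbounded boundary faces, whose cones would break the stated counts, are excluded. *)

theory Defs
  imports
    "HOL-Analysis.Analysis"
    "HOL-Computational_Algebra.Computational_Algebra"
begin

section \<open>The field of fifth roots of unity\<close>

definition zeta :: complex where
  "zeta = exp (2 * of_real pi * \<i> / 5)"

definition is_subfield :: "complex set \<Rightarrow> bool" where
  "is_subfield K \<longleftrightarrow> 0 \<in> K \<and> 1 \<in> K \<and>
     (\<forall>x\<in>K. \<forall>y\<in>K. x - y \<in> K \<and> x * y \<in> K) \<and> (\<forall>x\<in>K. inverse x \<in> K)"

text \<open>Subfields of the complex numbers contain the rationals, so the smallest one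
  containing \<open>zeta\<close> is the field obtained by adjoining \<open>zeta\<close> to the rationals.\<close>

definition F5 :: "complex set" where
  "F5 = is_subfield hull {zeta}"

definition O5 :: "complex set" where
  "O5 = {x \<in> F5. algebraic_int x}"

definition field_embedding_on :: "complex set \<Rightarrow> (complex \<Rightarrow> complex) \<Rightarrow> bool" where
  "field_embedding_on K f \<longleftrightarrow> f 1 = 1 \<and>
     (\<forall>x\<in>K. \<forall>y\<in>K. f (x + y) = f x + f y \<and> f (x * y) = f x * f y)"

text \<open>The embedding of \<open>F5\<close> sending \<open>zeta\<close> to its \<open>k\<close>-th power (\<open>k\<close> prime to 5). It is
  determined on \<open>F5\<close>; its values elsewhere are unspecified and are never used.\<close>

definition embed :: "nat \<Rightarrow> complex \<Rightarrow> complex" where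
  "embed k = (SOME f. field_embedding_on F5 f \<and> f zeta = zeta ^ k)"

abbreviation iota1 :: "complex \<Rightarrow> complex" where "iota1 \<equiv> embed 1"
abbreviation iota2 :: "complex \<Rightarrow> complex" where "iota2 \<equiv> embed 3"


section \<open>Pairs of Hermitian matrices\<close>

type_synonym cmat = "complex ^ 2 ^ 2"

definition ctranspose :: "cmat \<Rightarrow> cmat" where
  "ctranspose A = (\<chi> i j. cnj (A $ j $ i))"

definition hermitian :: "cmat \<Rightarrow> bool" where
  "hermitian A \<longleftrightarrow> ctranspose A = A"

definition pos_semidef :: "cmat \<Rightarrow> bool" where
  "pos_semidef A \<longleftrightarrow> hermitian A \<and>
     (\<forall>x :: complex ^ 2. 0 \<le> Re (\<Sum>i\<in>UNIV. \<Sum>j\<in>UNIV. cnj (x $ i) * A $ i $ j * x $ j))"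

definition \<V> :: "(cmat \<times> cmat) set" where
  "\<V> = {(A1, A2). hermitian A1 \<and> hermitian A2}"

definition Cbar :: "(cmat \<times> cmat) set" where
  "Cbar = {(A1, A2) \<in> \<V>. pos_semidef A1 \<and> pos_semidef A2}"

definition map_vector :: "(complex \<Rightarrow> complex) \<Rightarrow> complex ^ 2 \<Rightarrow> complex ^ 2" where
  "map_vector f v = (\<chi> i. f (v $ i))"

text \<open>The rank one matrix \<open>x x\<^sup>*\<close>.\<close>

definition outer :: "complex ^ 2 \<Rightarrow> cmat" where
  "outer x = (\<chi> i j. x $ i * cnj (x $ j))"

definition q :: "complex ^ 2 \<Rightarrow> cmat \<times> cmat" where
  "q v = (outer (map_vector iota1 v), outer (map_vector iota2 v))"

definition vectors_over :: "complex set \<Rightarrow> (complex ^ 2) set" where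
  "vectors_over K = {v. \<forall>i. v $ i \<in> K}"

definition matrices_over :: "complex set \<Rightarrow> cmat set" where
  "matrices_over K = {g. \<forall>i j. g $ i $ j \<in> K}"


section \<open>The Voronoi polyhedron and its cones\<close>

definition \<Lambda> :: "(cmat \<times> cmat) set" where
  "\<Lambda> = group_closure (q ` vectors_over O5)"

definition C1 :: "(cmat \<times> cmat) set" where
  "C1 = {t *\<^sub>R q v | t v. t > 0 \<and> v \<in> vectors_over F5 - {0}}"

definition voronoi_polyhedron :: "(cmat \<times> cmat) set" where
  "voronoi_polyhedron = Cbar \<inter> closure (convex hull ((C1 \<inter> \<Lambda>) - {0}))"

text \<open>The faces of the polyhedron are its polytopal faces, that is, the nonempty bounded
  ones. In the sense of \<open>(face_of)\<close>, the unbounded convex set \<open>voronoi_polyhedron\<close> has further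
  faces: itself, and its intersections with faces of the cone \<open>Cbar\<close> together with some
  unbounded faces of those. All of these are unbounded; they do not belong to
  the Voronoi decomposition (the cone over the whole polyhedron, for instance, is
  8-dimensional but is not a Voronoi cone).\<close>

definition voronoi_face :: "(cmat \<times> cmat) set \<Rightarrow> bool" where
  "voronoi_face P \<longleftrightarrow> P face_of voronoi_polyhedron \<and> P \<noteq> {} \<and> bounded P"

definition voronoi_cones :: "nat \<Rightarrow> (cmat \<times> cmat) set set" where
  "voronoi_cones n = {conic hull P | P. voronoi_face P \<and> aff_dim (conic hull P) = int n}"

definition GL2_O5 :: "cmat set" where
  "GL2_O5 = {g \<in> matrices_over O5. \<exists>h \<in> matrices_over O5. g ** h = mat 1 \<and> h ** g = mat 1}"

definition act :: "cmat \<Rightarrow> cmat \<times> cmat \<Rightarrow> cmat \<times> cmat" where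
  "act g = (\<lambda>(A1, A2).
     (map_matrix iota1 g ** A1 ** ctranspose (map_matrix iota1 g),
      map_matrix iota2 g ** A2 ** ctranspose (map_matrix iota2 g)))"

definition cone_equiv :: "nat \<Rightarrow> ((cmat \<times> cmat) set \<times> (cmat \<times> cmat) set) set" where
  "cone_equiv n = {(\<sigma>, \<tau>). \<sigma> \<in> voronoi_cones n \<and> \<tau> \<in> voronoi_cones n \<and>
     (\<exists>g \<in> GL2_O5. \<tau> = act g ` \<sigma>)}"

definition voronoi_classes :: "nat \<Rightarrow> (cmat \<times> cmat) set set set" where
  "voronoi_classes n = voronoi_cones n // cone_equiv n"

end

theory Submission
  imports Defs
begin

text \<open>The positive definite form used here turns \<open>O5\<^sup>2\<close>, with half its trace form, into the root lattice
  \<open>E\<^sub>8\<close>. It takes positive integral values on the points \<open>q v\<close>, and its 240 minimal vectors give 24 points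
  spanning a facet of the Voronoi polyhedron.  For a convex combination \<open>p\<close> of lattice points the
  values of the form at the points \<open>g p\<close> attain their minimum. At a minimising \<open>g\<close> the point
  \<open>g p\<close> satisfies all 118 facet inequalities of the cone over the 24 points, since each inequality
  is the change of the form under a neighbouring group element. So every bounded face is equivalent
  to a face of this one facet.

  That the 118 inequalities define the cone is certified by incidence data alone: subtracting the
  largest admissible multiple of a vertex moves a point into a facet, which reduces the claim to
  smaller faces, down to simplicial ones. The faces are stored as bit masks of vertices, and descending
  from facet to facet with explicit group elements yields a list of representatives. They are
  pairwise inequivalent by an invariant built from determinants of sums of two extreme points.\<close>

section \<open>Integers of the fifth cyclotomic field in coordinates\<close>

text \<open>The minimum over the group is attained for a finite combination of lattice points,
  whereas a point of the polyhedron is merely a limit of such combinations; this is the main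
  obstacle. Boundedness of the face overcomes it. Along a sequence of combinations tending to a
  relative interior point of the face, a subsequence can be chosen on which each of the 24 moving
  vertices is either constant or of value tending to infinity. The escaping vertices lose all weight
  in the limit but may leave behind a vector, and then the polyhedron contains a whole ray in its
  direction. A bounded face admits no such ray, so the vector is zero and a single image of the
  facet remains.

  The functional of a facet vanishes at the vertices of its mask and is positive at the others.
  Besides linearity this is all that the certificates use, so evaluation involves only cyclotomic
  integers and masks, never normal vectors.\<close>

datatype 'a cyc = Cyc 'a 'a 'a 'a

text \<open>Coefficients with respect to 1, w, w^2, w^3 for a primitive fifth root of unity w. The
  coefficient ring is left open: integers serve for evaluation of the tables, rationals for the
  field.\<close>

instantiation cyc :: (comm_ring_1) comm_ring_1
begin

definition zero_cyc :: "'a cyc" where "0 = Cyc 0 0 0 0"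
definition one_cyc :: "'a cyc" where "1 = Cyc 1 0 0 0"

fun plus_cyc :: "'a cyc \<Rightarrow> 'a cyc \<Rightarrow> 'a cyc" where
  "Cyc a b c d + Cyc a' b' c' d' = Cyc (a + a') (b + b') (c + c') (d + d')"

fun minus_cyc :: "'a cyc \<Rightarrow> 'a cyc \<Rightarrow> 'a cyc" where
  "Cyc a b c d - Cyc a' b' c' d' = Cyc (a - a') (b - b') (c - c') (d - d')"

fun uminus_cyc :: "'a cyc \<Rightarrow> 'a cyc" where
  "- Cyc a b c d = Cyc (- a) (- b) (- c) (- d)"

text \<open>\<open>e\<close> is the coefficient of w^4, eliminated by w^4 = -1 - w - w^2 - w^3; the
  exponents 5 and 6 are reduced by w^5 = 1.\<close>

fun times_cyc :: "'a cyc \<Rightarrow> 'a cyc \<Rightarrow> 'a cyc" where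
  "Cyc a b c d * Cyc a' b' c' d' =
     (let e = b * d' + c * c' + d * b' in
      Cyc (a * a' + c * d' + d * c' - e) (a * b' + b * a' + d * d' - e)
          (a * c' + b * b' + c * a' - e) (a * d' + b * c' + c * b' + d * a' - e))"

instance
proof
  fix x y z :: "'a cyc"
  show "x + y + z = x + (y + z)" by (cases x; cases y; cases z) (simp add: algebra_simps)
  show "x + y = y + x" by (cases x; cases y) (simp add: algebra_simps)
  show "0 + x = x" by (cases x) (simp add: zero_cyc_def)
  show "- x + x = 0" by (cases x) (simp add: zero_cyc_def)
  show "x - y = x + - y" by (cases x; cases y) simp
  show "x * y * z = x * (y * z)" by (cases x; cases y; cases z) (simp add: Let_def algebra_simps)
  show "x * y = y * x" by (cases x; cases y) (simp add: Let_def algebra_simps)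
  show "1 * x = x" by (cases x) (simp add: one_cyc_def)
  show "(x + y) * z = x * z + y * z" by (cases x; cases y; cases z) (simp add: Let_def algebra_simps)
  show "(0 :: 'a cyc) \<noteq> 1" by (simp add: zero_cyc_def one_cyc_def)
qed

end

definition cyc_const :: "'a::comm_ring_1 \<Rightarrow> 'a cyc" where "cyc_const a = Cyc a 0 0 0"

fun cyc_conj :: "'a::comm_ring_1 cyc \<Rightarrow> 'a cyc" where
  "cyc_conj (Cyc a b c d) = Cyc (a - b) (- b) (d - b) (c - b)"

text \<open>The automorphism sending a root of unity to its cube.\<close>

fun cyc_gal :: "'a::comm_ring_1 cyc \<Rightarrow> 'a cyc" where
  "cyc_gal (Cyc a b c d) = Cyc (a - d) (c - d) (- d) (b - d)"

section \<open>Evaluation at a primitive fifth root of unity\<close>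

fun cval :: "complex \<Rightarrow> rat cyc \<Rightarrow> complex" where
  "cval w (Cyc a b c d) = of_rat a + of_rat b * w + of_rat c * w\<^sup>2 + of_rat d * w ^ 3"

definition prim5 :: "complex \<Rightarrow> bool" where
  "prim5 w \<longleftrightarrow> 1 + w + w\<^sup>2 + w ^ 3 + w ^ 4 = 0"

text \<open>Identities modulo the cyclotomic polynomial are proved with an explicit cofactor
  \<open>k\<close>, which turns them into polynomial identities that expansion settles.\<close>

lemma prim5_eqI: assumes "prim5 w" "x - y = (1 + w + w\<^sup>2 + w ^ 3 + w ^ 4) * k" shows "x = y"
  using assms by (simp add: prim5_def)

lemma prim5_pow5: assumes "prim5 w" shows "w ^ 5 = 1"
proof -
  have "w ^ 5 - 1 = (w - 1) * (1 + w + w\<^sup>2 + w ^ 3 + w ^ 4)" by (simp add: algebra_simps eval_nat_numeral)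
  then show ?thesis using assms by (simp add: prim5_def)
qed

lemma prim5_norm: assumes "prim5 w" shows "cmod w = 1"
  using prim5_pow5[OF assms] power_eq_1_iff[of w 5] by auto

lemma prim5_cnj: assumes "prim5 w" shows "cnj w = w ^ 4"
proof -
  have "w * cnj w = 1" using prim5_norm[OF assms] by (simp add: complex_norm_square[symmetric])
  moreover have "w * w ^ 4 = 1" using prim5_pow5[OF assms] by (simp add: power_Suc[symmetric] del: power_Suc)
  moreover have "w \<noteq> 0" using prim5_norm[OF assms] by auto
  ultimately show ?thesis by (metis mult_left_cancel)
qed

lemma prim5_cube: assumes "prim5 w" shows "prim5 (w ^ 3)"
proof -
  have 5: "w ^ 5 = 1" using prim5_pow5[OF assms] .
  have a: "(w ^ 3)\<^sup>2 = w" "(w ^ 3) ^ 3 = w ^ 4" "(w ^ 3) ^ 4 = w\<^sup>2"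
  proof -
    have "(w ^ 3)\<^sup>2 = w ^ 5 * w" by (simp add: algebra_simps eval_nat_numeral)
    then show "(w ^ 3)\<^sup>2 = w" by (simp add: 5)
    have "(w ^ 3) ^ 3 = w ^ 5 * w ^ 4" by (simp add: algebra_simps eval_nat_numeral)
    then show "(w ^ 3) ^ 3 = w ^ 4" by (simp add: 5)
    have "(w ^ 3) ^ 4 = w ^ 5 * w ^ 5 * w\<^sup>2" by (simp add: algebra_simps eval_nat_numeral)
    then show "(w ^ 3) ^ 4 = w\<^sup>2" by (simp add: 5)
  qed
  show ?thesis using assms unfolding prim5_def a by (simp add: ac_simps)
qed

lemma zeta_prim5: "prim5 zeta"
proof -
  have p: "zeta ^ 5 = 1"
  proof -
    have "zeta ^ 5 = exp (of_nat 5 * (2 * of_real pi * \<i> / 5))" unfolding zeta_def exp_of_nat_mult ..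
    also have "of_nat 5 * (2 * of_real pi * \<i> / 5) = 2 * of_real pi * \<i>" by simp
    finally show ?thesis by (simp only: exp_two_pi_i)
  qed
  have n: "zeta \<noteq> 1"
  proof
    assume "zeta = 1"
    then obtain k :: int where "2 * of_real pi * \<i> / 5 = of_int (2 * k) * of_real pi * \<i>"
      unfolding zeta_def exp_eq_1 by (auto simp: complex_eq_iff)
    then have "2 * pi / 5 = of_int (2 * k) * pi" by (simp add: complex_eq_iff)
    then have "(of_int (5 * k) :: real) = of_int 1" by simp
    then have "5 * k = 1" by (simp only: of_int_eq_iff)
    then show False by presburger
  qed
  have "zeta ^ 5 - 1 = (zeta - 1) * (1 + zeta + zeta\<^sup>2 + zeta ^ 3 + zeta ^ 4)" by (simp add: algebra_simps eval_nat_numeral)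
  then show ?thesis using p n by (simp add: prim5_def)
qed

lemma cval_add: "cval w (x + y) = cval w x + cval w y"
  by (cases x; cases y) (simp add: of_rat_add algebra_simps)

lemma cval_neg: "cval w (- x) = - cval w x"
  by (cases x) (simp add: of_rat_minus algebra_simps)

lemma cval_diff: "cval w (x - y) = cval w x - cval w y"
  using cval_add[of w x "- y"] by (simp add: cval_neg)

lemma cval_const [simp]: "cval w (cyc_const a) = of_rat a"
  by (simp add: cyc_const_def)

lemma cval_mul: assumes "prim5 w" shows "cval w (x * y) = cval w x * cval w y"
proof (cases x; cases y)
  fix a b c d a' b' c' d' assume x: "x = Cyc a b c d" and y: "y = Cyc a' b' c' d'"
  have *: "(A + B * w + C * w\<^sup>2 + D * w ^ 3) * (A' + B' * w + C' * w\<^sup>2 + D' * w ^ 3) =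
    (A * A' + C * D' + D * C' - (B * D' + C * C' + D * B'))
    + (A * B' + B * A' + D * D' - (B * D' + C * C' + D * B')) * w
    + (A * C' + B * B' + C * A' - (B * D' + C * C' + D * B')) * w\<^sup>2
    + (A * D' + B * C' + C * B' + D * A' - (B * D' + C * C' + D * B')) * w ^ 3"
    for A B C D A' B' C' D' :: complex
  proof -
    have "(A + B * w + C * w\<^sup>2 + D * w ^ 3) * (A' + B' * w + C' * w\<^sup>2 + D' * w ^ 3) -
      ((A * A' + C * D' + D * C' - (B * D' + C * C' + D * B'))
      + (A * B' + B * A' + D * D' - (B * D' + C * C' + D * B')) * w
      + (A * C' + B * B' + C * A' - (B * D' + C * C' + D * B')) * w\<^sup>2
      + (A * D' + B * C' + C * B' + D * A' - (B * D' + C * C' + D * B')) * w ^ 3) =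
      (1 + w + w\<^sup>2 + w ^ 3 + w ^ 4) *
        ((B * D' + C * C' + D * B') + (C * D' + D * C') * (w - 1) + D * D' * (w\<^sup>2 - w))"
      by (simp add: algebra_simps eval_nat_numeral)
    then show ?thesis by (rule prim5_eqI[OF assms])
  qed
  show ?thesis unfolding x y cval.simps times_cyc.simps Let_def *
    by (simp only: of_rat_add of_rat_diff of_rat_mult)
qed

lemma cval_conj: assumes "prim5 w" shows "cval w (cyc_conj x) = cnj (cval w x)"
proof (cases x)
  case (Cyc a b c d)
  have cr: "cnj (of_rat r) = of_rat r" for r
    by (cases r) (simp add: of_rat_rat)
  have *: "A + B * w ^ 4 + C * (w ^ 4)\<^sup>2 + D * (w ^ 4) ^ 3
     = (A - B) + (- B) * w + (D - B) * w\<^sup>2 + (C - B) * w ^ 3" for A B C D :: complex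
  proof -
    have "A + B * w ^ 4 + C * (w ^ 4)\<^sup>2 + D * (w ^ 4) ^ 3
      - ((A - B) + (- B) * w + (D - B) * w\<^sup>2 + (C - B) * w ^ 3)
      = (1 + w + w\<^sup>2 + w ^ 3 + w ^ 4) * (B + C * (w ^ 3 * (w - 1)) + D * (w\<^sup>2 * (w ^ 5 + 1) * (w - 1)))"
      by (simp add: algebra_simps eval_nat_numeral)
    then show ?thesis by (rule prim5_eqI[OF assms])
  qed
  show ?thesis unfolding Cyc cval.simps cyc_conj.simps complex_cnj_add complex_cnj_mult complex_cnj_power
    prim5_cnj[OF assms] cr * by (simp add: of_rat_diff of_rat_minus)
qed

lemma cval_gal: assumes "prim5 w" shows "cval w (cyc_gal x) = cval (w ^ 3) x"
proof (cases x)
  case (Cyc a b c d)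
  have *: "A + B * w ^ 3 + C * (w ^ 3)\<^sup>2 + D * (w ^ 3) ^ 3
     = (A - D) + (C - D) * w + (- D) * w\<^sup>2 + (B - D) * w ^ 3" for A B C D :: complex
  proof -
    have "A + B * w ^ 3 + C * (w ^ 3)\<^sup>2 + D * (w ^ 3) ^ 3
      - ((A - D) + (C - D) * w + (- D) * w\<^sup>2 + (B - D) * w ^ 3)
      = (1 + w + w\<^sup>2 + w ^ 3 + w ^ 4) * (C * (w * (w - 1)) + D * (1 + w ^ 4 * (w - 1)))"
      by (simp add: algebra_simps eval_nat_numeral)
    then show ?thesis by (rule prim5_eqI[OF assms])
  qed
  show ?thesis unfolding Cyc cval.simps cyc_gal.simps * by (simp add: of_rat_diff of_rat_minus)
qed

section \<open>The real quadratic subfield and independence of the powers of w\<close>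

lemma golden_irrational:
  fixes s :: complex
  assumes "s\<^sup>2 = 1 - s" shows "s \<notin> \<rat>"
proof
  assume "s \<in> \<rat>"
  moreover have "algebraic_int s"
    by (rule algebraic_int.intros[of "[:-1, 1, 1:]"]) (use assms in \<open>auto simp: coeff_pCons algebra_simps power2_eq_square split: nat.splits\<close>)
  ultimately have "s \<in> \<int>" using rational_algebraic_int_is_int by blast
  then obtain k where "s = of_int k" by (auto elim: Ints_cases)
  with assms have "(of_int (k\<^sup>2) :: complex) = of_int (1 - k)" by simp
  then have "k\<^sup>2 = 1 - k" by (simp only: of_int_eq_iff)
  then have "k * (k + 1) = 1" by (simp add: power2_eq_square algebra_simps)
  then have "even (1::int)" by (metis even_mult_iff even_plus_one_iff)
  then show False by simp
qed

lemma prim5_golden: assumes "prim5 w" shows "(w\<^sup>2 + w ^ 3)\<^sup>2 = 1 - (w\<^sup>2 + w ^ 3)"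
proof -
  have "(w\<^sup>2 + w ^ 3)\<^sup>2 - (1 - (w\<^sup>2 + w ^ 3)) = (1 + w + w\<^sup>2 + w ^ 3 + w ^ 4) * (w\<^sup>2 + w - 1)"
    by (simp add: algebra_simps eval_nat_numeral)
  then show ?thesis by (rule prim5_eqI[OF assms])
qed

lemma golden_indep:
  assumes "s\<^sup>2 = 1 - s" "of_rat a + of_rat b * s = (0::complex)"
  shows "a = 0 \<and> b = 0"
proof -
  have b: "b = 0"
  proof (rule ccontr)
    assume "b \<noteq> 0"
    then have "s = of_rat (- a / b)" using assms(2)
      by (simp add: of_rat_divide of_rat_minus field_simps eq_neg_iff_add_eq_0)
    then show False using golden_irrational[OF assms(1)] by simp
  qed
  then show ?thesis using assms(2) by simp
qed

text \<open>Irreducibility of the cyclotomic polynomial by descent to the real quadratic subfield: a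
  relation minus its complex conjugate has the factor w^2 - w^3, and the other factor is a rational
  relation between 1 and \<open>?s\<close>, which are independent by \<open>golden_indep\<close>.
  This gives \<open>b = 0\<close> and \<open>c = d\<close>, and the relation that is left is again
  one between 1 and \<open>?s\<close>.\<close>

lemma cval_eq_0: assumes w: "prim5 w" and x: "cval w x = 0" shows "x = 0"
proof (cases x)
  case (Cyc a b c d)
  let ?s = "w\<^sup>2 + w ^ 3"
  let ?A = "of_rat a :: complex" and ?B = "of_rat b :: complex" and ?C = "of_rat c :: complex" and ?D = "of_rat d :: complex"
  have e1: "?A + ?B * w + ?C * w\<^sup>2 + ?D * w ^ 3 = 0" using x Cyc by simp
  moreover have e2: "(of_rat a - of_rat b) + (- of_rat b) * w + (of_rat d - of_rat b) * w\<^sup>2 + (of_rat c - of_rat b) * w ^ 3 = (0::complex)"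
    using x Cyc cval_conj[OF w, of x] by (simp add: of_rat_diff of_rat_minus)
  ultimately have "(of_rat (c - d) + of_rat (- b) * ?s) * (w\<^sup>2 - w ^ 3) = 0"
  proof -
    have "((?C - ?D) + (- ?B) * ?s) * (w\<^sup>2 - w ^ 3) =
      (?A + ?B * w + ?C * w\<^sup>2 + ?D * w ^ 3)
      - ((?A - ?B) + (- ?B) * w + (?D - ?B) * w\<^sup>2 + (?C - ?B) * w ^ 3)
      - ?B * (1 + w + w\<^sup>2 + w ^ 3 + w ^ 4) * (1 + w - w\<^sup>2)"
      by (simp add: algebra_simps eval_nat_numeral)
    then show ?thesis using w[unfolded prim5_def] e1 e2 by (simp only: of_rat_diff of_rat_minus) simp
  qed
  moreover have "w\<^sup>2 - w ^ 3 \<noteq> 0"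
  proof
    assume "w\<^sup>2 - w ^ 3 = 0"
    then have "w\<^sup>2 * (1 - w) = 0" by (simp add: algebra_simps eval_nat_numeral)
    moreover have "w \<noteq> 0" using prim5_norm[OF w] by auto
    ultimately have "w = 1" by simp
    then show False using w by (simp add: prim5_def)
  qed
  ultimately have "of_rat (c - d) + of_rat (- b) * ?s = 0" by simp
  from golden_indep[OF prim5_golden[OF w] this] have b: "b = 0" and cd: "c = d" by auto
  have "of_rat a + of_rat c * ?s = 0" using x Cyc b cd by (simp add: algebra_simps)
  from golden_indep[OF prim5_golden[OF w] this] show ?thesis using b cd Cyc by (auto simp: zero_cyc_def)
qed

lemma cval_inj: assumes "prim5 w" "cval w x = cval w y" shows "x = y"
proof -
  have "cval w (x - y) = 0" using assms by (simp add: cval_diff)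
  from cval_eq_0[OF assms(1) this] show ?thesis by simp
qed

text \<open>Inversion in two quadratic steps: \<open>x\<close> times its conjugate has the form m +
  k s in the real subfield, and m - k - k s is its conjugate under s -> -1 - s, so that the product
  of these two is the rational number \<open>?r\<close>.\<close>

lemma cyc_norm_exists:
  assumes w: "prim5 w" and "cval w x \<noteq> 0"
  shows "\<exists>y. cval w y = inverse (cval w x)"
proof -
  obtain a b c d where x: "x = Cyc a b c d" by (cases x)
  let ?n = "x * cyc_conj x"
  let ?s = "w\<^sup>2 + w ^ 3"
  define m where "m = a * a + b * b + c * c + d * d - (a * b + b * c + c * d)"
  define k where "k = a * c + a * d + b * d - (a * b + b * c + c * d)"
  have n: "?n = Cyc m 0 k k"
    by (simp add: x Let_def m_def k_def algebra_simps)
  have N: "cval w x * cnj (cval w x) = of_rat m + of_rat k * ?s"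
    using cval_mul[OF w, of x "cyc_conj x"] unfolding n cval_conj[OF w] by (simp add: algebra_simps)
  let ?r = "m\<^sup>2 - m * k - k\<^sup>2"
  have prod: "(of_rat m + of_rat k * ?s) * (of_rat m - of_rat k - of_rat k * ?s) = of_rat ?r"
  proof -
    have "(M + K * t) * (M - K - K * t) = M\<^sup>2 - M * K - K\<^sup>2 * (t + t\<^sup>2)" for M K t :: complex
      by (simp add: algebra_simps eval_nat_numeral)
    then show ?thesis by (simp only: prim5_golden[OF w] of_rat_diff of_rat_mult of_rat_power) simp
  qed
  have nz: "of_rat m + of_rat k * ?s \<noteq> 0" using N assms(2) by (metis complex_cnj_zero_iff mult_eq_0_iff)
  have "of_rat m - of_rat k - of_rat k * ?s \<noteq> 0"
  proof
    assume "of_rat m - of_rat k - of_rat k * ?s = 0"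
    then have "of_rat (m - k) + of_rat (- k) * ?s = 0" by (simp add: of_rat_diff of_rat_minus)
    from golden_indep[OF prim5_golden[OF w] this] show False using nz by auto
  qed
  then have rnz: "of_rat ?r \<noteq> (0::complex)" using prod nz by (metis mult_eq_0_iff)
  let ?y = "cyc_conj x * Cyc (m - k) 0 (- k) (- k) * cyc_const (inverse ?r)"
  have "cval w x * cval w ?y = (cval w x * cnj (cval w x)) * (of_rat m - of_rat k - of_rat k * ?s) * inverse (of_rat ?r)"
    by (simp add: cval_mul[OF w] cval_conj[OF w] of_rat_inverse of_rat_diff of_rat_minus algebra_simps)
  also have "\<dots> = 1" unfolding N prod using rnz by simp
  finally have "cval w ?y = inverse (cval w x)" by (metis inverse_unique)
  then show ?thesis by blast
qed

section \<open>The field \<open>F5\<close> and its embeddings\<close>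

lemma F5_eq: "F5 = range (cval zeta)"
proof
  have "is_subfield (range (cval zeta))"
    unfolding is_subfield_def
  proof (intro conjI ballI)
    have "cval zeta (cyc_const 0) = 0" by simp
    then show "0 \<in> range (cval zeta)" by (metis rangeI)
    have "cval zeta (cyc_const 1) = 1" by simp
    then show "1 \<in> range (cval zeta)" by (metis rangeI)
  next
    fix x y assume "x \<in> range (cval zeta)" "y \<in> range (cval zeta)"
    then obtain a b where "x = cval zeta a" "y = cval zeta b" by auto
    then have "x - y = cval zeta (a - b)" "x * y = cval zeta (a * b)"
      by (simp_all add: cval_diff cval_mul[OF zeta_prim5])
    then show "x - y \<in> range (cval zeta)" "x * y \<in> range (cval zeta)" by auto
  next
    fix x assume "x \<in> range (cval zeta)"
    then obtain a where a: "x = cval zeta a" by auto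
    show "inverse x \<in> range (cval zeta)"
    proof (cases "x = 0")
      case True then show ?thesis by (metis a inverse_zero rangeI)
    next
      case False then show ?thesis using cyc_norm_exists[OF zeta_prim5] a by (metis rangeI)
    qed
  qed
  then show "F5 \<subseteq> range (cval zeta)"
    unfolding F5_def by (rule hull_minimal[rotated]) (auto intro: range_eqI[of _ _ "Cyc 0 1 0 0"])
next
  show "range (cval zeta) \<subseteq> F5"
  proof
    fix z assume "z \<in> range (cval zeta)"
    then obtain a b c d where z: "z = cval zeta (Cyc a b c d)" by (metis cyc.exhaust imageE)
    have "z \<in> K" if K: "is_subfield K" "zeta \<in> K" for K
    proof -
      have d: "\<And>x y. x \<in> K \<Longrightarrow> y \<in> K \<Longrightarrow> x - y \<in> K" and m: "\<And>x y. x \<in> K \<Longrightarrow> y \<in> K \<Longrightarrow> x * y \<in> K"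
        and i: "\<And>x. x \<in> K \<Longrightarrow> inverse x \<in> K" and 0: "0 \<in> K" and 1: "1 \<in> K"
        using K(1) by (auto simp: is_subfield_def)
      have neg: "- x \<in> K" if "x \<in> K" for x using d[OF 0 that] by simp
      have ad: "x + y \<in> K" if "x \<in> K" "y \<in> K" for x y using d[OF that(1) neg[OF that(2)]] by simp
      have nat: "of_nat n \<in> K" for n by (induction n) (auto intro: 0 1 ad)
      have int: "of_int n \<in> K" for n by (cases n) (auto intro: nat neg simp del: of_nat_Suc)
      have rat: "of_rat r \<in> K" for r
      proof -
        obtain p q where "r = of_int p / of_int q" by (metis quotient_of_div surj_pair)
        then have "(of_rat r :: complex) = of_int p * inverse (of_int q)" by (simp add: of_rat_divide) (simp add: divide_inverse)
        then show ?thesis using int i m by metis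
      qed
      have pw: "zeta ^ n \<in> K" for n by (induction n) (auto intro: 1 m K(2))
      show ?thesis unfolding z cval.simps by (intro ad m rat pw K(2))
    qed
    then show "z \<in> F5" unfolding F5_def hull_def by auto
  qed
qed

text \<open>Substituting the power for \<open>zeta\<close> in coordinates is a field embedding, so
  the choice made in \<open>embed\<close> has a witness. Conversely every embedding fixes the
  rational numbers, so the chosen one agrees with this substitution on the whole field.\<close>

lemma embed_cval: assumes k: "prim5 (zeta ^ k)" shows "embed k (cval zeta x) = cval (zeta ^ k) x"
proof -
  let ?f = "\<lambda>z. cval (zeta ^ k) (inv (cval zeta) z)"
  have ic: "inv (cval zeta) (cval zeta x) = x" for x
    by (rule inv_f_f) (auto intro: injI cval_inj[OF zeta_prim5])
  have 1: "?f 1 = 1" using ic[of "cyc_const 1"] by simp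
  have z: "?f zeta = zeta ^ k" using ic[of "Cyc 0 1 0 0"] by simp
  have "field_embedding_on F5 ?f \<and> ?f zeta = zeta ^ k"
    unfolding field_embedding_on_def F5_eq
    by (auto simp: 1 z cval_add[symmetric] cval_mul[OF zeta_prim5, symmetric] ic)
      (auto simp: cval_add cval_mul[OF k])
  then have E: "field_embedding_on F5 (embed k)" "embed k zeta = zeta ^ k"
    unfolding embed_def by (metis (mono_tags, lifting) someI)+
  let ?e = "embed k"
  have one: "?e 1 = 1" and ad: "\<And>x y. ?e (cval zeta x + cval zeta y) = ?e (cval zeta x) + ?e (cval zeta y)"
    and mu: "\<And>x y. ?e (cval zeta x * cval zeta y) = ?e (cval zeta x) * ?e (cval zeta y)"
    using E(1) unfolding field_embedding_on_def F5_eq by auto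
  have radd: "?e (of_rat (a + b)) = ?e (of_rat a) + ?e (of_rat b)" for a b
    using ad[of "cyc_const a" "cyc_const b"] by (simp add: of_rat_add)
  have rmul: "?e (of_rat (a * b)) = ?e (of_rat a) * ?e (of_rat b)" for a b
    using mu[of "cyc_const a" "cyc_const b"] by (simp add: of_rat_mult)
  have r0: "?e 0 = 0" using radd[of 0 0] by simp
  have rneg: "?e (of_rat (- a)) = - ?e (of_rat a)" for a
    using radd[of a "- a"] r0 by (simp add: eq_neg_iff_add_eq_0 add.commute)
  have rnat: "?e (of_rat (of_nat n)) = of_nat n" for n
  proof (induction n)
    case (Suc n) then show ?case using radd[of 1 "of_nat n"] one by simp
  qed (use r0 in simp)
  have rint: "?e (of_rat (of_int n)) = of_int n" for n
  proof (cases n)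
    case (nonneg m) then show ?thesis using rnat[of m] by simp
  next
    case (neg m) then show ?thesis using rnat[of "Suc m"] rneg[of "of_nat (Suc m)"] by (simp del: of_nat_Suc)
  qed
  have rat: "?e (of_rat r) = of_rat r" for r
  proof -
    obtain p q where r: "r = of_int p / of_int q" and q: "q > 0" by (metis quotient_of_div quotient_of_denom_pos surj_pair)
    have "?e (of_rat r) * ?e (of_rat (of_int q)) = ?e (of_rat (of_int p))"
      using rmul[of r "of_int q"] r q by simp
    then show ?thesis unfolding rint using q by (simp add: r of_rat_divide field_simps)
  qed
  have pw: "?e (zeta ^ n) = (zeta ^ k) ^ n \<and> zeta ^ n \<in> range (cval zeta)" for n
  proof (induction n)
    case 0 show ?case using one cval_const[of zeta 1] by (metis of_rat_1 power_0 rangeI)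
  next
    case (Suc n)
    then obtain y where y: "zeta ^ n = cval zeta y" by auto
    have "?e (zeta * zeta ^ n) = ?e zeta * ?e (zeta ^ n)" using mu[of "Cyc 0 1 0 0" y] y by simp
    moreover have "zeta * zeta ^ n = cval zeta (Cyc 0 1 0 0 * y)" by (simp add: cval_mul[OF zeta_prim5] y)
    ultimately show ?case using Suc E(2) by auto
  qed
  have trm: "?e (of_rat a * zeta ^ n) = of_rat a * (zeta ^ k) ^ n \<and> of_rat a * zeta ^ n \<in> range (cval zeta)" for a n
  proof -
    obtain y where y: "zeta ^ n = cval zeta y" using pw[of n] by auto
    have "?e (of_rat a * zeta ^ n) = ?e (of_rat a) * ?e (zeta ^ n)" using mu[of "cyc_const a" y] y by simp
    moreover have "of_rat a * zeta ^ n = cval zeta (cyc_const a * y)" by (simp add: cval_mul[OF zeta_prim5] y)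
    ultimately show ?thesis using rat pw by auto
  qed
  have ad': "?e (u + v) = ?e u + ?e v \<and> u + v \<in> range (cval zeta)" if "u \<in> range (cval zeta)" "v \<in> range (cval zeta)" for u v
    using that ad by (auto simp: cval_add[symmetric])
  obtain a b c d where x: "x = Cyc a b c d" by (cases x)
  have x': "cval w x = of_rat a * w ^ 0 + of_rat b * w ^ 1 + of_rat c * w ^ 2 + of_rat d * w ^ 3" for w
    by (simp add: x)
  show ?thesis unfolding x' using trm ad' by metis
qed

lemma iota1_cval: "iota1 (cval zeta x) = cval zeta x"
  using embed_cval[of 1] zeta_prim5 by simp

lemma iota2_cval: "iota2 (cval zeta x) = cval (zeta ^ 3) x"
  using embed_cval[of 3] prim5_cube[OF zeta_prim5] by simp

section \<open>Integral coordinates\<close>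

abbreviation cint :: "int cyc \<Rightarrow> rat cyc" where "cint \<equiv> map_cyc of_int"

abbreviation ival :: "complex \<Rightarrow> int cyc \<Rightarrow> complex" where "ival w x \<equiv> cval w (cint x)"

lemma of_nat_cyc: "of_nat n = Cyc (of_nat n) 0 0 (0 :: 'a::comm_ring_1)"
  by (induction n) (simp_all add: zero_cyc_def one_cyc_def)

lemma of_int_cyc: "of_int n = Cyc (of_int n) 0 0 (0 :: 'a::comm_ring_1)"
  by (cases n) (simp_all add: of_nat_cyc del: of_nat_Suc)

lemma cint_add: "cint (x + y) = cint x + cint y"
  by (cases x; cases y) simp

lemma cint_diff: "cint (x - y) = cint x - cint y"
  by (cases x; cases y) simp

lemma cint_mult: "cint (x * y) = cint x * cint y"
  by (cases x; cases y) (simp add: Let_def)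

lemma cint_of_int: "cint (of_int n) = of_int n"
  by (simp add: of_int_cyc)

lemma cint_uminus: "cint (- x) = - cint x"
  by (cases x) simp

lemma cint_conj: "cint (cyc_conj x) = cyc_conj (cint x)"
  by (cases x) simp

lemma cint_gal: "cint (cyc_gal x) = cyc_gal (cint x)"
  by (cases x) simp

lemma cval_0 [simp]: "cval w 0 = 0" and cval_1 [simp]: "cval w 1 = 1"
  by (simp_all add: zero_cyc_def one_cyc_def)

lemma cval_of_int: "cval w (of_int n) = of_int n"
  by (simp add: of_int_cyc)

lemma cval_power: "prim5 w \<Longrightarrow> cval w (x ^ n) = cval w x ^ n"
  by (induction n) (simp_all add: cval_mul)

lemma gal_mult: "cyc_gal (x * y) = cyc_gal x * cyc_gal (y :: 'a::comm_ring_1 cyc)"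
  by (cases x; cases y) (simp add: Let_def algebra_simps)

lemma gal_of_int: "cyc_gal (of_int n) = (of_int n :: 'a::comm_ring_1 cyc)"
  by (simp add: of_int_cyc)

lemma gal_power: "cyc_gal (x ^ n) = cyc_gal x ^ n"
  by (induction n) (simp_all add: gal_mult one_cyc_def)

section \<open>Almost integral elements\<close>

lemma range_cint_add: "x \<in> range cint \<Longrightarrow> y \<in> range cint \<Longrightarrow> x + y \<in> range cint"
  by (auto simp: cint_add[symmetric])

lemma range_cint_mult: "x \<in> range cint \<Longrightarrow> y \<in> range cint \<Longrightarrow> x * y \<in> range cint"
  by (auto simp: cint_mult[symmetric])

lemma range_cint_uminus: "x \<in> range cint \<Longrightarrow> - x \<in> range cint"
  by (auto simp: cint_uminus[symmetric])

lemma range_cint_of_int: "of_int n \<in> range cint"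
  by (metis cint_of_int rangeI)

lemma range_cint_of_nat: "of_nat n \<in> range cint"
  using range_cint_of_int[of "int n"] by simp

lemma range_cint_sum: "(\<And>i. i \<in> A \<Longrightarrow> f i \<in> range cint) \<Longrightarrow> sum f A \<in> range cint"
proof (induction A rule: infinite_finite_induct)
  case (insert x F) then show ?case by (simp add: range_cint_add)
qed (use range_cint_of_int[of 0] in auto)

lemma range_cint_power: "x \<in> range cint \<Longrightarrow> x ^ n \<in> range cint"
proof (induction n)
  case 0 show ?case using range_cint_of_int[of 1] by simp
qed (simp add: range_cint_mult)

lemma range_cint_gal: "x \<in> range cint \<Longrightarrow> cyc_gal x \<in> range cint"
  by (auto simp: cint_gal[symmetric])

text \<open>Unlike integrality, this property is visibly closed under sums and products.\<close>

definition almost_integral :: "rat cyc \<Rightarrow> bool" where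
  "almost_integral x \<longleftrightarrow> (\<exists>D>0. \<forall>k. of_int D * x ^ k \<in> range cint)"

lemma almost_integral_mult:
  assumes "almost_integral x" "almost_integral y" shows "almost_integral (x * y)"
proof -
  obtain D E where "D > 0" "E > 0" and D: "\<And>k. of_int D * x ^ k \<in> range cint" and E: "\<And>k. of_int E * y ^ k \<in> range cint"
    using assms by (auto simp: almost_integral_def)
  have "of_int (D * E) * (x * y) ^ k = (of_int D * x ^ k) * (of_int E * y ^ k)" for k
    by (simp add: power_mult_distrib mult_ac)
  then have "of_int (D * E) * (x * y) ^ k \<in> range cint" for k using range_cint_mult[OF D E] by metis
  then show ?thesis unfolding almost_integral_def using \<open>D > 0\<close> \<open>E > 0\<close> by (intro exI[of _ "D * E"]) auto
qed

lemma almost_integral_add: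
  assumes "almost_integral x" "almost_integral y" shows "almost_integral (x + y)"
proof -
  obtain D E where "D > 0" "E > 0" and D: "\<And>k. of_int D * x ^ k \<in> range cint" and E: "\<And>k. of_int E * y ^ k \<in> range cint"
    using assms by (auto simp: almost_integral_def)
  have "of_int (D * E) * (x + y) ^ k = (\<Sum>i\<le>k. of_nat (k choose i) * ((of_int D * x ^ i) * (of_int E * y ^ (k - i))))" for k
    by (simp add: binomial_ring sum_distrib_left mult_ac)
  then have "of_int (D * E) * (x + y) ^ k \<in> range cint" for k
    by (simp only:) (intro range_cint_sum range_cint_mult range_cint_of_nat D E)
  then show ?thesis unfolding almost_integral_def using \<open>D > 0\<close> \<open>E > 0\<close> by (intro exI[of _ "D * E"]) auto
qed

lemma almost_integral_cint: "almost_integral (cint x)"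
  unfolding almost_integral_def
  by (intro exI[of _ 1] conjI allI range_cint_mult range_cint_of_int range_cint_power) auto

lemma almost_integral_of_int: "almost_integral (of_int n)"
  using almost_integral_cint[of "of_int n"] by (simp add: cint_of_int)

lemma almost_integral_diff:
  assumes "almost_integral x" "almost_integral y" shows "almost_integral (x - y)"
  using almost_integral_add[OF assms(1) almost_integral_mult[OF almost_integral_of_int[of "-1"] assms(2)]] by simp

lemma almost_integral_gal: assumes "almost_integral x" shows "almost_integral (cyc_gal x)"
proof -
  obtain D where "D > 0" and D: "\<And>k. of_int D * x ^ k \<in> range cint"
    using assms by (auto simp: almost_integral_def)
  have "of_int D * cyc_gal x ^ k \<in> range cint" for k
    using range_cint_gal[OF D[of k]] by (simp add: gal_mult gal_of_int gal_power)
  then show ?thesis using \<open>D > 0\<close> by (auto simp: almost_integral_def)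
qed

text \<open>With \<open>r = a / b\<close> in lowest terms every power of \<open>b\<close> divides
  the fixed integer \<open>D\<close>; for \<open>b\<close> at least 2 the powers outgrow it.\<close>

lemma almost_integral_const: assumes "almost_integral (cyc_const r)" shows "r \<in> \<int>"
proof -
  obtain D where "D > 0" and D: "\<And>k. of_int D * cyc_const r ^ k \<in> range cint"
    using assms by (auto simp: almost_integral_def)
  have pw: "cyc_const r ^ k = cyc_const (r ^ k)" for k
    by (induction k) (simp_all add: cyc_const_def one_cyc_def Let_def)
  have int: "of_int D * r ^ k \<in> \<int>" for k
  proof -
    obtain y where "of_int D * cyc_const r ^ k = cint y" using D by auto
    then have "of_int D * cyc_const (r ^ k) = cint y" by (simp only: pw)
    then show ?thesis by (cases y) (auto simp: cyc_const_def of_int_cyc Let_def)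
  qed
  obtain a b where r: "r = of_int a / of_int b" and b: "b > 0" and co: "coprime a b"
    by (metis quotient_of_div quotient_of_denom_pos quotient_of_coprime surj_pair)
  have dv: "b ^ k dvd D" for k
  proof -
    obtain n where "of_int D * r ^ k = of_int n" using int[of k] by (auto elim: Ints_cases)
    then have "of_int (D * a ^ k) = (of_int (n * b ^ k) :: rat)" using b by (simp add: r field_simps)
    then have "D * a ^ k = n * b ^ k" by (simp only: of_int_eq_iff)
    then have "b ^ k dvd a ^ k * D" by (metis dvd_triv_right mult.commute)
    moreover have "coprime (b ^ k) (a ^ k)" using co by (simp add: coprime_commute)
    ultimately show ?thesis using coprime_dvd_mult_right_iff by blast
  qed
  have "b = 1"
  proof (rule ccontr)
    assume "b \<noteq> 1"
    then have "2 ^ nat D \<le> b ^ nat D" using b by (intro power_mono) auto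
    also have "\<dots> \<le> D" using dv \<open>D > 0\<close> by (simp add: zdvd_imp_le)
    finally show False using of_nat_less_two_power[of "nat D", where 'a = int] \<open>D > 0\<close> by simp
  qed
  then show ?thesis using r by simp
qed

lemma common_denominator: "\<exists>d>0. of_int d * x \<in> range cint"
proof (cases x)
  case (Cyc a b c d)
  have den: "\<exists>m>0::int. \<exists>n::int. of_int m * r = of_int n" for r :: rat
  proof -
    obtain p q where "r = of_int p / of_int q" "q > 0" by (metis quotient_of_div quotient_of_denom_pos surj_pair)
    then show ?thesis by (intro exI[of _ q] conjI exI[of _ p]) auto
  qed
  obtain m1 n1 where 1: "m1 > 0" "of_int m1 * a = of_int n1" using den by blast
  obtain m2 n2 where 2: "m2 > 0" "of_int m2 * b = of_int n2" using den by blast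
  obtain m3 n3 where 3: "m3 > 0" "of_int m3 * c = of_int n3" using den by blast
  obtain m4 n4 where 4: "m4 > 0" "of_int m4 * d = of_int n4" using den by blast
  have "of_int (m1 * m2 * m3 * m4) * x = Cyc (of_int (m2 * m3 * m4) * (of_int m1 * a)) (of_int (m1 * m3 * m4) * (of_int m2 * b))
     (of_int (m1 * m2 * m4) * (of_int m3 * c)) (of_int (m1 * m2 * m3) * (of_int m4 * d))"
    unfolding of_int_cyc Cyc by (simp add: Let_def)
  also have "\<dots> = cint (Cyc (m2 * m3 * m4 * n1) (m1 * m3 * m4 * n2) (m1 * m2 * m4 * n3) (m1 * m2 * m3 * n4))"
    unfolding 1 2 3 4 by simp
  finally have "of_int (m1 * m2 * m3 * m4) * x \<in> range cint" by (rule range_eqI)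
  moreover have "m1 * m2 * m3 * m4 > 0" using 1 2 3 4 by simp
  ultimately show ?thesis by blast
qed

text \<open>If \<open>d\<close> clears the denominators of \<open>x\<close>, then d^n clears those
  of all powers below the degree n, and the monic equation expresses every higher power by n
  preceding ones with integral coefficients.\<close>

lemma algebraic_int_imp_almost_integral:
  assumes w: "prim5 w" and x: "algebraic_int (cval w x)" shows "almost_integral x"
proof -
  from x obtain p where lc: "lead_coeff p = 1" and ints: "\<forall>i. coeff p i \<in> \<int>" and p0: "poly p (cval w x) = 0"
    by (rule algebraic_int.cases) simp
  define n where "n = degree p"
  have "\<forall>i. \<exists>k. coeff p i = of_int k" using ints unfolding Ints_def by blast
  from choice[OF this] obtain c where c: "\<And>i. coeff p i = of_int (c i)" by blast
  have n: "n > 0"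
  proof (rule ccontr)
    assume "\<not> n > 0"
    then show False using p0 lc by (simp add: poly_altdef n_def)
  qed
  have "cval w x ^ n + (\<Sum>i<n. of_int (c i) * cval w x ^ i) = 0"
    using p0 lc[folded n_def] unfolding poly_altdef n_def[symmetric] lessThan_Suc_atMost[symmetric]
    by (simp add: add.commute) (simp add: c)
  moreover have cs: "cval w (\<Sum>i\<in>A. f i) = (\<Sum>i\<in>A. cval w (f i))" if "finite A" for f and A :: "nat set"
    using that by (induction A rule: finite_induct) (simp_all add: cval_add)
  ultimately have "cval w (x ^ n + (\<Sum>i<n. of_int (c i) * x ^ i)) = 0"
    by (simp add: cval_add cval_mul[OF w] cval_power[OF w] cval_of_int)
  from cval_eq_0[OF w this] have xn: "x ^ n = - (\<Sum>i<n. of_int (c i) * x ^ i)"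
    by (simp add: eq_neg_iff_add_eq_0)
  obtain d where d: "d > 0" "of_int d * x \<in> range cint" using common_denominator by blast
  have "of_int (d ^ n) * x ^ k \<in> range cint" for k
  proof (induction k rule: less_induct)
    case (less k)
    show ?case
    proof (cases "k < n")
      case True
      have "of_int (d ^ n) * x ^ k = of_int (d ^ (n - k)) * (of_int d * x) ^ k"
        using True by (simp add: power_mult_distrib mult.assoc[symmetric] power_add[symmetric])
      then show ?thesis by (simp only:) (intro range_cint_mult range_cint_of_int range_cint_power d)
    next
      case False
      have "x ^ k = x ^ (k - n) * x ^ n" using False by (simp add: power_add[symmetric])
      also have "\<dots> = - (\<Sum>i<n. of_int (c i) * x ^ (k - n + i))"
        unfolding xn by (simp add: sum_distrib_left power_add mult_ac)
      finally have eq: "of_int (d ^ n) * x ^ k = - (\<Sum>i<n. of_int (c i) * (of_int (d ^ n) * x ^ (k - n + i)))"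
        by (simp add: sum_distrib_left mult_ac)
      have "of_int (d ^ n) * x ^ (k - n + i) \<in> range cint" if "i < n" for i
        using less.IH[of "k - n + i"] that False by auto
      then show ?thesis
        unfolding eq by (intro range_cint_uminus range_cint_sum) (metis lessThan_iff range_cint_mult range_cint_of_int)
    qed
  qed
  then show ?thesis unfolding almost_integral_def using d(1) by (intro exI[of _ "d ^ n"]) auto
qed

section \<open>Trace, norm and the prime above five\<close>

lemma cyc_gal_gal: "cyc_gal (cyc_gal x) = cyc_conj (x :: 'a::comm_ring_1 cyc)"
  by (cases x) simp

fun cyc_trace :: "'a::comm_ring_1 cyc \<Rightarrow> 'a" where
  "cyc_trace (Cyc a b c d) = 4 * a - b - c - d"

definition cyc_norm :: "'a::comm_ring_1 cyc \<Rightarrow> 'a cyc" where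
  "cyc_norm x = x * cyc_conj x * cyc_gal (x * cyc_conj x)"

lemma trace_eq: "x + cyc_gal x + cyc_conj x + cyc_gal (cyc_conj x) = cyc_const (cyc_trace x)"
  by (cases x) (simp add: cyc_const_def)

lemma almost_integral_trace: assumes "almost_integral x" shows "cyc_trace x \<in> \<int>"
  using assms by (intro almost_integral_const, fold trace_eq)
    (intro almost_integral_add; simp add: almost_integral_gal flip: cyc_gal_gal)

lemma norm_const: "\<exists>n. cyc_norm x = cyc_const (n :: 'a::comm_ring_1)"
proof -
  obtain a b c d where x: "x = Cyc a b c d" by (cases x)
  define m where "m = a * a + b * b + c * c + d * d - (a * b + b * c + c * d)"
  define k where "k = a * c + a * d + b * d - (a * b + b * c + c * d)"
  have n: "x * cyc_conj x = Cyc m 0 k k"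
    by (simp add: x Let_def m_def k_def algebra_simps)
  show ?thesis unfolding cyc_norm_def n
    by (rule exI[of _ "m * m - m * k - k * k"]) (simp add: cyc_const_def Let_def algebra_simps)
qed

lemma conj_mult: "cyc_conj (x * y) = cyc_conj x * cyc_conj (y :: 'a::comm_ring_1 cyc)"
  by (simp add: gal_mult flip: cyc_gal_gal)

lemma cyc_norm_mult: "cyc_norm (x * y) = cyc_norm x * cyc_norm (y :: 'a::comm_ring_1 cyc)"
  by (simp add: cyc_norm_def gal_mult conj_mult mult_ac)

text \<open>The element 1 - w, of norm 5, generates the prime above 5.\<close>

definition lam :: "'a::comm_ring_1 cyc" where "lam = Cyc 1 (-1) 0 0"

text \<open>Taking norms gives c^4 = 5 N(t), and N(t) is an integer because it is rational and
  almost integral.\<close>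

lemma lam_dvd_int:
  assumes "almost_integral t" "of_int c = lam * t" shows "5 dvd c"
proof -
  obtain n where n: "cyc_norm t = cyc_const n" using norm_const by blast
  have "almost_integral (cyc_norm t)" unfolding cyc_norm_def
    by (intro almost_integral_mult almost_integral_gal assms) (simp_all add: almost_integral_gal assms flip: cyc_gal_gal)
  then obtain m where m: "n = of_int m" unfolding n by (metis almost_integral_const Ints_cases)
  have "cyc_norm (of_int c) = cyc_norm (lam :: rat cyc) * cyc_norm t" unfolding assms(2) cyc_norm_mult ..
  moreover have "cyc_norm (of_int c) = cyc_const (of_int (c ^ 4) :: rat)"
    by (simp add: cyc_norm_def of_int_cyc cyc_const_def Let_def eval_nat_numeral)
  moreover have "cyc_norm (lam :: rat cyc) = cyc_const 5"
    by (simp add: cyc_norm_def lam_def cyc_const_def Let_def)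
  ultimately have "(of_int (c ^ 4) :: rat) = of_int (5 * m)"
    unfolding n m by (simp add: cyc_const_def Let_def)
  then have "5 dvd c ^ 4" by (metis dvd_triv_left of_int_eq_iff)
  then show ?thesis using prime_dvd_power[of "5::int" c 4] by simp
qed

lemma lam_cancel: assumes "lam * x = lam * (y :: rat cyc)" shows "x = y"
proof -
  have "lam * Cyc (4/5) (3/5) (2/5) (1/5) = (1 :: rat cyc)"
    by (simp add: lam_def one_cyc_def Let_def)
  then have "Cyc (4/5) (3/5) (2/5) (1/5) * (lam * x) = x" "Cyc (4/5) (3/5) (2/5) (1/5) * (lam * y) = y"
    by (metis mult.assoc mult.commute mult_1)+
  with assms show ?thesis by metis
qed

text \<open>The ring of integers is spanned by the powers of w. Traces bring the denominators down
  to 5. The digits of \<open>5 x\<close> in powers of \<open>lam\<close> are then treated in turn,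
  since 5 is divisible by the fourth power of \<open>lam\<close>: the lowest digit is a multiple of
  \<open>lam\<close>, hence of 5, and after it has been absorbed into \<open>x\<close> one factor
  \<open>lam\<close> cancels.\<close>

lemma almost_integral_range: assumes "almost_integral x" shows "x \<in> range cint"
proof -
  obtain a0 a1 a2 a3 where x: "x = Cyc a0 a1 a2 a3" by (cases x)
  note ai = almost_integral_mult almost_integral_add almost_integral_diff almost_integral_of_int almost_integral_cint
  have t: "cyc_trace (x * cint u) \<in> \<int>" for u by (intro almost_integral_trace ai assms)
  have "cyc_trace (x * cint (Cyc 0 1 0 0)) = - a0 - a1 - a2 - a3" by (simp add: x Let_def)
  then have t4: "- a0 - a1 - a2 - a3 \<in> \<int>" using t by metis
  \<comment> \<open>All nontrivial fifth roots of unity have trace -1, so the trace of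
    \<open>x\<close> times a suitable power of w singles out one coefficient with factor 4;
    subtracting the trace of x w makes it 5 and removes the others.\<close>
  have "5 * a0 \<in> \<int>" "5 * a1 \<in> \<int>" "5 * a2 \<in> \<int>" "5 * a3 \<in> \<int>"
    using Ints_diff[OF t[of "Cyc 1 0 0 0"] t4] Ints_diff[OF t[of "Cyc (-1) (-1) (-1) (-1)"] t4]
      Ints_diff[OF t[of "Cyc 0 0 0 1"] t4] Ints_diff[OF t[of "Cyc 0 0 1 0"] t4]
    by (simp_all add: x Let_def algebra_simps)
  then obtain b0 b1 b2 b3 where b: "5 * a0 = of_int b0" "5 * a1 = of_int b1" "5 * a2 = of_int b2" "5 * a3 = of_int b3"
    by (metis Ints_cases)
  \<comment> \<open>These are the digits of \<open>5 x\<close> after substituting w = 1 -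
    \<open>lam\<close>.\<close>
  define c0 where "c0 = b0 + b1 + b2 + b3"
  define c1 where "c1 = - b1 - 2 * b2 - 3 * b3"
  define c2 where "c2 = b2 + 3 * b3"
  define c3 where "c3 = - b3"
  let ?l = "lam :: rat cyc"
  define u :: "rat cyc" where "u = Cyc (-1) (-1) 0 1"
  have five: "of_int 5 = ?l * (?l * (?l * (?l * u)))"
    by (simp add: lam_def u_def of_int_cyc Let_def)
  have h: "of_int 5 * x = of_int c0 + ?l * (of_int c1 + ?l * (of_int c2 + ?l * of_int c3))"
    by (simp add: x of_int_cyc Let_def lam_def b c0_def c1_def c2_def c3_def)
  have ail: "almost_integral ?l" using almost_integral_cint[of lam] by (simp add: lam_def)
  have aiu: "almost_integral u" using almost_integral_cint[of "Cyc (-1) (-1) 0 1"] by (simp add: u_def)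
  note ai = ai ail aiu assms
  have "of_int c0 = ?l * (?l * (?l * (?l * u)) * x - (of_int c1 + ?l * (of_int c2 + ?l * of_int c3)))"
    using h unfolding five by (simp add: algebra_simps)
  then have "5 dvd c0" by (intro lam_dvd_int[rotated]) (auto intro!: ai)
  then obtain e0 where e0: "c0 = 5 * e0" by (elim dvdE)
  define x1 where "x1 = x - of_int e0"
  have ai1: "almost_integral x1" unfolding x1_def by (intro ai)
  have "?l * (?l * (?l * (?l * u)) * x1) = ?l * (of_int c1 + ?l * (of_int c2 + ?l * of_int c3))"
    using h unfolding x1_def e0 of_int_mult five by (simp add: algebra_simps)
  then have h1: "?l * (?l * (?l * u)) * x1 = of_int c1 + ?l * (of_int c2 + ?l * of_int c3)"
    by (rule lam_cancel)
  then have "of_int c1 = ?l * (?l * (?l * u) * x1 - (of_int c2 + ?l * of_int c3))"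
    by (simp add: algebra_simps)
  then have "5 dvd c1" by (intro lam_dvd_int[rotated]) (auto intro!: ai ai1)
  then obtain e1 where e1: "c1 = 5 * e1" by (elim dvdE)
  define x2 where "x2 = x1 - ?l * of_int e1"
  have ai2: "almost_integral x2" unfolding x2_def by (intro ai ai1)
  have "?l * (?l * (?l * u) * x2) = ?l * (of_int c2 + ?l * of_int c3)"
    using h1 unfolding x2_def e1 of_int_mult five by (simp add: algebra_simps)
  then have h2: "?l * (?l * u) * x2 = of_int c2 + ?l * of_int c3"
    by (rule lam_cancel)
  then have "of_int c2 = ?l * (?l * u * x2 - of_int c3)"
    by (simp add: algebra_simps)
  then have "5 dvd c2" by (intro lam_dvd_int[rotated]) (auto intro!: ai ai2)
  then obtain e2 where e2: "c2 = 5 * e2" by (elim dvdE)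
  define x3 where "x3 = x2 - ?l * (?l * of_int e2)"
  have ai3: "almost_integral x3" unfolding x3_def by (intro ai ai2)
  have "?l * (?l * u * x3) = ?l * of_int c3"
    using h2 unfolding x3_def e2 of_int_mult five by (simp add: algebra_simps)
  then have "?l * u * x3 = of_int c3"
    by (rule lam_cancel)
  then have "of_int c3 = ?l * (u * x3)"
    by (simp add: algebra_simps)
  then have "5 dvd c3" by (intro lam_dvd_int[rotated]) (auto intro!: ai ai3)
  then obtain e3 where e3: "c3 = 5 * e3" by (elim dvdE)
  have b3: "b3 = 5 * (- e3)" using e3 unfolding c3_def by simp
  have b2: "b2 = 5 * (e2 + 3 * e3)" using e2 unfolding c2_def b3 by simp
  have b1: "b1 = 5 * (- e1 - 2 * e2 - 3 * e3)" using e1 unfolding c1_def b2 b3 by simp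
  have b0: "b0 = 5 * (e0 + e1 + e2 + e3)" using e0 unfolding c0_def b1 b2 b3 by simp
  have "a3 = of_int (- e3)" "a2 = of_int (e2 + 3 * e3)" "a1 = of_int (- e1 - 2 * e2 - 3 * e3)" "a0 = of_int (e0 + e1 + e2 + e3)"
    using b unfolding b0 b1 b2 b3 by simp_all
  then have "x = cint (Cyc (e0 + e1 + e2 + e3) (- e1 - 2 * e2 - 3 * e3) (e2 + 3 * e3) (- e3))"
    by (simp add: x)
  then show ?thesis by blast
qed

text \<open>\<open>x\<close> and its conjugate are the roots of a quadratic polynomial over the real
  subfield. Multiplying it by its image under s -> -1 - s gives the monic integral quartic
  \<open>?p\<close>; the identity \<open>id\<close> shows this modulo the equation for s.\<close>

lemma algebraic_int_ival: assumes w: "prim5 w" shows "algebraic_int (ival w x)"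
proof -
  obtain a b c d where x: "x = Cyc a b c d" by (cases x)
  define t0 t1 m k where "t0 = 2 * a - b" and "t1 = c + d - b"
    and "m = a * a + b * b + c * c + d * d - (a * b + b * c + c * d)"
    and "k = a * c + a * d + b * d - (a * b + b * c + c * d)"
  let ?s = "w\<^sup>2 + w ^ 3"
  have s2: "?s\<^sup>2 = 1 - ?s" by (rule prim5_golden[OF w])
  have t: "x + cyc_conj x = Cyc t0 0 t1 t1" by (simp add: x t0_def t1_def)
  have n: "x * cyc_conj x = Cyc m 0 k k"
    by (simp add: x Let_def m_def k_def algebra_simps)
  let ?z = "ival w x"
  have T: "?z + cnj ?z = of_int t0 + of_int t1 * ?s"
    using arg_cong[OF t, of "ival w"] by (simp add: cint_add cval_add cint_conj cval_conj[OF w] algebra_simps)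
  have N: "?z * cnj ?z = of_int m + of_int k * ?s"
    using arg_cong[OF n, of "ival w"] by (simp add: cint_mult cval_mul[OF w] cint_conj cval_conj[OF w] algebra_simps)
  have q: "?z\<^sup>2 - (of_int t0 + of_int t1 * ?s) * ?z + (of_int m + of_int k * ?s) = 0"
    unfolding T[symmetric] N[symmetric] by (simp add: algebra_simps power2_eq_square)
  let ?p = "[: of_int (m\<^sup>2 - m * k - k\<^sup>2), of_int (- (2 * m * t0 - m * t1 - t0 * k - 2 * t1 * k)),
      of_int (2 * m - k + (t0\<^sup>2 - t0 * t1 - t1\<^sup>2)), of_int (- (2 * t0 - t1)), 1 :] :: complex poly"
  have id: "A\<^sup>2 * A\<^sup>2 + (- (2 * T0 - T1)) * (A * A\<^sup>2) + (2 * M - K + (T0\<^sup>2 - T0 * T1 - T1\<^sup>2)) * A\<^sup>2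
      + (- (2 * M * T0 - M * T1 - T0 * K - 2 * T1 * K)) * A + (M\<^sup>2 - M * K - K\<^sup>2)
     = (A\<^sup>2 - (T0 + T1 * S) * A + (M + K * S)) * (A\<^sup>2 - (T0 - T1 - T1 * S) * A + (M - K - K * S))
       - (S\<^sup>2 - (1 - S)) * - ((T1 * A - K)\<^sup>2)" for A T0 T1 M K S :: complex
    by (simp add: algebra_simps power2_eq_square)
  have "poly ?p ?z = 0"
    using id[of ?z "of_int t0" "of_int t1" "of_int m" "of_int k" ?s] unfolding q s2
    by (simp add: algebra_simps power2_eq_square)
  then show ?thesis
    by (intro algebraic_int.intros[of ?p]) (auto simp: coeff_pCons simp del: of_int_diff of_int_add of_int_mult of_int_minus of_int_power split: nat.splits)
qed

lemma O5_eq: "O5 = range (ival zeta)"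
proof
  show "O5 \<subseteq> range (ival zeta)"
  proof
    fix z assume "z \<in> O5"
    then obtain x where "z = cval zeta x" "algebraic_int (cval zeta x)" by (auto simp: O5_def F5_eq)
    with almost_integral_range[OF algebraic_int_imp_almost_integral[OF zeta_prim5]]
    show "z \<in> range (ival zeta)" by auto
  qed
  show "range (ival zeta) \<subseteq> O5" using algebraic_int_ival[OF zeta_prim5] by (auto simp: O5_def F5_eq)
qed

lemma norm_const_int: "\<exists>n. cyc_norm (x :: int cyc) = of_int n"
proof -
  obtain n where "cyc_norm x = cyc_const n" using norm_const by blast
  then show ?thesis by (intro exI[of _ n]) (simp add: of_int_cyc cyc_const_def)
qed

section \<open>Perfect facets and faces of the Voronoi polyhedron\<close>

text \<open>Finitely many successive refinements suffice, since what has been secured passes to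
  later subsequences.\<close>

lemma common_subsequence:
  assumes "finite A"
    and ex: "\<And>x r. x \<in> A \<Longrightarrow> strict_mono (r :: nat \<Rightarrow> nat) \<Longrightarrow> \<exists>s. strict_mono (s :: nat \<Rightarrow> nat) \<and> P x (r \<circ> s)"
    and st: "\<And>x r s. P x r \<Longrightarrow> strict_mono s \<Longrightarrow> P x (r \<circ> s)"
  shows "\<exists>r. strict_mono r \<and> (\<forall>x\<in>A. P x r)"
  using \<open>finite A\<close> ex
proof (induction A rule: finite_induct)
  case empty
  show ?case by (intro exI[of _ id]) (auto simp: strict_mono_def)
next
  case (insert x A)
  then obtain r where r: "strict_mono r" "\<forall>y\<in>A. P y r" by (metis insertCI)
  obtain s where s: "strict_mono s" "P x (r \<circ> s)" using insert.prems[of x r] r by blast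
  show ?case
  proof (intro exI[of _ "r \<circ> s"] conjI ballI)
    show "strict_mono (r \<circ> s)" using r(1) s(1) by (rule strict_mono_o)
    fix y assume "y \<in> insert x A"
    then show "P y (r \<circ> s)" using s(2) st[OF _ s(1)] r(2) by blast
  qed
qed

lemma exposed_face:
  assumes "convex S" "linear (l :: 'a::euclidean_space \<Rightarrow> real)" "\<And>x. x \<in> S \<Longrightarrow> m \<le> l x"
  shows "{x \<in> S. l x = m} face_of S"
proof -
  have l: "l (x + y) = l x + l y" "l (t *\<^sub>R x) = t * l x" for x y t
    using assms(2) by (simp_all add: linear_add linear_scale)
  have cv: "convex {x \<in> S. l x = m}"
    unfolding convex_def
  proof (intro ballI allI impI)
    fix x y and u v :: real assume *: "x \<in> {x \<in> S. l x = m}" "y \<in> {x \<in> S. l x = m}" "0 \<le> u" "0 \<le> v" "u + v = 1"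
    then have "u *\<^sub>R x + v *\<^sub>R y \<in> S" using assms(1) by (auto simp: convex_def)
    moreover have "u * m + v * m = m" using * by (metis distrib_right mult_1)
    ultimately show "u *\<^sub>R x + v *\<^sub>R y \<in> {x \<in> S. l x = m}" using * by (simp add: l)
  qed
  show ?thesis
    unfolding face_of_def
  proof (intro conjI ballI impI cv)
    show "{x \<in> S. l x = m} \<subseteq> S" by blast
    fix a b x assume a: "a \<in> S" and b: "b \<in> S" and x: "x \<in> {x \<in> S. l x = m}" and seg: "x \<in> open_segment a b"
    obtain u where u: "0 < u" "u < 1" "x = (1 - u) *\<^sub>R a + u *\<^sub>R b" using seg by (auto simp: in_segment)
    have "l x = (1 - u) * l a + u * l b" unfolding u(3) by (simp add: l)
    then have eq: "(1 - u) * (l a - m) + u * (l b - m) = 0" using x by (simp add: algebra_simps)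
    have "(1 - u) * (l a - m) \<ge> 0" "u * (l b - m) \<ge> 0" using u assms(3)[OF a] assms(3)[OF b] by simp_all
    then have "(1 - u) * (l a - m) = 0" "u * (l b - m) = 0" using eq by linarith+
    then show "a \<in> {x \<in> S. l x = m}" "b \<in> {x \<in> S. l x = m}" using u a b by auto
  qed
qed

text \<open>\<open>a + r\<close> lies strictly between \<open>a\<close> and each later point of the
  ray, so the face property draws the rest of the ray into \<open>P\<close>, against
  boundedness.\<close>

lemma face_of_ray:
  fixes P :: "'a::real_normed_vector set"
  assumes "P face_of S" "bounded P" "a + r \<in> P" "\<And>t. t \<ge> 0 \<Longrightarrow> a + t *\<^sub>R r \<in> S"
  shows "r = 0"
proof (rule ccontr)
  assume r: "r \<noteq> 0"
  have ray: "a + t *\<^sub>R r \<in> P" if "t > 1" for t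
  proof -
    have "a + r \<in> open_segment a (a + t *\<^sub>R r)"
      unfolding in_segment using r that
      by (intro conjI exI[of _ "1 / t"]) (auto simp: algebra_simps)
    moreover have "a \<in> S" using assms(4)[of 0] by simp
    ultimately show ?thesis using assms(1,3) assms(4)[of t] that unfolding face_of_def by auto
  qed
  obtain B where B: "\<And>x. x \<in> P \<Longrightarrow> norm x \<le> B" using assms(2) unfolding bounded_iff by blast
  define t where "t = 2 + (\<bar>B\<bar> + norm a) / norm r"
  have t: "t > 1" using r by (simp add: t_def add_pos_nonneg)
  have "t * norm r = 2 * norm r + (\<bar>B\<bar> + norm a)" using r by (simp add: t_def field_simps)
  moreover have "norm (t *\<^sub>R r) \<le> norm (a + t *\<^sub>R r) + norm a" by (metis add_diff_cancel_left' norm_triangle_ineq4)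
  moreover have "norm r > 0" using r by simp
  moreover have "norm (t *\<^sub>R r) = t * norm r" using t by simp
  ultimately have "norm (a + t *\<^sub>R r) > B" by linarith
  then show False using B[OF ray[OF t]] by simp
qed

text \<open>Keeps the geometry apart from the arithmetic. In the application \<open>V\<close>
  consists of the nonzero lattice points on the rays of \<open>C1\<close>, \<open>Q\<close> is the
  pairing with the perfect form, \<open>X\<close> is the set of the 24 vertices and \<open>H\<close>
  contains one group element for each facet of the cone over \<open>X\<close>. By
  \<open>Q_ge_norm\<close> the points of \<open>V\<close> of bounded value are bounded in norm. The
  incidence certificates supply \<open>complete\<close>.\<close>

locale voronoi =
  fixes V :: "'a::euclidean_space set" and G :: "('a \<Rightarrow> 'a) set" and Q :: "'a \<Rightarrow> real"
    and X :: "'a set" and H :: "('a \<Rightarrow> 'a) set" and c :: real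
  assumes linear_G: "g \<in> G \<Longrightarrow> linear g"
    and id_G: "id \<in> G"
    and comp_G: "g \<in> G \<Longrightarrow> h \<in> G \<Longrightarrow> g \<circ> h \<in> G"
    and inverse_G: "g \<in> G \<Longrightarrow> \<exists>h\<in>G. (\<forall>x. g (h x) = x) \<and> (\<forall>x. h (g x) = x)"
    and G_V: "g \<in> G \<Longrightarrow> v \<in> V \<Longrightarrow> g v \<in> V"
    and linear_Q: "linear Q"
    and Q_int: "v \<in> V \<Longrightarrow> Q v \<in> \<int>"
    and c_pos: "c > 0"
    and Q_ge_norm: "v \<in> V \<Longrightarrow> c * norm v \<le> Q v"
    and V_nz: "0 \<notin> V"
    and V_mult: "v \<in> V \<Longrightarrow> n > 0 \<Longrightarrow> real n *\<^sub>R v \<in> V"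
    and finite_X: "finite X" and X_V: "X \<subseteq> V" and Q_X: "x \<in> X \<Longrightarrow> Q x = 1"
    and finite_H: "finite H" and H_G: "H \<subseteq> G"
    and complete: "p \<in> span V \<Longrightarrow> (\<And>h. h \<in> H \<Longrightarrow> Q p \<le> Q (h p)) \<Longrightarrow>
       \<exists>a. (\<forall>x\<in>X. 0 \<le> a x) \<and> p = (\<Sum>x\<in>X. a x *\<^sub>R x)"
begin

definition Pi :: "'a set" where "Pi = closure (convex hull V)"
definition P0 :: "'a set" where "P0 = convex hull X"

lemma Q_V_ge_1: assumes "v \<in> V" shows "Q v \<ge> 1"
proof -
  have "v \<noteq> 0" using assms V_nz by auto
  then have "Q v > 0" using Q_ge_norm[OF assms] c_pos by (metis less_le_trans mult_pos_pos zero_less_norm_iff)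
  moreover obtain k where "Q v = of_int k" using Q_int[OF assms] by (auto elim: Ints_cases)
  ultimately show ?thesis by simp
qed

lemma Q_sum: "Q (\<Sum>i\<in>A. f i) = (\<Sum>i\<in>A. Q (f i))"
  by (rule linear_sum[OF linear_Q])

lemma Q_scale: "Q (t *\<^sub>R x) = t * Q x"
  using linear_scale[OF linear_Q] by simp

lemma Q_diff: "Q (x - y) = Q x - Q y"
  by (rule linear_diff[OF linear_Q])

lemma linear_QG: "g \<in> G \<Longrightarrow> linear (\<lambda>x. Q (g x))"
  using linear_compose[OF linear_G linear_Q] by (simp add: o_def)

lemma closed_convex_ge:
  assumes "linear (l :: 'a \<Rightarrow> real)" "\<And>v. v \<in> V \<Longrightarrow> m \<le> l v" "p \<in> Pi"
  shows "m \<le> l p"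
proof -
  have l: "l (x + y) = l x + l y" "l (t *\<^sub>R x) = t * l x" for x y t
    using assms(1) by (simp_all add: linear_add linear_scale)
  have "convex {p. m \<le> l p}"
    unfolding convex_def
  proof (intro ballI allI impI)
    fix x y and u v :: real assume *: "x \<in> {p. m \<le> l p}" "y \<in> {p. m \<le> l p}" "0 \<le> u" "0 \<le> v" "u + v = 1"
    have "u * m + v * m \<le> u * l x + v * l y" using * by (intro add_mono mult_left_mono) auto
    moreover have "u * m + v * m = m" using * by (metis distrib_right mult_1)
    ultimately show "u *\<^sub>R x + v *\<^sub>R y \<in> {p. m \<le> l p}" by (simp add: l)
  qed
  moreover have "continuous_on UNIV l"
    using assms(1) by (intro linear_continuous_on) (simp add: linear_conv_bounded_linear[symmetric])
  then have "closed {p. m \<le> l p}" by (intro closed_Collect_le continuous_on_const) auto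
  ultimately have "closure (convex hull V) \<subseteq> {p. m \<le> l p}"
    using assms(2) by (intro closure_minimal hull_minimal) auto
  then show ?thesis using assms(3) by (auto simp: Pi_def)
qed

lemma QG_Pi: "g \<in> G \<Longrightarrow> p \<in> Pi \<Longrightarrow> 1 \<le> Q (g p)"
  by (rule closed_convex_ge[OF linear_QG]) (auto intro: Q_V_ge_1 G_V)

lemma Q_Pi: "p \<in> Pi \<Longrightarrow> 1 \<le> Q p"
  using QG_Pi[OF id_G] by simp

lemma zero_notin_Pi: "0 \<notin> Pi"
  using Q_Pi[of 0] linear_0[OF linear_Q] by auto

lemma convex_Pi: "convex Pi" and closed_Pi: "closed Pi"
  by (simp_all add: Pi_def convex_closure)

lemma hull_Pi: "convex hull V \<subseteq> Pi"
  unfolding Pi_def by (rule closure_subset)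

lemma G_hull: assumes "g \<in> G" "p \<in> convex hull V" shows "g p \<in> convex hull V"
proof -
  have "g ` (convex hull V) = convex hull (g ` V)"
    by (rule convex_hull_linear_image[OF linear_G[OF assms(1)]])
  also have "\<dots> \<subseteq> convex hull V" using G_V[OF assms(1)] by (intro hull_mono) auto
  finally show ?thesis using assms(2) by auto
qed

lemma G_Pi: assumes "g \<in> G" "p \<in> Pi" shows "g p \<in> Pi"
proof -
  have "continuous_on (closure (convex hull V)) g"
    using linear_G[OF assms(1)] by (simp add: linear_continuous_on linear_conv_bounded_linear)
  then have "g ` closure (convex hull V) \<subseteq> closure (g ` (convex hull V))"
    by (rule image_closure_subset) (auto simp: closure_subset)
  also have "\<dots> \<subseteq> closure (convex hull V)"
    using G_hull[OF assms(1)] by (intro closure_mono) auto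
  finally show ?thesis using assms(2) unfolding Pi_def by auto
qed

lemma G_image_Pi: assumes "g \<in> G" shows "g ` Pi = Pi"
proof
  show "g ` Pi \<subseteq> Pi" using G_Pi[OF assms] by auto
  obtain h where "h \<in> G" "\<forall>x. g (h x) = x" using inverse_G[OF assms] by blast
  then show "Pi \<subseteq> g ` Pi" using G_Pi[of h] by (metis imageI subsetI)
qed

lemma inj_G: "g \<in> G \<Longrightarrow> inj g"
  using inverse_G by (metis injI)

text \<open>\<open>V\<close> admits only integral multiples, so a real factor is reached on the
  segment from \<open>v\<close> to \<open>n v\<close>. This upward closure is what provides rays
  inside the polyhedron.\<close>

lemma scale_Pi: assumes p: "p \<in> Pi" and t: "1 \<le> t" shows "t *\<^sub>R p \<in> Pi"
proof -
  have v: "t *\<^sub>R v \<in> convex hull V" if "v \<in> V" for v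
  proof -
    obtain n :: nat where n: "t \<le> real n" using real_arch_simple by blast
    then have "n > 0" using t by (cases n) auto
    then have "real n *\<^sub>R v \<in> V" using V_mult that by blast
    then have S: "closed_segment v (real n *\<^sub>R v) \<subseteq> convex hull V"
      using that by (intro closed_segment_subset_convex_hull) (auto intro: hull_inc)
    have "t *\<^sub>R v \<in> closed_segment v (real n *\<^sub>R v)"
    proof (cases "real n = 1")
      case True then show ?thesis using n t by (simp add: antisym)
    next
      case False
      then have n1: "real n > 1" using n t by linarith
      define u where "u = (t - 1) / (real n - 1)"
      have "u * (real n - 1) = t - 1" using n1 by (simp add: u_def)
      then have "t = (1 - u) + u * real n" by (simp add: algebra_simps)
      then have "t *\<^sub>R v = (1 - u) *\<^sub>R v + u *\<^sub>R (real n *\<^sub>R v)" by (metis scaleR_add_left scaleR_scaleR)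
      moreover have "0 \<le> u" "u \<le> 1" using n1 n t by (simp_all add: u_def)
      ultimately show ?thesis unfolding in_segment by blast
    qed
    then show ?thesis using S by blast
  qed
  have lin: "linear (\<lambda>x::'a. t *\<^sub>R x)" by (simp add: linear_scale_self)
  have "(\<lambda>x. t *\<^sub>R x) ` (convex hull V) = convex hull ((\<lambda>x. t *\<^sub>R x) ` V)"
    by (rule convex_hull_linear_image[OF lin])
  also have "\<dots> \<subseteq> convex hull V" using v by (intro hull_minimal) auto
  finally have sub: "(\<lambda>x. t *\<^sub>R x) ` (convex hull V) \<subseteq> convex hull V" .
  have "(\<lambda>x. t *\<^sub>R x) ` closure (convex hull V) \<subseteq> closure ((\<lambda>x. t *\<^sub>R x) ` (convex hull V))"
    by (rule image_closure_subset) (auto simp: closure_subset intro!: continuous_intros)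
  also have "\<dots> \<subseteq> closure (convex hull V)" by (rule closure_mono[OF sub])
  finally show ?thesis using p unfolding Pi_def by auto
qed

lemma P0_Pi: "P0 \<subseteq> Pi"
  unfolding P0_def using hull_mono[OF X_V] hull_Pi by blast

lemma Q_P0: "p \<in> P0 \<Longrightarrow> Q p = 1"
proof -
  assume "p \<in> P0"
  then obtain u where u: "sum u X = 1" "(\<Sum>x\<in>X. u x *\<^sub>R x) = p"
    unfolding P0_def convex_hull_finite[OF finite_X] by blast
  have "Q p = (\<Sum>x\<in>X. u x * Q x)" unfolding u(2)[symmetric] Q_sum Q_scale ..
  also have "\<dots> = 1" using u(1) Q_X by simp
  finally show ?thesis .
qed

lemma Pi_span: "Pi \<subseteq> span V"
proof -
  have "convex hull V \<subseteq> span V" by (simp add: hull_minimal span_superset subspace_imp_convex)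
  then show ?thesis unfolding Pi_def by (intro closure_minimal) (auto simp: closed_span)
qed

text \<open>On the polyhedron every \<open>Q (h p)\<close> is at least 1, so a point at level 1
  satisfies all inequalities required by \<open>complete\<close>; its coefficients then add up to
  1.\<close>

lemma P0_eq: "P0 = {p \<in> Pi. Q p = 1}"
proof
  show "P0 \<subseteq> {p \<in> Pi. Q p = 1}" using P0_Pi Q_P0 by auto
  show "{p \<in> Pi. Q p = 1} \<subseteq> P0"
  proof
    fix p assume p: "p \<in> {p \<in> Pi. Q p = 1}"
    have "Q p \<le> Q (h p)" if "h \<in> H" for h using p QG_Pi[of h p] that H_G by auto
    then obtain a where a: "\<forall>x\<in>X. 0 \<le> a x" "p = (\<Sum>x\<in>X. a x *\<^sub>R x)"
      using complete[of p] p Pi_span by blast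
    have "Q p = sum a X" unfolding a(2) Q_sum Q_scale using Q_X by simp
    then show "p \<in> P0" using p a unfolding P0_def convex_hull_finite[OF finite_X] by auto
  qed
qed

lemma P0_face: "P0 face_of Pi"
  unfolding P0_eq by (rule exposed_face[OF convex_Pi linear_Q Q_Pi])

lemma compact_P0: "compact P0"
  unfolding P0_def by (simp add: finite_X finite_imp_compact_convex_hull)

lemma face_image:
  assumes "g \<in> G" "F face_of Pi" shows "g ` F face_of Pi"
  using face_of_linear_image[OF linear_G[OF assms(1)] inj_G[OF assms(1)], of F Pi] assms(2) G_image_Pi[OF assms(1)] by simp

lemma bounded_image: assumes "g \<in> G" "bounded F" shows "bounded (g ` F)"
  using assms linear_G by (simp add: bounded_linear_image linear_conv_bounded_linear)

text \<open>The integers \<open>Q (h v)\<close>, for \<open>h\<close> in \<open>H\<close> or the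
  identity, determine \<open>v\<close>: if they agree for \<open>v\<close> and \<open>w\<close>,
  then \<open>complete\<close> writes \<open>v - w\<close> with nonnegative coefficients of sum 0. A
  bound on \<open>Q v\<close> bounds the norm of \<open>v\<close> and with it each of these
  integers.\<close>

lemma V_discrete: "finite {v \<in> V. Q v \<le> B}"
proof -
  define f where "f v = (\<lambda>h\<in>insert id H. Q (h v))" for v
  have inj: "inj_on f {v \<in> V. Q v \<le> B}"
  proof (rule inj_onI)
    fix v w assume v: "v \<in> {v \<in> V. Q v \<le> B}" and w: "w \<in> {v \<in> V. Q v \<le> B}" and eq: "f v = f w"
    have e: "Q (h v) = Q (h w)" if "h \<in> insert id H" for h
      using fun_cong[OF eq, of h] that by (simp add: f_def)
    have "v - w \<in> span V" using v w by (simp add: span_base span_diff)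
    moreover have q0: "Q (v - w) = 0" using e[of id] by (simp add: Q_diff)
    moreover have "Q (h (v - w)) = 0" if "h \<in> H" for h
      using e[of h] that H_G linear_diff[OF linear_G, of h] by (auto simp: Q_diff)
    ultimately obtain a where a: "\<forall>x\<in>X. 0 \<le> a x" "v - w = (\<Sum>x\<in>X. a x *\<^sub>R x)"
      using complete[of "v - w"] by auto
    have "sum a X = 0" using q0 unfolding a(2) Q_sum Q_scale using Q_X by simp
    then have "\<forall>x\<in>X. a x = 0" using a(1) by (simp add: sum_nonneg_eq_0_iff finite_X)
    then show "v = w" using a(2) by simp
  qed
  have "\<exists>K. \<forall>v\<in>V. Q v \<le> B \<longrightarrow> \<bar>Q (h v)\<bar> \<le> K" if "h \<in> insert id H" for h
  proof -
    have "h \<in> G" using that H_G id_G by auto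
    then have "bounded_linear (\<lambda>x. Q (h x))" using linear_QG by (simp add: linear_conv_bounded_linear)
    then obtain K where K: "\<And>x. norm (Q (h x)) \<le> norm x * K" and "K > 0" using bounded_linear.pos_bounded by blast
    have "\<bar>Q (h v)\<bar> \<le> B / c * K" if "v \<in> V" "Q v \<le> B" for v
    proof -
      have "norm v \<le> B / c" using Q_ge_norm[OF that(1)] that(2) c_pos by (simp add: field_simps)
      then have "norm v * K \<le> B / c * K" using \<open>K > 0\<close> by (intro mult_right_mono) auto
      then show ?thesis using K[of v] by simp
    qed
    then show ?thesis by blast
  qed
  then have "\<forall>h\<in>insert id H. \<exists>K. \<forall>v\<in>V. Q v \<le> B \<longrightarrow> \<bar>Q (h v)\<bar> \<le> K" by blast
  from bchoice[OF this] obtain K where K: "\<forall>h\<in>insert id H. \<forall>v\<in>V. Q v \<le> B \<longrightarrow> \<bar>Q (h v)\<bar> \<le> K h" by blast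
  have "f ` {v \<in> V. Q v \<le> B} \<subseteq> (\<Pi>\<^sub>E h\<in>insert id H. {k \<in> \<int>. \<bar>k\<bar> \<le> K h})"
  proof
    fix u assume "u \<in> f ` {v \<in> V. Q v \<le> B}"
    then obtain v where v: "u = f v" "v \<in> V" "Q v \<le> B" by blast
    have "Q (h v) \<in> \<int> \<and> \<bar>Q (h v)\<bar> \<le> K h" if "h \<in> insert id H" for h
    proof -
      have "h \<in> G" using that H_G id_G by blast
      then show ?thesis using K that v Q_int G_V by blast
    qed
    then show "u \<in> (\<Pi>\<^sub>E h\<in>insert id H. {k \<in> \<int>. \<bar>k\<bar> \<le> K h})" unfolding v(1) f_def restrict_PiE_iff by blast
  qed
  moreover have "finite (\<Pi>\<^sub>E h\<in>insert id H. {k \<in> \<int>. \<bar>k\<bar> \<le> K h})"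
    by (intro finite_PiE) (auto simp: finite_H finite_abs_int_segment)
  ultimately have "finite (f ` {v \<in> V. Q v \<le> B})" by (rule finite_subset)
  then show ?thesis using inj by (rule finite_imageD)
qed

text \<open>A combination of lattice points is moved into the cone over the perfect facet by minimising
  its value under the form: the values at the lattice points are positive integers.\<close>

lemma covering:
  assumes p: "p \<in> convex hull V"
  shows "\<exists>g\<in>G. \<exists>a. (\<forall>x\<in>X. 0 \<le> a x) \<and> p = (\<Sum>x\<in>X. a x *\<^sub>R g x)"
proof -
  obtain S u where S: "finite S" "S \<subseteq> V" and u: "\<And>v. v \<in> S \<Longrightarrow> 0 \<le> u v" "sum u S = 1" "(\<Sum>v\<in>S. u v *\<^sub>R v) = p"
    using p unfolding convex_hull_explicit by blast
  define S' where "S' = {v \<in> S. u v > 0}"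
  have S': "finite S'" "S' \<subseteq> V" "\<And>v. v \<in> S' \<Longrightarrow> u v > 0" using S by (auto simp: S'_def)
  have pS: "p = (\<Sum>v\<in>S'. u v *\<^sub>R v)"
    unfolding u(3)[symmetric] S'_def using S(1) u(1) by (intro sum.mono_neutral_right) force+
  have Qg: "Q (g p) = (\<Sum>v\<in>S'. u v * Q (g v))" if "g \<in> G" for g
    unfolding pS linear_sum[OF linear_G[OF that]] Q_sum linear_scale[OF linear_G[OF that]] Q_scale ..
  define T where "T = {Q (g p) | g. g \<in> G \<and> Q (g p) \<le> Q p}"
  \<comment> \<open>All summands are positive, so each \<open>Q (g v)\<close> is a positive integer
    at most \<open>Q p / u v\<close>. This leaves finitely many tuples and hence finitely many
    values below \<open>Q p\<close>.\<close>
  have "T \<subseteq> (\<lambda>f. \<Sum>v\<in>S'. u v * f v) ` (\<Pi>\<^sub>E v\<in>S'. {k \<in> \<int>. \<bar>k\<bar> \<le> Q p / u v})"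
  proof
    fix t assume "t \<in> T"
    then obtain g where g: "g \<in> G" "t = Q (g p)" "Q (g p) \<le> Q p" by (auto simp: T_def)
    have "Q (g v) \<in> \<int> \<and> \<bar>Q (g v)\<bar> \<le> Q p / u v" if v: "v \<in> S'" for v
    proof -
      have gv: "g v \<in> V" using g(1) v S'(2) G_V by auto
      have "u v * Q (g v) \<le> (\<Sum>v\<in>S'. u v * Q (g v))"
      proof (rule member_le_sum[OF v _ S'(1)])
        fix w assume "w \<in> S' - {v}"
        then have "g w \<in> V" "u w > 0" using g(1) S' G_V by auto
        then show "0 \<le> u w * Q (g w)" using Q_V_ge_1[of "g w"] by simp
      qed
      also have "\<dots> \<le> Q p" using g(3) Qg[OF g(1)] by simp
      finally have "Q (g v) \<le> Q p / u v" using S'(3)[OF v] by (simp add: field_simps)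
      then show ?thesis using Q_int[OF gv] Q_V_ge_1[OF gv] by simp
    qed
    then have mem: "\<forall>v\<in>S'. Q (g v) \<in> {k \<in> \<int>. \<bar>k\<bar> \<le> Q p / u v}" by blast
    show "t \<in> (\<lambda>f. \<Sum>v\<in>S'. u v * f v) ` (\<Pi>\<^sub>E v\<in>S'. {k \<in> \<int>. \<bar>k\<bar> \<le> Q p / u v})"
    proof (rule image_eqI)
      show "t = (\<Sum>v\<in>S'. u v * (\<lambda>v\<in>S'. Q (g v)) v)"
        unfolding g(2) Qg[OF g(1)] by (intro sum.cong) auto
      show "(\<lambda>v\<in>S'. Q (g v)) \<in> (\<Pi>\<^sub>E v\<in>S'. {k \<in> \<int>. \<bar>k\<bar> \<le> Q p / u v})"
        using mem unfolding restrict_PiE_iff .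
    qed
  qed
  moreover have "finite \<dots>"
    by (intro finite_imageI finite_PiE) (auto simp: S' finite_abs_int_segment)
  ultimately have fT: "finite T" by (rule finite_subset)
  have "Q p \<in> T" unfolding T_def using id_G by (auto intro: exI[of _ id])
  then have "Min T \<in> T" using fT by (intro Min_in) auto
  then obtain g where g: "g \<in> G" "Min T = Q (g p)" "Q (g p) \<le> Q p" by (auto simp: T_def)
  have min: "Q (g p) \<le> Q (h p)" if "h \<in> G" for h
  proof (cases "Q (h p) \<le> Q p")
    case True
    then have "Q (h p) \<in> T" using that by (auto simp: T_def)
    then show ?thesis using Min_le[OF fT] g(2) by simp
  next
    case False then show ?thesis using g(3) by simp
  qed
  have "Q (g p) \<le> Q (h (g p))" if "h \<in> H" for h
    using min[OF comp_G[OF _ g(1)], of h] that H_G by auto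
  moreover have "g p \<in> span V" using G_hull[OF g(1) p] hull_Pi Pi_span by blast
  ultimately obtain a where a: "\<forall>x\<in>X. 0 \<le> a x" "g p = (\<Sum>x\<in>X. a x *\<^sub>R x)"
    using complete[of "g p"] by blast
  obtain h where h: "h \<in> G" "\<forall>x. h (g x) = x" using inverse_G[OF g(1)] by blast
  have "p = h (g p)" using h by simp
  also have "\<dots> = (\<Sum>x\<in>X. a x *\<^sub>R h x)"
    unfolding a(2) linear_sum[OF linear_G[OF h(1)]] linear_scale[OF linear_G[OF h(1)]] ..
  finally show ?thesis using h(1) a(1) by blast
qed

end

section \<open>Bounded faces and images of the perfect facet\<close>

context voronoi
begin

text \<open>It suffices to place one relative interior point \<open>p\<close> of \<open>P\<close>
  into an image of \<open>P0\<close>, because that image is a face. The approximating points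
  \<open>z n\<close> lie in cones over the images of \<open>X\<close> under \<open>g n\<close>;
  their coefficients and scaled vertices are bounded since \<open>Q (z n)\<close> converges, so they
  have limits along a subsequence.\<close>

lemma bounded_face_representative:
  assumes F: "P face_of Pi" "P \<noteq> {}" "bounded P"
  shows "\<exists>g\<in>G. P \<subseteq> g ` P0"
proof -
  have "convex P" using F(1) face_of_imp_convex by blast
  then obtain p where p: "p \<in> rel_interior P" using rel_interior_eq_empty F(2) by blast
  then have pP: "p \<in> P" using rel_interior_subset by blast
  then have "p \<in> Pi" using F(1) face_of_imp_subset by blast
  then obtain z where z: "\<And>n. z n \<in> convex hull V" "z \<longlonglongrightarrow> p"
    unfolding Pi_def closure_sequential by blast
  have "\<forall>n. \<exists>g\<in>G. \<exists>a. (\<forall>x\<in>X. 0 \<le> a x) \<and> z n = (\<Sum>x\<in>X. a x *\<^sub>R g x)" using covering[OF z(1)] by blast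
  then obtain g a where g: "\<And>n. g n \<in> G" and a: "\<And>n x. x \<in> X \<Longrightarrow> 0 \<le> a n x"
    and za: "\<And>n. z n = (\<Sum>x\<in>X. a n x *\<^sub>R g n x)" by metis
  have gV: "g n x \<in> V" if "x \<in> X" for n x using G_V[OF g] X_V that by blast
  have Qz: "Q (z n) = (\<Sum>x\<in>X. a n x * Q (g n x))" for n
    unfolding za Q_sum Q_scale ..
  \<comment> \<open>Undoing \<open>g n\<close> turns the sum of the coefficients into a value of
    \<open>Q\<close> on the polyhedron.\<close>
  have sum1: "1 \<le> (\<Sum>x\<in>X. a n x)" for n
  proof -
    obtain h where h: "h \<in> G" "\<forall>x. h (g n x) = x" using inverse_G[OF g] by blast
    have "Q (h (z n)) = (\<Sum>x\<in>X. a n x)"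
      unfolding za linear_sum[OF linear_G[OF h(1)]] linear_scale[OF linear_G[OF h(1)]] Q_sum Q_scale
      using h(2) Q_X by simp
    then show ?thesis using QG_Pi[OF h(1), of "z n"] z(1) hull_Pi by auto
  qed
  have "(\<lambda>n. Q (z n)) \<longlonglongrightarrow> Q p"
    using z(2) linear_Q by (metis linear_conv_bounded_linear bounded_linear.tendsto)
  then have "bounded (range (\<lambda>n. Q (z n)))" by (rule convergent_imp_bounded)
  then obtain B where B: "\<And>n. \<bar>Q (z n)\<bar> \<le> B" unfolding bounded_iff by auto
  have aQ: "a n x * Q (g n x) \<le> B" if x: "x \<in> X" for n x
  proof -
    have "a n x * Q (g n x) \<le> Q (z n)" unfolding Qz
      by (rule member_le_sum[OF x _ finite_X]) (use a order_trans[OF zero_le_one Q_V_ge_1[OF gV]] in \<open>auto intro!: mult_nonneg_nonneg\<close>)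
    then show ?thesis using B[of n] by linarith
  qed
  have aB: "\<bar>a n x\<bar> \<le> B" if "x \<in> X" for n x
    using mult_left_mono[OF Q_V_ge_1[OF gV[OF that]] a[OF that], of n n] aQ[OF that, of n] a[OF that, of n] by simp
  have yB: "norm (a n x *\<^sub>R g n x) \<le> B / c" if "x \<in> X" for n x
  proof -
    have "c * norm (a n x *\<^sub>R g n x) \<le> a n x * Q (g n x)"
      using mult_left_mono[OF Q_ge_norm[OF gV[OF that]] a[OF that], of n n] a[OF that] by (simp add: mult_ac)
    then show ?thesis using aQ[OF that, of n] c_pos by (simp add: field_simps)
  qed
  \<comment> \<open>Besides convergence this asks for a dichotomy: the vertex is constant along the
    subsequence or its value tends to infinity. It is obtained from \<open>V_discrete\<close> and
    the pigeonhole principle.\<close>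
  define good where "good x r \<longleftrightarrow> (\<exists>l. (\<lambda>n. a (r n) x) \<longlonglongrightarrow> l) \<and> (\<exists>y. (\<lambda>n. a (r n) x *\<^sub>R g (r n) x) \<longlonglongrightarrow> y) \<and>
     ((\<exists>v. \<forall>n. g (r n) x = v) \<or> filterlim (\<lambda>n. Q (g (r n) x)) at_top sequentially)" for x and r :: "nat \<Rightarrow> nat"
  have good_sub: "good x (r \<circ> s)" if "good x r" "strict_mono s" for x r s
  proof -
    have fs: "filterlim s sequentially sequentially" by (rule filterlim_subseq[OF that(2)])
    show ?thesis using that(1) unfolding good_def o_def
      by (auto dest: filterlim_compose[OF _ fs])
  qed
  have "\<exists>r. strict_mono r \<and> (\<forall>x\<in>X. good x r)"
  proof (rule common_subsequence[where P = good, OF finite_X _ good_sub])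
    fix x and r :: "nat \<Rightarrow> nat" assume x: "x \<in> X" and r: "strict_mono r"
    have "bounded (range (\<lambda>n. (a (r n) x, a (r n) x *\<^sub>R g (r n) x)))"
    proof -
      have "range (\<lambda>n. (a (r n) x, a (r n) x *\<^sub>R g (r n) x)) \<subseteq> cball 0 B \<times> cball 0 (B / c)"
        using aB[OF x] yB[OF x] by auto
      then show ?thesis by (rule bounded_subset[OF bounded_Times[OF bounded_cball bounded_cball]])
    qed
    from bounded_imp_convergent_subsequence[OF this] obtain l s where s: "strict_mono (s :: nat \<Rightarrow> nat)"
      and l: "((\<lambda>n. (a (r n) x, a (r n) x *\<^sub>R g (r n) x)) \<circ> s) \<longlonglongrightarrow> l" by blast
    have l1: "(\<lambda>n. a (r (s n)) x) \<longlonglongrightarrow> fst l" and l2: "(\<lambda>n. a (r (s n)) x *\<^sub>R g (r (s n)) x) \<longlonglongrightarrow> snd l"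
      using tendsto_fst[OF l] tendsto_snd[OF l] by (simp_all add: o_def)
    show "\<exists>s. strict_mono s \<and> good x (r \<circ> s)"
    proof (cases "\<exists>B. infinite {n. Q (g (r (s n)) x) \<le> B}")
      case True
      then obtain B' where inf: "infinite {n. Q (g (r (s n)) x) \<le> B'}" (is "infinite ?N") by blast
      have "(\<lambda>n. g (r (s n)) x) ` ?N \<subseteq> {v \<in> V. Q v \<le> B'}" using gV[OF x] by auto
      then have "finite ((\<lambda>n. g (r (s n)) x) ` ?N)" using V_discrete finite_subset by blast
      from pigeonhole_infinite[OF inf this] obtain n0 where
        "infinite {n \<in> ?N. g (r (s n)) x = g (r (s n0)) x}" by blast
      from infinite_enumerate[OF this] obtain t :: "nat \<Rightarrow> nat" where t: "strict_mono t"
        "\<And>n. g (r (s (t n))) x = g (r (s n0)) x" by auto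
      have ft: "filterlim t sequentially sequentially" by (rule filterlim_subseq[OF t(1)])
      have "good x (r \<circ> (s \<circ> t))" unfolding good_def o_def
        using filterlim_compose[OF l1 ft] filterlim_compose[OF l2 ft] t(2) by blast
      then show ?thesis using strict_mono_o[OF s t(1)] by blast
    next
      case False
      have "filterlim (\<lambda>n. Q (g (r (s n)) x)) at_top sequentially"
        unfolding filterlim_at_top
      proof
        fix Z
        have "finite {n. \<not> Z \<le> Q (g (r (s n)) x)}"
          using False by (rule_tac finite_subset[of _ "{n. Q (g (r (s n)) x) \<le> Z}"]) auto
        then show "\<forall>\<^sub>F n in sequentially. Z \<le> Q (g (r (s n)) x)"
          unfolding cofinite_eq_sequentially[symmetric] eventually_cofinite .
      qed
      then have "good x (r \<circ> s)" unfolding good_def o_def using l1 l2 by blast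
      then show ?thesis using s by blast
    qed
  qed
  then obtain r where r: "strict_mono r" "\<And>x. x \<in> X \<Longrightarrow> good x r" by blast
  define C where "C = {x \<in> X. \<exists>v. \<forall>n. g (r n) x = v}"
  define D where "D = X - C"
  have CD: "finite C" "finite D" "C \<inter> D = {}" "C \<union> D = X" using finite_X by (auto simp: C_def D_def)
  obtain l where l: "\<And>x. x \<in> X \<Longrightarrow> (\<lambda>n. a (r n) x) \<longlonglongrightarrow> l x" using r(2) unfolding good_def by metis
  obtain y where y: "\<And>x. x \<in> X \<Longrightarrow> (\<lambda>n. a (r n) x *\<^sub>R g (r n) x) \<longlonglongrightarrow> y x" using r(2) unfolding good_def by metis
  define w where "w x = g (r 0) x" for x
  have w: "g (r n) x = w x" if "x \<in> C" for n x using that by (auto simp: C_def w_def)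
  have l_ge: "0 \<le> l x" if "x \<in> X" for x
    using LIMSEQ_le_const[OF l[OF that]] a[OF that] by blast
  \<comment> \<open>The product of coefficient and value stays below \<open>B\<close>, so a vertex
    of unbounded value loses its coefficient in the limit, although the scaled vertex may tend to a
    nonzero \<open>y x\<close>.\<close>
  have l0: "l x = 0" if "x \<in> D" for x
  proof -
    have x: "x \<in> X" "filterlim (\<lambda>n. Q (g (r n) x)) at_top sequentially"
      using that r(2)[of x] by (auto simp: D_def C_def good_def)
    have lim: "(\<lambda>n. B / Q (g (r n) x)) \<longlonglongrightarrow> 0" by (rule real_tendsto_divide_at_top[OF tendsto_const x(2)])
    have le: "norm (a (r n) x) \<le> B / Q (g (r n) x)" for n
    proof -
      have "Q (g (r n) x) \<ge> 1" by (rule Q_V_ge_1[OF gV[OF x(1)]])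
      then show ?thesis using aQ[OF x(1), of "r n"] a[OF x(1), of "r n"] by (simp add: field_simps)
    qed
    then have "(\<lambda>n. a (r n) x) \<longlonglongrightarrow> 0"
      by (intro Lim_null_comparison[OF always_eventually lim] allI)
    then show ?thesis using l[OF x(1)] LIMSEQ_unique by blast
  qed
  have yC: "y x = l x *\<^sub>R w x" if "x \<in> C" for x
  proof -
    have "(\<lambda>n. a (r n) x *\<^sub>R w x) \<longlonglongrightarrow> l x *\<^sub>R w x" using l[of x] that CD by (intro tendsto_intros) auto
    then show ?thesis using y[of x] w[OF that] that CD(4) LIMSEQ_unique by auto
  qed
  define s where "s = (\<Sum>x\<in>C. l x *\<^sub>R w x)"
  define d where "d = (\<Sum>x\<in>D. y x)"
  define T where "T = (\<Sum>x\<in>C. l x)"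
  have psd: "p = s + d"
  proof -
    have "(\<lambda>n. \<Sum>x\<in>X. a (r n) x *\<^sub>R g (r n) x) \<longlonglongrightarrow> (\<Sum>x\<in>X. y x)" by (intro tendsto_sum y)
    moreover have "(\<lambda>n. z (r n)) \<longlonglongrightarrow> p" using LIMSEQ_subseq_LIMSEQ[OF z(2) r(1)] by (simp add: o_def)
    ultimately have "p = (\<Sum>x\<in>X. y x)" unfolding za using LIMSEQ_unique by blast
    also have "\<dots> = (\<Sum>x\<in>C. y x) + (\<Sum>x\<in>D. y x)" unfolding CD(4)[symmetric] by (rule sum.union_disjoint) (use CD in auto)
    also have "(\<Sum>x\<in>C. y x) = s" unfolding s_def using yC by (intro sum.cong) auto
    finally show ?thesis by (simp add: d_def)
  qed
  have T1: "1 \<le> T"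
  proof -
    have "(\<lambda>n. \<Sum>x\<in>X. a (r n) x) \<longlonglongrightarrow> (\<Sum>x\<in>X. l x)" by (intro tendsto_sum l)
    then have "1 \<le> (\<Sum>x\<in>X. l x)" using LIMSEQ_le_const sum1 by blast
    also have "\<dots> = T + (\<Sum>x\<in>D. l x)" unfolding CD(4)[symmetric] T_def by (rule sum.union_disjoint) (use CD in auto)
    also have "(\<Sum>x\<in>D. l x) = 0" using l0 by (intro sum.neutral) auto
    finally show ?thesis by simp
  qed
  \<comment> \<open>Multiplying the coefficients over \<open>D\<close> by any \<open>t\<close>
    leaves the limit \<open>T\<close> of the total weight unchanged. After normalisation these are
    convex combinations tending to \<open>(s + t d) / T\<close>, and \<open>scale_Pi\<close> removes
    the denominator.\<close>
  have ray: "s + t *\<^sub>R d \<in> Pi \<and> (1 / T) *\<^sub>R (s + t *\<^sub>R d) \<in> Pi" if t: "0 \<le> t" for t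
  proof -
    define Tn where "Tn n = (\<Sum>x\<in>C. a (r n) x) + t * (\<Sum>x\<in>D. a (r n) x)" for n
    define sn where "sn n = (\<Sum>x\<in>C. a (r n) x *\<^sub>R g (r n) x) + t *\<^sub>R (\<Sum>x\<in>D. a (r n) x *\<^sub>R g (r n) x)" for n
    have "Tn \<longlonglongrightarrow> (\<Sum>x\<in>C. l x) + t * (\<Sum>x\<in>D. l x)"
      unfolding Tn_def using CD by (intro tendsto_intros l) auto
    moreover have "(\<Sum>x\<in>D. l x) = 0" using l0 by (intro sum.neutral) auto
    ultimately have Tn: "Tn \<longlonglongrightarrow> T" by (simp add: T_def)
    have "sn \<longlonglongrightarrow> (\<Sum>x\<in>C. y x) + t *\<^sub>R (\<Sum>x\<in>D. y x)"
      unfolding sn_def using CD by (intro tendsto_intros y) auto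
    moreover have "(\<Sum>x\<in>C. y x) = s" unfolding s_def using yC by (intro sum.cong) auto
    ultimately have sn: "sn \<longlonglongrightarrow> s + t *\<^sub>R d" by (simp add: d_def)
    have lim: "(\<lambda>n. (1 / Tn n) *\<^sub>R sn n) \<longlonglongrightarrow> (1 / T) *\<^sub>R (s + t *\<^sub>R d)"
      using T1 by (intro tendsto_intros Tn sn) auto
    have "eventually (\<lambda>n. Tn n > 0) sequentially" using order_tendstoD(1)[OF Tn, of 0] T1 by simp
    then have ev: "eventually (\<lambda>n. (1 / Tn n) *\<^sub>R sn n \<in> Pi) sequentially"
    proof eventually_elim
      case (elim n)
      define b where "b x = (if x \<in> C then a (r n) x else t * a (r n) x) / Tn n" for x
      have "(\<Sum>x\<in>X. b x *\<^sub>R g (r n) x) \<in> convex hull V"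
      proof (rule convex_sum[OF finite_X convex_convex_hull])
        have "(\<Sum>x\<in>X. b x) = (\<Sum>x\<in>C. b x) + (\<Sum>x\<in>D. b x)" unfolding CD(4)[symmetric] by (rule sum.union_disjoint) (use CD in auto)
        also have "(\<Sum>x\<in>C. b x) = (\<Sum>x\<in>C. a (r n) x) / Tn n" unfolding sum_divide_distrib by (intro sum.cong) (auto simp: b_def)
        also have "(\<Sum>x\<in>D. b x) = t * (\<Sum>x\<in>D. a (r n) x) / Tn n" unfolding sum_divide_distrib sum_distrib_left by (intro sum.cong) (auto simp: b_def D_def)
        also have "(\<Sum>x\<in>C. a (r n) x) / Tn n + t * (\<Sum>x\<in>D. a (r n) x) / Tn n = 1"
          using elim by (simp add: add_divide_distrib[symmetric]) (simp add: Tn_def)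
        finally show "(\<Sum>x\<in>X. b x) = 1" .
      next
        fix x assume "x \<in> X"
        then show "0 \<le> b x" "g (r n) x \<in> convex hull V" using a elim t gV hull_inc[of _ V] by (auto simp: b_def)
      qed
      moreover have "(\<Sum>x\<in>X. b x *\<^sub>R g (r n) x) = (1 / Tn n) *\<^sub>R sn n"
      proof -
        have "(\<Sum>x\<in>X. b x *\<^sub>R g (r n) x) = (\<Sum>x\<in>C. b x *\<^sub>R g (r n) x) + (\<Sum>x\<in>D. b x *\<^sub>R g (r n) x)"
          unfolding CD(4)[symmetric] by (rule sum.union_disjoint) (use CD in auto)
        also have "(\<Sum>x\<in>C. b x *\<^sub>R g (r n) x) = (1 / Tn n) *\<^sub>R (\<Sum>x\<in>C. a (r n) x *\<^sub>R g (r n) x)"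
          unfolding scaleR_sum_right by (intro sum.cong) (auto simp: b_def)
        also have "(\<Sum>x\<in>D. b x *\<^sub>R g (r n) x) = (1 / Tn n) *\<^sub>R (t *\<^sub>R (\<Sum>x\<in>D. a (r n) x *\<^sub>R g (r n) x))"
          unfolding scaleR_sum_right by (intro sum.cong) (auto simp: b_def D_def)
        finally show ?thesis by (simp add: sn_def scaleR_add_right)
      qed
      ultimately show ?case using hull_Pi by auto
    qed
    have in1: "(1 / T) *\<^sub>R (s + t *\<^sub>R d) \<in> Pi"
      by (rule Lim_in_closed_set[OF closed_Pi ev _ lim]) simp
    have "T *\<^sub>R ((1 / T) *\<^sub>R (s + t *\<^sub>R d)) \<in> Pi" by (rule scale_Pi[OF in1 T1])
    then show ?thesis using in1 T1 by simp
  qed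
  have "d = 0" by (rule face_of_ray[OF F(1,3), of s]) (use psd pP ray in auto)
  then have ps: "p = s" using psd by simp
  \<comment> \<open>The same device applied to the excess of \<open>T\<close> over 1: the ray from
    \<open>s / T\<close> in direction \<open>e\<close> stays in the polyhedron and passes through
    \<open>p\<close> at parameter 1, which forces \<open>T = 1\<close>.\<close>
  define e where "e = (1 - 1 / T) *\<^sub>R s"
  have "e = 0"
  proof (rule face_of_ray[OF F(1,3), of "(1 / T) *\<^sub>R s"])
    have "(1 / T) *\<^sub>R s + e = s" unfolding e_def by (simp flip: scaleR_add_left)
    then show "(1 / T) *\<^sub>R s + e \<in> P" using pP ps by simp
    fix t :: real assume t: "0 \<le> t"
    have "(1 / T) *\<^sub>R s + t *\<^sub>R e = (1 + t * (T - 1)) *\<^sub>R ((1 / T) *\<^sub>R s)"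
      unfolding e_def scaleR_scaleR scaleR_add_left[symmetric]
      by (rule arg_cong[of _ _ "\<lambda>k. k *\<^sub>R s"]) (use T1 in \<open>simp add: field_simps\<close>)
    moreover have "(1 / T) *\<^sub>R s \<in> Pi" using ray[of 0] by simp
    ultimately show "(1 / T) *\<^sub>R s + t *\<^sub>R e \<in> Pi" using scale_Pi[of "(1 / T) *\<^sub>R s" "1 + t * (T - 1)"] t T1 by simp
  qed
  moreover have "s \<noteq> 0" using ps pP F(1) face_of_imp_subset zero_notin_Pi by blast
  ultimately have T: "T = 1" using T1 by (simp add: e_def)
  \<comment> \<open>The first index of the subsequence serves as well as any other: the vertices
    over \<open>C\<close> are constant along it, and \<open>s\<close> involves no others.\<close>
  have "s \<in> convex hull (g (r 0) ` X)"
    unfolding s_def using CD l_ge T unfolding T_def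
    by (intro convex_sum) (auto simp: w_def intro!: hull_inc)
  also have "\<dots> = g (r 0) ` P0" unfolding P0_def by (rule convex_hull_linear_image[symmetric, OF linear_G[OF g]])
  finally have pin: "p \<in> g (r 0) ` P0" using ps by simp
  have "g (r 0) ` P0 face_of Pi" by (rule face_image[OF g P0_face])
  then have "P \<subseteq> g (r 0) ` P0"
    using subset_of_face_of[of "g (r 0) ` P0" Pi P] F(1) face_of_imp_subset p pin by (auto simp: disjnt_iff)
  then show ?thesis using g by blast
qed

lemma bounded_face_equiv:
  assumes F: "P face_of Pi" "P \<noteq> {}" "bounded P"
  shows "\<exists>g\<in>G. g ` P face_of P0"
proof -
  obtain g where g: "g \<in> G" "P \<subseteq> g ` P0" using bounded_face_representative[OF F] by blast
  obtain h where h: "h \<in> G" "\<forall>x. h (g x) = x" using inverse_G[OF g(1)] by blast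
  have "h ` P \<subseteq> P0" using g(2) h(2) by auto
  moreover have "h ` P face_of Pi" by (rule face_image[OF h(1) F(1)])
  ultimately have "h ` P face_of P0" using face_of_subset P0_Pi by blast
  then show ?thesis using h(1) by blast
qed

lemma face_P0_bounded:
  assumes "F face_of P0" shows "F face_of Pi" "bounded F"
  using face_of_trans[OF assms P0_face] compact_P0 face_of_imp_subset[OF assms]
  by (auto intro: bounded_subset compact_imp_bounded)

text \<open>Since the polyhedron is closed under upward scaling, no point of a bounded face is a
  proper multiple t > 1 of a point of the polyhedron. Hence a cone determines its face, and
  equivalences of cones become equivalences of faces.\<close>

lemma bounded_face_cone_inj:
  assumes "P face_of Pi" "bounded P" "P' face_of Pi" "bounded P'" "conic hull P = conic hull P'"
  shows "P \<subseteq> P'"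
proof
  have key: "t = 1" if S: "S face_of Pi" "bounded S" and "p \<in> S" "p = t *\<^sub>R p'" "p' \<in> Pi" "t \<ge> 1" for S p p' t
  proof -
    have "(t - 1) *\<^sub>R p' = 0"
    proof (rule face_of_ray[OF S])
      show "p' + (t - 1) *\<^sub>R p' \<in> S" using that by (simp add: algebra_simps)
      fix k :: real assume "k \<ge> 0"
      have "p' + k *\<^sub>R (t - 1) *\<^sub>R p' = (1 + k * (t - 1)) *\<^sub>R p'" by (simp add: algebra_simps)
      then show "p' + k *\<^sub>R (t - 1) *\<^sub>R p' \<in> Pi" using scale_Pi[OF that(5), of "1 + k * (t - 1)"] \<open>k \<ge> 0\<close> that(6) by simp
    qed
    then show ?thesis using that(5) zero_notin_Pi by auto
  qed
  fix p assume p: "p \<in> P"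
  then have "p \<in> conic hull P'" using assms(5) hull_inc by metis
  then obtain t p' where t: "p = t *\<^sub>R p'" "t \<ge> 0" "p' \<in> P'" by (auto simp: conic_hull_explicit)
  have in_Pi: "p \<in> Pi" "p' \<in> Pi" using p t assms face_of_imp_subset by blast+
  have "t \<noteq> 0" using t in_Pi zero_notin_Pi by auto
  have "t = 1"
  proof (cases "t \<ge> 1")
    case True then show ?thesis using key[OF assms(1,2) p t(1) in_Pi(2)] by simp
  next
    case False
    then have "p' = (1 / t) *\<^sub>R p" "1 / t \<ge> 1" using t \<open>t \<noteq> 0\<close> by (auto simp: field_simps)
    then have "1 / t = 1" using key[OF assms(3,4) t(3) _ in_Pi(1)] by blast
    then show ?thesis by simp
  qed
  then show "p \<in> P'" using t by simp
qed

end

section \<open>Tables and certificates\<close>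

unbundle bit_operations_syntax

type_synonym zvec = "int cyc \<times> int cyc"

text \<open>Three entries of the rank one matrix of \<open>(x, y)\<close>; the fourth is the
  conjugate of the middle one. As cyclotomic integers they determine the matrices at both places at
  once.\<close>

fun herm_coords :: "zvec \<Rightarrow> int cyc \<times> int cyc \<times> int cyc" where
  "herm_coords (x, y) = (x * cyc_conj x, x * cyc_conj y, y * cyc_conj y)"

text \<open>For a triple \<open>(p, r, t)\<close>: half the trace of
  \<open>alpha (p + t) / 5\<close> plus the trace of \<open>beta r / 5\<close>. The ignored
  coordinates are 0 and a repetition of \<open>k\<close>, by the shape of
  \<open>x * cyc_conj x\<close>.\<close>

fun form_coords :: "int cyc \<times> int cyc \<times> int cyc \<Rightarrow> int" where
  "form_coords (Cyc m _ k _, Cyc r0 r1 r2 r3, Cyc m' _ k' _) = (m - k) + (m' - k') + (r2 + r3 - r0 - r1)"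

fun zapply :: "zvec \<times> zvec \<Rightarrow> zvec \<Rightarrow> zvec" where
  "zapply ((a, b), (c, d)) (x, y) = (a * x + b * y, c * x + d * y)"

definition zdet :: "zvec \<times> zvec \<Rightarrow> int cyc" where
  "zdet M = (case M of ((a, b), (c, d)) \<Rightarrow> a * d - b * c)"

text \<open>A face of the perfect facet is stored as the bit mask of the indices in \<open>vtab\<close> of its vertices, so
  intersection is bitwise conjunction; \<open>pows\<close> lists the masks of the vertices.  A map of vertices is
  the list of the masks of the images, with \<open>0\<close> where the image is not a vertex.\<close>

definition full :: int where "full = 2 ^ 24 - 1"

definition pows :: "int list" where
  "pows = [1, 2, 4, 8, 16, 32, 64, 128, 256, 512, 1024, 2048, 4096, 8192, 16384, 32768, 65536,
     131072, 262144, 524288, 1048576, 2097152, 4194304, 8388608]"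

primrec img :: "int list \<Rightarrow> int \<Rightarrow> int" where
  "img [] S = 0"
| "img (m # ms) S = (if even S then 0 else m) OR img ms (S div 2)"

primrec defined :: "int list \<Rightarrow> int \<Rightarrow> bool" where
  "defined [] S \<longleftrightarrow> S = 0"
| "defined (m # ms) S \<longleftrightarrow> (even S \<or> m \<noteq> 0) \<and> defined ms (S div 2)"

primrec chain :: "int list \<Rightarrow> int \<Rightarrow> bool" where
  "chain [] S \<longleftrightarrow> True"
| "chain (Z # Zs) S \<longleftrightarrow> S AND Z \<noteq> S \<and> chain Zs (S AND Z)"

definition meet :: "int \<Rightarrow> int list \<Rightarrow> int" where "meet S Zs = foldl (AND) S Zs"

text \<open>The face \<open>S\<close> spans dimension \<open>n\<close>: the strictly decreasing chains from the whole facet down to \<open>S\<close>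
  and from \<open>S\<close> down to a nonempty face leave no other value.\<close>

definition flag :: "int \<Rightarrow> nat \<Rightarrow> int list \<Rightarrow> int list \<Rightarrow> bool" where
  "flag S n up down \<longleftrightarrow> chain up full \<and> meet full up = S \<and> length up + n = 8 \<and>
     chain down S \<and> meet S down \<noteq> 0 \<and> Suc (length down) = n"

text \<open>For each vertex of \<open>S\<close> some inequality in \<open>K\<close> is tight at all
  other vertices of \<open>S\<close> but not at this one. Such dual functionals force the vertices
  to be independent.\<close>

definition simplicial :: "int \<Rightarrow> int list \<Rightarrow> bool" where
  "simplicial S K \<longleftrightarrow> list_all (\<lambda>m. S AND m = 0 \<or> list_ex (\<lambda>Z. S AND Z = S XOR m) K) pows"

definition count :: "int \<Rightarrow> nat" where "count S = length (filter (\<lambda>m. S AND m \<noteq> 0) pows)"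

definition subl :: "int list \<Rightarrow> int list \<Rightarrow> bool" where
  "subl K L \<longleftrightarrow> list_all (List.member L) K"

text \<open>A node \<open>(S, n, up, down, m, K)\<close> certifies that the inequalities \<open>K\<close> cut out the cone over the face \<open>S\<close>
  of dimension \<open>n\<close>, by shooting from the vertex \<open>m\<close> and referring to later nodes or simplicial faces.\<close>

type_synonym node = "int \<times> nat \<times> int list \<times> int list \<times> int \<times> int list"

definition child_ok :: "node list \<Rightarrow> nat \<Rightarrow> int list \<Rightarrow> int \<Rightarrow> bool" where
  "child_ok nds n K f \<longleftrightarrow> (simplicial f K \<and> Suc (count f) = n) \<or>
     list_ex (\<lambda>(S, n', _, _, _, K'). S = f \<and> Suc n' = n \<and> subl K' K) nds"

definition node_ok :: "node list \<Rightarrow> node \<Rightarrow> bool" where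
  "node_ok nds nd = (case nd of (S, n, up, down, m, K) \<Rightarrow>
     flag S n up down \<and> List.member pows m \<and> S AND m = m \<and> list_ex (\<lambda>Z. Z AND m = 0) K \<and>
     list_all (\<lambda>Z. Z AND m = m \<or> child_ok nds n K (S AND Z)) K)"

primrec nodes_ok :: "node list \<Rightarrow> bool" where
  "nodes_ok [] \<longleftrightarrow> True"
| "nodes_ok (nd # nds) \<longleftrightarrow> node_ok nds nd \<and> nodes_ok nds"

text \<open>One vector per point: multiplication by the ten roots of unity of the field does not
  change \<open>q\<close>, which reduces the 240 minimal vectors to 24.\<close>

definition vtab :: "zvec list" where
  "vtab = [(Cyc 0 0 0 0, Cyc 1 1 1 1), (Cyc 1 1 1 1, Cyc 0 0 0 0), (Cyc 0 0 0 0, Cyc 1 1 0 1), (Cyc 1 1 0 1, Cyc 0 0 0 0), (Cyc 1 1 1 1, Cyc 0 0 0 (-1)),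
   (Cyc 1 1 1 1, Cyc 0 0 1 0), (Cyc 1 1 1 1, Cyc 1 1 1 1), (Cyc 1 1 1 1, Cyc 0 1 0 0), (Cyc 1 1 1 1, Cyc (-1) 0 0 (-1)), (Cyc 1 1 1 0, Cyc 0 0 0 (-1)),
   (Cyc 1 1 1 1, Cyc 1 1 1 0), (Cyc 1 1 1 1, Cyc 0 1 1 0), (Cyc 1 1 0 1, Cyc 0 0 0 (-1)), (Cyc 1 1 1 1, Cyc 1 0 1 0), (Cyc 1 1 1 0, Cyc 0 1 0 0),
   (Cyc 1 1 0 1, Cyc 1 0 0 0), (Cyc 1 1 1 0, Cyc 1 1 1 0), (Cyc 1 1 0 1, Cyc 1 0 1 0), (Cyc 1 1 0 1, Cyc 0 (-1) 0 (-1)), (Cyc 1 1 1 0, Cyc 1 1 0 0),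
   (Cyc 2 1 1 1, Cyc 0 0 0 (-1)), (Cyc 1 1 1 1, Cyc 0 0 1 (-1)), (Cyc 1 1 1 0, Cyc 0 1 0 (-1)), (Cyc 1 2 1 1, Cyc 1 1 1 0)]"

text \<open>The first two matrices generate symmetries of the facet.  The other nine are the neighbours \<open>h\<close>
  whose inequalities \<open>form p \<le> form (h p)\<close> represent the facets of its cone up to these symmetries; \<open>bases\<close> lists
  the corresponding masks.\<close>

definition gens :: "((zvec \<times> zvec) \<times> int list) list" where
  "gens =
  [(((Cyc 0 0 1 1, Cyc 1 0 0 0), (Cyc (-1) 0 0 0, Cyc 0 0 0 0)), [2, 16384, 8, 256, 512, 32, 4096, 128, 64, 8388608, 16, 1, 4, 1048576, 65536, 262144, 2048, 131072, 8192, 524288, 2097152, 32768, 1024, 4194304]),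
   (((Cyc 1 1 1 1, Cyc 1 0 0 0), (Cyc 0 0 0 0, Cyc 0 0 0 (-1))), [32, 2, 131072, 8, 1, 16384, 1048576, 32768, 8192, 16, 2048, 65536, 64, 262144, 512, 4096, 8388608, 256, 4, 1024, 128, 2097152, 4194304, 524288]),
   (((Cyc (-1) 0 (-1) 0, Cyc 0 0 0 0), (Cyc 0 0 0 0, Cyc 1 0 0 1)), [4, 8, 0, 0, 0, 0, 131072, 0, 0, 256, 4096, 0, 0, 0, 0, 0, 32, 0, 0, 64, 0, 0, 0, 0]),
   (((Cyc 1 1 0 0, Cyc 1 0 0 0), (Cyc 0 0 0 0, Cyc 0 0 (-1) (-1))), [2048, 0, 4096, 2, 0, 0, 0, 0, 0, 0, 0, 0, 8388608, 0, 0, 524288, 0, 16384, 16, 0, 0, 0, 0, 0]),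
   (((Cyc 0 0 (-1) (-1), Cyc 0 0 0 0), (Cyc 1 0 0 0, Cyc 1 0 0 0)), [1, 16384, 4, 256, 524288, 0, 0, 4194304, 65536, 0, 0, 0, 2048, 0, 0, 0, 0, 0, 128, 0, 0, 0, 0, 0]),
   (((Cyc 0 0 0 1, Cyc 1 0 0 0), (Cyc (-1) (-1) 0 0, Cyc 0 0 0 0)), [2, 2048, 8, 4096, 524288, 0, 0, 0, 0, 0, 0, 0, 0, 1024, 0, 16, 0, 1, 128, 0, 0, 0, 0, 0]),
   (((Cyc 0 (-1) 0 (-1), Cyc 0 0 0 0), (Cyc 0 0 0 0, Cyc 1 0 0 0)), [1, 8, 4, 0, 32768, 0, 0, 4096, 131072, 64, 0, 0, 0, 0, 32, 0, 0, 0, 0, 2048, 0, 0, 0, 0]),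
   (((Cyc 0 0 0 0, Cyc 1 0 0 0), (Cyc 0 (-1) 0 (-1), Cyc 0 0 0 0)), [2, 4, 8, 0, 0, 0, 8192, 256, 0, 64, 0, 0, 0, 0, 128, 0, 512, 0, 0, 16384, 0, 0, 0, 0]),
   (((Cyc 0 0 (-1) 0, Cyc 0 0 0 0), (Cyc 0 0 0 0, Cyc 1 0 0 0)), [1, 2, 4, 8, 128, 0, 32, 64, 0, 16384, 2048, 0, 0, 256, 0, 4096, 0, 0, 0, 65536, 0, 0, 0, 0]),
   (((Cyc 1 0 0 1, Cyc 0 0 0 0), (Cyc 0 0 0 0, Cyc 1 0 0 1)), [4, 8, 0, 0, 262144, 131072, 0, 0, 0, 8192, 32768, 4096, 0, 0, 256, 0, 64, 0, 0, 128, 0, 0, 2097152, 1048576]),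
   (((Cyc 0 0 0 0, Cyc 1 1 1 0), (Cyc 1 1 0 0, Cyc 0 0 0 0)), [0, 0, 2, 1, 0, 0, 524288, 65536, 1024, 0, 0, 0, 512, 2048, 0, 16384, 0, 16, 32, 0, 4194304, 8388608, 0, 0])]"

definition bases :: "int list" where "bases = [591427, 430093, 266655, 434207, 541591, 606919, 567007, 13192755, 3584460]"

text \<open>An entry \<open>(Z, k, Y)\<close> with \<open>k < 2\<close> says that \<open>Z\<close> is the image of \<open>Y\<close> under the
  symmetry \<open>k\<close>; \<open>k = 2\<close> marks a base facet.\<close>

definition orbit :: "(int \<times> nat \<times> int) list" where
  "orbit = [(591427, 2, 0), (430093, 2, 0), (266655, 2, 0), (434207, 2, 0), (541591, 2, 0), (606919, 2, 0), (567007, 2, 0), (13192755, 2, 0), (3584460, 2, 0),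
   (8935442, 0, 591427), (9440306, 1, 591427), (401678, 0, 430093), (135532, 1, 430093), (25550, 0, 266655), (172143, 1, 266655), (1467146, 0, 434207),
   (397615, 1, 434207), (8995530, 0, 541591), (173619, 1, 541591), (9001098, 0, 606919), (9602610, 1, 606919), (10245018, 0, 567007),
   (1481787, 1, 567007), (4801029, 0, 8935442), (6308401, 0, 9440306), (608387, 1, 9440306), (1204552, 0, 401678), (9523656, 0, 25550),
   (1483290, 1, 25550), (1462570, 0, 172143), (11755840, 0, 1467146), (271262, 1, 1467146), (156014, 0, 397615), (13195648, 0, 8995530),
   (9995802, 1, 8995530), (9847346, 0, 173619), (284979, 1, 173619), (4802949, 0, 9001098), (9012810, 1, 9001098), (15090224, 0, 9602610),
   (547219, 1, 9602610), (15295428, 0, 10245018), (2515767, 0, 1481787), (88559, 1, 1481787), (8981514, 0, 4801029), (12715568, 1, 4801029),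
   (8488482, 0, 6308401), (3346752, 0, 1204552), (1319816, 1, 1204552), (6363588, 0, 9523656), (10003144, 1, 9523656), (11952896, 0, 1483290),
   (2318692, 0, 1462570), (7575616, 0, 11755840), (12329856, 1, 11755840), (9462728, 0, 271262), (1266024, 0, 156014), (4787397, 0, 13195648),
   (13215296, 1, 13195648), (15483664, 0, 9995802), (531611, 1, 9995802), (14901792, 0, 9847346), (90727, 0, 284979), (593099, 0, 4802949),
   (12822048, 1, 4802949), (13392144, 0, 9012810), (9968666, 1, 9012810), (6832917, 1, 15090224), (108131, 1, 547219), (14261448, 0, 15295428),
   (16688656, 1, 15295428), (9691754, 0, 2515767), (4737297, 0, 8981514), (12863536, 0, 8488482), (2267204, 0, 3346752), (11542976, 1, 3346752),
   (303260, 1, 1319816), (40141, 0, 6363588), (15966272, 1, 6363588), (16519552, 0, 10003144), (1873048, 1, 10003144), (2892692, 1, 11952896),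
   (1284200, 0, 2318692), (2530309, 0, 7575616), (15798720, 1, 7575616), (16294080, 0, 12329856), (2925716, 1, 12329856), (1876632, 1, 9462728),
   (2300260, 0, 1266024), (13863968, 1, 4787397), (14425104, 0, 13215296), (6825493, 1, 15483664), (101483, 1, 531611), (9525290, 0, 90727),
   (9538602, 1, 593099), (14027824, 0, 12822048), (4793925, 0, 13392144), (6432305, 1, 6832917), (9721906, 0, 108131), (7085461, 0, 14261448),
   (16210208, 0, 9691754), (4269601, 1, 4737297), (7377088, 0, 11542976), (3973248, 1, 11542976), (7773184, 0, 15966272), (6857924, 0, 16519552),
   (2532373, 1, 2892692), (2496805, 0, 1284200), (6331588, 0, 15798720), (8164480, 0, 16294080), (300189, 1, 1876632), (170093, 0, 2300260),
   (6687793, 0, 13863968), (6375717, 0, 9525290), (6572337, 0, 9538602), (6382117, 0, 9721906), (6532197, 1, 7085461), (2397316, 0, 7377088)]"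

definition nodes :: "node list" where
  "nodes =
  [(3584460, 7, [3584460], [25550, 88559, 40141, 156014, 90727, 101483], 4, [25550, 40141, 88559, 156014, 172143, 170093, 135532, 266655, 271262, 300189, 434207, 397615, 303260, 401678, 430093, 567007, 1284200, 1266024,
   1481787, 1467146, 1483290, 1462570, 1876632, 1873048, 1204552, 1319816, 2318692, 2300260, 2515767, 2530309, 2532373, 2496805, 2925716, 2892692,
   2267204, 2397316, 3346752, 3973248, 6532197, 7085461, 6331588, 6363588, 6857924, 7575616, 7773184, 8164480, 7377088, 9691754, 10245018, 9462728,
   9523656, 10003144, 11755840, 12329856, 11952896, 14261448, 15295428, 16210208, 16688656, 15966272, 16519552, 15798720, 16294080, 11542976]),
   (606919, 7, [606919], [25550, 88559, 90727, 172143, 40141, 101483], 2, [25550, 88559, 90727, 541591, 567007, 593099, 608387, 591427, 4787397, 4793925, 4802949, 4801029, 8995530, 13192755, 15295428]),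
   (606916, 6, [606919, 15295428], [25550, 88559, 40141, 90727, 101483], 64, [25550, 88559, 90727, 541591, 567007, 4787397, 4793925, 4802949, 4801029, 8995530]),
   (541591, 7, [541591], [25550, 88559, 156014, 90727, 172143, 40141], 1, [25550, 88559, 266655, 271262, 547219, 567007, 606919, 2515767, 2892692, 4802949, 7085461, 6832917, 10245018, 13192755, 15295428]),
   (541586, 6, [541591, 10245018], [25550, 88559, 156014, 90727, 101483], 2, [25550, 271262, 547219, 567007, 606919, 2515767, 2892692, 6832917, 13192755, 15295428]),
   (4367, 5, [88559, 266655, 397615], [25550, 172143, 40141, 90727], 1, [401678, 430093, 172143, 135532, 284979, 531611, 541591, 1462570, 2496805]),
   (266511, 6, [266655, 397615], [88559, 25550, 172143, 40141, 90727], 1, [88559, 401678, 284979, 430093, 434207, 1481787, 1462570, 2515767, 2496805, 3584460]),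
   (40991, 6, [434207, 567007], [173619, 108131, 90727, 25550, 88559], 1, [173619, 172143, 266655, 271262, 300189, 303260, 1481787, 1483290, 2515767, 2532373]),
   (13192755, 7, [13192755], [88559, 90727, 101483, 173619, 156014, 25550], 1, [88559, 90727, 101483, 108131, 173619, 284979, 531611, 541591, 547219, 567007, 593099, 606919, 608387, 591427, 1481787, 2515767, 4787397, 4793925,
   4802949, 6532197, 7085461, 6375717, 6382117, 6432305, 6572337, 6832917, 6825493, 6687793, 4269601, 4737297, 4801029, 6308401, 8995530, 9012810,
   9001098, 9691754, 10245018, 9525290, 9538602, 9602610, 9721906, 9847346, 9968666, 9995802, 12822048, 13195648, 13215296, 13392144, 14261448,
   13863968, 14425104, 15295428, 16210208, 16688656, 14901792, 15483664, 14027824, 15090224, 8488482, 8935442, 8981514, 9440306, 12715568, 12863536]),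
   (567007, 7, [567007], [25550, 88559, 40141, 156014, 90727, 101483], 1, [25550, 40141, 88559, 90727, 101483, 108131, 173619, 172143, 266655, 271262, 300189, 434207, 303260, 531611, 541591, 593099, 606919, 591427, 1481787,
   1483290, 1876632, 1873048, 2515767, 2532373, 2925716, 2892692, 3584460, 4787397, 4793925, 6532197, 7085461, 6825493, 6857924, 8995530, 9012810,
   9691754, 10245018, 9995802, 10003144, 13192755, 13215296, 14261448, 15295428, 16688656]),
   (565960, 6, [567007, 10003144], [25550, 271262, 303260, 40141, 101483], 8, [25550, 1876632, 3584460, 6857924, 8995530, 9012810, 9691754, 13215296, 14261448, 15295428]),
   (558618, 6, [567007, 9995802], [173619, 108131, 101483, 40141, 172143], 2, [173619, 531611, 1481787, 1483290, 1876632, 1873048, 9012810, 10245018, 13192755, 16688656]),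
   (558666, 6, [567007, 9012810], [101483, 40141, 108131, 173619, 172143], 2, [101483, 108131, 593099, 591427, 8995530, 9691754, 9995802, 10003144, 13215296, 14261448]),
   (566468, 6, [567007, 6857924], [40141, 300189, 303260, 25550, 90727], 4, [40141, 2925716, 3584460, 4787397, 4793925, 6532197, 10003144, 13215296, 14261448, 15295428]),
   (566420, 6, [567007, 2925716], [300189, 40141, 303260, 25550, 90727], 4, [300189, 303260, 1876632, 1873048, 2532373, 2892692, 7085461, 6825493, 6857924, 16688656]),
   (565912, 6, [567007, 1876632], [271262, 25550, 303260, 40141, 101483], 8, [271262, 303260, 1483290, 1873048, 2925716, 2892692, 10245018, 9995802, 10003144, 16688656]),
   (8862, 6, [271262, 567007], [25550, 88559, 40141, 156014, 90727], 2, [25550, 266655, 434207, 303260, 541591, 1483290, 1876632, 2515767, 2892692, 10245018]),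
   (8910, 6, [25550, 567007], [88559, 40141, 156014, 90727, 101483], 2, [88559, 90727, 172143, 271262, 606919, 3584460, 8995530, 9691754, 10003144, 15295428]),
   (434207, 7, [434207], [173619, 172143, 108131, 90727, 25550, 88559], 1, [173619, 172143, 266655, 271262, 300189, 397615, 303260, 401678, 430093, 567007, 1481787, 1483290, 2515767, 2532373, 3584460]),
   (434202, 6, [434207, 1483290], [173619, 172143, 108131, 25550, 88559], 2, [173619, 172143, 271262, 303260, 401678, 567007, 1481787, 2515767, 2532373, 3584460]),
   (266655, 7, [266655], [88559, 25550, 156014, 172143, 40141, 90727], 4, [88559, 271262, 284979, 300189, 434207, 397615, 531611, 541591, 547219, 567007, 1481787, 2515767, 3584460, 7085461, 10245018]),
   (266650, 6, [266655, 10245018], [88559, 25550, 156014, 101483, 40141], 2, [88559, 271262, 284979, 300189, 397615, 531611, 547219, 1481787, 3584460, 7085461])]"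

text \<open>In \<open>(R, n, up, down, Kw)\<close> every inequality \<open>Z\<close> in \<open>Kw\<close> comes with a word in \<open>gens\<close> that maps the
  face \<open>R AND Z\<close> to a listed representative.\<close>

definition reps :: "(int \<times> nat \<times> int list \<times> int list \<times> (int \<times> nat list) list) list" where
  "reps =
  [(591427, 7, [591427], [108131, 90727, 88559, 172143, 25550, 40141], [(108131, [0, 1, 7, 1, 1]), (567007, [2, 10, 1, 0]), (593099, [0, 0, 7, 0, 0, 0, 0]), (606919, [7, 1, 1]), (4793925, [2, 1, 1, 1, 1, 0, 5, 0]),
   (9012810, [2, 0, 1, 1, 1, 1, 0, 5, 0]), (13192755, [])]),
   (266655, 7, [266655], [88559, 25550, 156014, 172143, 40141, 90727], [(88559, [1, 1, 1, 8, 1, 1, 1]), (271262, [1, 0, 1, 1, 1]), (284979, [0, 1, 1]), (300189, [0, 1, 1]), (434207, []), (397615, []),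
   (531611, [1, 0, 1, 1, 1]), (541591, []), (547219, []), (567007, []), (1481787, [1, 0, 1, 1, 1]), (2515767, [0, 1, 1]), (3584460, [4, 0, 0]),
   (7085461, [0, 8, 1, 1, 1]), (10245018, [1, 8, 0, 1, 1, 1])]),
   (434207, 7, [434207], [173619, 172143, 108131, 90727, 25550, 88559], [(173619, [5, 0, 1]), (172143, [0, 1, 1, 1]), (266655, []), (271262, [1]), (300189, [0, 1, 1]), (397615, []), (303260, [5, 0, 1, 0, 1]),
   (401678, [5, 0]), (430093, [0, 1, 1, 5, 0]), (567007, []), (1481787, [1, 0, 1, 1, 1]), (1483290, [1]), (2515767, [0, 1, 1]),
   (2532373, [1, 0, 1, 1, 1, 1]), (3584460, [1, 10])]),
   (567007, 7, [567007], [25550, 88559, 40141, 156014, 90727, 101483], [(25550, [8, 1, 1, 1]), (40141, [8, 0, 0, 1, 1, 1]), (88559, [8, 0, 1, 1, 1]), (90727, [1, 1, 6, 0, 1, 1, 1, 1]), (101483, [0, 0, 1, 1, 6, 0]),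
   (108131, [1, 1, 7, 1, 1]), (173619, [0, 1, 6, 0]), (172143, [8, 0, 1, 1, 1]), (266655, []), (271262, [1, 1, 0, 1, 1, 1]), (300189, [0, 1]),
   (434207, []), (303260, [8, 10]), (531611, [8, 0, 0, 7, 1, 1]), (541591, [6, 0]), (593099, [0, 1, 1, 1, 7, 1, 1]), (606919, [7, 0, 0, 0, 0]),
   (591427, [2, 10, 1, 0]), (1481787, [8, 0, 6, 0, 1, 1, 1, 1]), (1483290, [8, 1, 8, 1, 1, 1]), (1876632, [1, 0, 1, 0, 1, 1]), (1873048, [0, 1, 0, 1]),
   (2515767, [8, 6, 0, 1, 1, 1, 1]), (2532373, [0, 1]), (2925716, [0, 1, 0, 1]), (2892692, [1, 0, 1, 0, 1, 1]), (3584460, [10, 9, 10]),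
   (4787397, [0, 0, 6, 1, 0, 0, 0]), (4793925, [1, 1, 0, 0, 0, 7, 1, 1]), (6532197, [8, 0, 0, 1, 1, 1]), (7085461, [8, 1, 1, 0, 0, 0, 6, 0]),
   (6825493, [8, 0, 0, 0, 7, 1, 1]), (6857924, [8, 0, 0, 0, 1, 1, 1]), (8995530, [0, 0, 0, 0, 6, 0]), (9012810, [1, 1, 0, 0, 7, 1, 1]),
   (9691754, [8, 1, 1, 1]), (10245018, [1, 8, 0, 6, 0, 1, 1, 1, 1]), (9995802, [8, 0, 0, 0, 0, 7, 1, 1]), (10003144, [8, 1, 1, 1, 0, 1]),
   (13192755, [1, 0]), (13215296, [0, 0, 0, 1, 0, 6, 0]), (14261448, [1, 0, 0, 8, 1, 1, 1]), (15295428, [8, 1, 1, 1, 0, 1]),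
   (16688656, [8, 1, 0, 1, 0, 0, 6, 0])]),
   (13192755, 7, [13192755], [88559, 90727, 101483, 173619, 156014, 25550], [(88559, [9, 10, 1, 0]), (90727, [1, 1, 1]), (101483, [9, 0, 10]), (108131, [0, 1, 7, 1, 1]), (173619, []), (284979, [9, 10]), (531611, [0, 1]),
   (541591, [1]), (547219, [9, 4, 0, 0]), (567007, [1, 0]), (593099, [0, 9, 4, 0, 0]), (606919, [7, 1, 1]), (608387, [9, 10]), (591427, []),
   (1481787, [0]), (2515767, []), (4787397, [1, 0, 0]), (4793925, [0, 1, 0, 9, 4, 0, 0]), (4802949, [0, 0, 9, 4, 0, 0]), (6532197, [0, 0]),
   (7085461, [1, 0, 0]), (6375717, [0, 9, 0, 10]), (6382117, [9, 10, 1, 0, 9, 4, 0, 0]), (6432305, [0, 1, 9, 4, 0, 0]), (6572337, [0, 0, 1, 7, 1, 1]),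
   (6832917, [1, 0, 1, 9, 4, 0, 0]), (6825493, [1, 0]), (6687793, [0]), (4269601, [9, 10, 1]), (4737297, [0]), (4801029, [1, 1, 0]),
   (6308401, [0, 1, 1]), (8995530, [1, 1, 0, 1]), (9012810, [1, 1, 0, 9, 4, 0, 0]), (9001098, [0, 0, 0, 9, 4, 0, 0]), (9691754, [0, 0, 0, 0]),
   (10245018, [1, 1, 0]), (9525290, [9, 10, 1, 0]), (9538602, [0, 0, 0, 1, 7, 1, 1]), (9602610, [1, 9, 4, 0, 0]), (9721906, [1, 7, 1, 1]),
   (9847346, [1, 1]), (9968666, [1, 0, 9, 4, 0, 0]), (9995802, [1, 0, 1]), (12822048, [0, 1, 0, 0, 9, 4, 0, 0]), (13195648, [0, 1, 0, 0]),
   (13215296, [0, 0, 1, 0]), (13392144, [0, 0, 1, 0, 9, 4, 0, 0]), (14261448, [0, 1, 0, 0]), (13863968, [0, 0]), (14425104, [0, 1, 0]),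
   (15295428, [0, 0, 1, 0, 0]), (16210208, [0, 0, 0]), (16688656, [1, 1, 0, 0]), (14901792, [0, 0, 0]), (15483664, [1, 1, 0]),
   (14027824, [1, 0, 0, 9, 4, 0, 0]), (15090224, [1, 1, 0, 1, 9, 4, 0, 0]), (8488482, [1, 1]), (8935442, [1]), (8981514, [0, 0]), (9440306, [1, 9, 10]),
   (12715568, [1, 0]), (12863536, [1, 1, 1, 0])]),
   (159, 6, [266655, 567007], [88559, 25550, 40141, 156014, 90727], [(88559, [8, 8, 0, 1, 1, 1]), (271262, [1, 0, 1, 1, 1]), (300189, [0, 1, 0, 1, 1, 5, 6, 0]), (434207, []), (531611, [8, 8, 0, 1, 1, 1]), (541591, [])]),
   (40991, 6, [434207, 567007], [173619, 108131, 90727, 25550, 88559], [(173619, [5, 1, 0]), (172143, [8]), (266655, []), (271262, [8, 1, 5, 0]), (300189, [8, 0, 1, 5, 0]), (303260, [5, 0, 1, 0, 1]),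
   (1481787, [1, 0, 1, 1, 1]), (1483290, [0, 1, 1, 5, 6, 0]), (2515767, []), (2532373, [1, 0, 1, 1, 1, 1])]),
   (262175, 6, [266655, 434207], [271262, 300189, 397615, 25550, 90727], [(271262, [1]), (300189, [4, 6, 0]), (397615, [0, 1, 1, 1]), (567007, []), (1481787, [1, 0, 1, 1, 1]), (2515767, [0, 1, 1])]),
   (266511, 6, [266655, 397615], [88559, 25550, 172143, 40141, 90727], [(88559, []), (401678, [1, 1, 1, 1, 5, 0]), (284979, [0, 1, 1, 6, 10, 1]), (430093, [0, 1, 5, 0]), (434207, [0, 1, 1, 1]), (1481787, [4, 0, 7, 1, 1]),
   (1462570, [1, 1, 1, 1, 5, 0]), (2515767, []), (2496805, [0, 1, 1, 1, 5, 0]), (3584460, [10, 9, 10])]),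
   (393231, 6, [434207, 397615], [172143, 88559, 25550, 40141, 90727], [(172143, []), (266655, [0, 1, 1, 1]), (401678, [5, 0, 1, 1, 1, 8, 1, 1, 1]), (430093, [3, 1, 7, 8, 1, 1, 1]), (1481787, [5, 0, 7, 1, 5, 0]),
   (2515767, [0, 1, 1, 8, 1, 5, 0])]),
   (407, 6, [266655, 541591], [88559, 25550, 156014, 90727, 40141], [(88559, [1, 1, 1, 8, 1, 1, 1]), (271262, [6, 10, 1]), (547219, []), (567007, []), (2515767, [4, 7, 0, 0, 0, 0]), (7085461, [0, 8, 1, 0, 0, 0, 0])]),
   (1587, 6, [173619, 13192755], [108131, 90727, 88559, 156014, 25550], [(108131, [9, 10]), (567007, [1, 9, 10]), (1481787, [0, 1, 1]), (2515767, []), (6432305, [9, 1, 10, 1]), (9602610, [1])]),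
   (16947, 6, [2515767, 13192755], [90727, 88559, 101483, 156014, 25550], [(90727, [1, 1, 1]), (173619, []), (284979, [1, 1, 1, 1]), (541591, [1]), (6308401, [0, 1, 1]), (9847346, [1, 1])]),
   (4499, 6, [266655, 547219], [88559, 284979, 531611, 40141, 90727], [(88559, [4, 0, 0]), (284979, [0, 1, 1]), (531611, [1, 0, 1, 1, 1]), (541591, []), (7085461, [4, 0, 0, 9, 1, 10]), (10245018, [1, 1, 1, 7, 10, 0])]),
   (591363, 6, [591427, 13192755], [108131, 90727, 88559, 173619, 25550], [(108131, [0, 1, 7, 1, 1]), (567007, []), (593099, [0, 0, 7, 0, 0, 0, 0]), (606919, [7, 1, 1]), (4793925, [2, 1, 1, 1, 1, 0, 5, 0]),
   (9012810, [1, 9, 1, 10, 7, 1, 1])]),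
   (31, 5, [266655, 434207, 567007], [88559, 25550, 40141, 90727], [(172143, []), (271262, [8, 1, 5, 0]), (300189, [8, 0, 4, 0, 0, 0]), (531611, [1, 0, 1, 1, 1]), (541591, [])]),
   (4367, 5, [88559, 266655, 397615], [25550, 172143, 40141, 90727], [(401678, [1, 5, 0]), (430093, [0, 1, 5, 0]), (172143, []), (135532, [4, 0, 0]), (284979, []), (531611, [0, 1, 1, 1, 8]), (541591, []),
   (1462570, [1, 1, 1, 1, 5, 0]), (2496805, [4, 0, 0, 1, 1, 1])]),
   (131087, 5, [172143, 434207, 397615], [88559, 25550, 40141, 90727], [(266655, []), (401678, [5, 0]), (430093, [5, 0, 1, 1, 1, 8]), (1481787, [5, 0, 7, 1, 5, 0]), (2515767, [5, 0, 1, 1, 1])]),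
   (151, 5, [266655, 541591, 567007], [88559, 25550, 40141, 90727], [(606919, [7, 1, 5, 0]), (271262, [1, 5]), (300189, [6, 0, 1, 5, 0]), (434207, []), (531611, [])]),
   (535, 5, [541591, 567007, 2515767], [90727, 25550, 88559, 40141], [(90727, []), (173619, [1]), (266655, []), (271262, [1, 0, 1, 1]), (6825493, [8, 7, 4, 0, 0, 0])]),
   (8215, 5, [434207, 567007, 2515767], [90727, 25550, 88559, 40141], [(90727, [8]), (173619, []), (266655, []), (271262, [8, 6, 10, 1]), (2532373, [8, 6, 0, 5, 0])]),
   (262407, 5, [266655, 397615, 2515767], [88559, 25550, 90727, 40141], [(541591, []), (401678, [1, 5, 0, 0, 1, 1]), (284979, [0, 1, 1, 1, 5]), (434207, [4, 7, 4, 0, 0, 0]), (2496805, [0, 1, 1, 1, 5, 0])]),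
   (563, 5, [173619, 2515767, 13192755], [90727, 88559, 156014, 25550], [(90727, [9, 10]), (284979, []), (541591, [1]), (6308401, [9, 5, 8, 0]), (9602610, [1, 1, 9, 10])]),
   (403, 5, [266655, 541591, 547219], [88559, 25550, 156014, 90727], [(88559, [1, 1, 1, 8, 1, 1, 1]), (271262, [1, 8]), (284979, [0, 1, 1]), (531611, []), (7085461, [0, 8, 1, 0, 0, 0, 0])]),
   (18451, 5, [284979, 547219, 13192755], [88559, 90727, 25550, 101483], [(608387, [9, 4, 0, 0]), (531611, []), (541591, [1, 9, 10]), (4737297, [0, 7, 8, 1, 1, 1]), (8935442, [1, 7, 8, 1, 1, 1])]),
   (525827, 5, [567007, 591427, 13192755], [108131, 90727, 25550, 88559], [(108131, [9, 5, 1, 0]), (531611, [2, 10, 6, 0]), (541591, [6, 0]), (4793925, [2, 0, 10, 6, 0]), (9012810, [2, 0, 0, 10, 6, 0])]),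
   (15, 4, [88559, 172143, 397615, 266655], [25550, 40141, 90727], [(401678, [1, 5, 0]), (430093, [0, 4, 0, 0, 0]), (90727, []), (101483, [0, 1, 1, 1])]),
   (23, 4, [266655, 434207, 567007, 541591], [88559, 25550, 40141], [(90727, []), (173619, []), (271262, [6, 8, 10]), (300189, [1, 0, 1, 1, 1, 1])]),
   (263, 4, [88559, 266655, 397615, 541591], [25550, 90727, 40141], [(401678, [6, 10]), (90727, []), (284979, []), (2496805, [6, 0, 5, 0])]),
   (519, 4, [90727, 567007, 606919, 541591], [25550, 88559, 40141], [(25550, [1, 1]), (172143, []), (591427, []), (4801029, [6, 7, 5, 1, 0, 0])]),
   (51, 4, [173619, 1481787, 2515767, 284979], [88559, 156014, 25550], [(90727, [9, 10]), (266655, []), (6308401, [0, 1, 1]), (9440306, [9, 3, 1])]),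
   (147, 4, [266655, 531611, 547219, 541591], [88559, 25550, 40141], [(608387, [7, 6, 10]), (173619, []), (271262, [1, 0, 1, 1, 1]), (300189, [6, 0, 1, 5, 0])]),
   (2067, 4, [284979, 547219, 531611, 13192755], [88559, 40141, 90727], [(608387, [9, 10]), (173619, []), (4737297, [0]), (8935442, [1, 7, 1, 1])]),
   (8211, 4, [173619, 434207, 567007, 2515767], [90727, 25550, 88559], [(90727, [8]), (266655, []), (271262, [5, 1, 0, 0]), (2532373, [8, 6, 0, 5, 0])]),
   (4355, 4, [88559, 266655, 397615, 284979], [531611, 40141, 90727], [(531611, [4, 9, 4, 0, 0]), (541591, []), (1462570, [4, 0, 0, 9, 10]), (2496805, [4, 0, 9, 10])]),
   (7, 3, [88559, 90727, 172143, 397615, 266655], [25550, 40141], [(401678, [6, 10]), (430093, []), (591427, [])]),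
   (19, 3, [173619, 434207, 567007, 1481787, 266655], [88559, 25550], [(591427, []), (8935442, [1]), (4737297, [4, 6, 0])]),
   (259, 3, [88559, 266655, 397615, 284979, 541591], [25550, 90727], [(401678, [6, 5, 4, 0]), (591427, []), (4737297, [6, 5])]),
   (515, 3, [90727, 108131, 173619, 567007, 541591], [25550, 88559], [(8488482, [1, 1]), (608387, []), (4269601, [6, 2, 10, 1])]),
   (3, 2, [88559, 90727, 101483, 172143, 173619, 266655], [25550], [(401678, [2, 10]), (430093, [])]),
   (5, 2, [40141, 88559, 170093, 172143, 90727, 266655], [25550], [(135532, [0, 10]), (591427, [])]),
   (1, 1, [40141, 88559, 170093, 101483, 172143, 90727, 173619], [], [])]"

text \<open>Facets in different orbits of the symmetries may still be joined by group elements that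
  do not preserve the whole perfect facet. The nine base facets become five in this way; the empty
  words mark the representatives.\<close>

definition base_words :: "(int \<times> nat list) list" where
  "base_words = [(591427, []), (430093, [3, 1]), (266655, []), (434207, []), (541591, [6, 0, 0, 1, 1, 1]), (606919, [7, 1, 1]), (567007, []), (13192755, []), (3584460, [10])]"

text \<open>The image vector occurs in \<open>vtab\<close> only up to a root of unity; comparing
  \<open>herm_coords\<close> absorbs this ambiguity.\<close>

definition gen_ok :: "(zvec \<times> zvec) \<times> int list \<Rightarrow> bool" where
  "gen_ok g = (case g of (M, ms) \<Rightarrow> length ms = 24 \<and>
     list_all (\<lambda>(v, m). m = 0 \<or> list_ex (\<lambda>(p, w). p = m \<and> herm_coords (zapply M v) = herm_coords w) (zip pows vtab)) (zip vtab ms))"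

text \<open>As the form has value 1 at all vertices, this says that its change under the group
  element vanishes exactly on the vertices in \<open>Z\<close> and is positive at the
  others.\<close>

definition base_ok :: "(zvec \<times> zvec) \<times> int list \<Rightarrow> int \<Rightarrow> bool" where
  "base_ok g Z = (case g of (M, ms) \<Rightarrow>
     list_all (\<lambda>(p, v). if Z AND p = 0 then 1 < form_coords (herm_coords (zapply M v)) else form_coords (herm_coords (zapply M v)) = 1) (zip pows vtab))"

definition facets :: "int list" where "facets = map fst orbit"

definition gen_maps :: "int list list" where "gen_maps = map snd gens"

definition stab :: "nat \<Rightarrow> int list" where "stab k = gen_maps ! k"

text \<open>The tables are passed as arguments so that symbolic evaluation unfolds each of them only once.\<close>

primrec orbit_ok :: "int list \<Rightarrow> int list \<Rightarrow> int list \<Rightarrow> int list \<Rightarrow> (int \<times> nat \<times> int) list \<Rightarrow> bool" where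
  "orbit_ok a b bs acc [] \<longleftrightarrow> True"
| "orbit_ok a b bs acc (e # es) \<longleftrightarrow> (case e of (Z, k, Y) \<Rightarrow>
     (if k = 2 then List.member bs Z else (k = 0 \<or> k = 1) \<and> List.member acc Y \<and> img (if k = 0 then a else b) Y = Z) \<and>
     orbit_ok a b bs (Z # acc) es)"

definition closed_under :: "int list \<Rightarrow> int list \<Rightarrow> bool" where
  "closed_under ms Zs \<longleftrightarrow> list_all (\<lambda>Z. List.member Zs (img ms Z)) Zs"

text \<open>A neighbour sends only some of the 24 vertices to vertices, so a word is valid only
  while the current face stays inside the facet. Words act from left to right.\<close>

primrec follow :: "int list list \<Rightarrow> nat list \<Rightarrow> int \<Rightarrow> int option" where
  "follow gm [] S = Some S"
| "follow gm (k # ks) S = (if k < length gm \<and> defined (gm ! k) S then follow gm ks (img (gm ! k) S) else None)"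

definition nodes_in :: "int list \<Rightarrow> node list \<Rightarrow> bool" where
  "nodes_in fs nds \<longleftrightarrow> list_all (\<lambda>(S, n, up, down, m, K). subl up fs \<and> subl down fs \<and> subl K fs) nds"

type_synonym rep = "int \<times> nat \<times> int list \<times> int list \<times> (int \<times> nat list) list"

definition rep_ok :: "int list \<Rightarrow> int list list \<Rightarrow> node list \<Rightarrow> int list \<Rightarrow> rep \<Rightarrow> bool" where
  "rep_ok fs gm nds Rs r = (case r of (R, n, up, down, Kw) \<Rightarrow> flag R n up down \<and>
     subl up fs \<and> subl down fs \<and> subl (map fst Kw) fs \<and>
     (n = 1 \<or> simplicial R (map fst Kw) \<or> list_ex (\<lambda>(S, _, _, _, _, K). S = R \<and> subl K (map fst Kw)) nds) \<and>
     list_all (\<lambda>(Z, w). case follow gm w (R AND Z) of None \<Rightarrow> False | Some R' \<Rightarrow> List.member Rs R') Kw)"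

section \<open>Evaluation of the certificates\<close>

lemma gens_ok: "list_all gen_ok gens" by code_simp
lemma gens_det: "list_all (\<lambda>(M, ms). cyc_norm (zdet M) = 1) gens" by code_simp
lemma bases_ok: "list_all2 base_ok (drop 2 gens) bases" by code_simp
lemma length_gens: "length gens = 11" by code_simp
lemma perm_ok: "list_all (List.member (stab 0)) pows" "list_all (List.member (stab 1)) pows" by code_simp+
lemma orbit_ok: "orbit_ok (stab 0) (stab 1) bases [] orbit" by code_simp
lemma facets_closed: "closed_under (stab 0) facets" "closed_under (stab 1) facets" by code_simp+
lemma facets_proper: "list_all (\<lambda>Z. list_ex (\<lambda>p. Z AND p = 0) pows) facets" by code_simp
lemma vtab_form: "list_all (\<lambda>v. form_coords (herm_coords v) = 1) vtab" by code_simp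
lemma nodes_ok: "nodes_ok nodes" by code_simp
lemma nodes_in: "nodes_in facets nodes" by code_simp
lemma bases_children: "list_all (child_ok nodes 8 facets) bases" by code_simp
lemma facet_at_0: "list_ex even facets" by code_simp
lemma reps_ok: "list_all (rep_ok facets gen_maps nodes (map fst reps)) reps" by code_simp
lemma base_words_ok: "list_all (\<lambda>(Z, w). case follow gen_maps w Z of None \<Rightarrow> False | Some R' \<Rightarrow> List.member (map fst reps) R') base_words" by code_simp
lemma base_words_bases: "map fst base_words = bases" by code_simp

section \<open>Incidence certificates for a polyhedral cone\<close>

definition bits :: "int \<Rightarrow> nat set" where "bits S = {i. i < 24 \<and> bit S i}"

text \<open>Masks are unbounded integers. Without bits beyond the 24 vertices they are determined by
  \<open>bits\<close>, so that different masks mean different vertex sets.\<close>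

definition rng :: "int \<Rightarrow> bool" where "rng S \<longleftrightarrow> S AND full = S"

lemma bit_full: "bit full i \<longleftrightarrow> i < 24"
proof -
  have f: "full = mask 24" by (simp add: full_def mask_eq_exp_minus_1)
  show ?thesis unfolding f bit_mask_iff by simp
qed

lemma bits_full: "bits full = {..<24}"
  by (auto simp: bits_def bit_full)

lemma finite_bits [simp]: "finite (bits S)"
  by (rule finite_subset[of _ "{..<24}"]) (auto simp: bits_def)

lemma bits_and: "bits (S AND Z) = bits S \<inter> bits Z"
  by (auto simp: bits_def bit_and_iff)

lemma rng_full: "rng full" by (simp add: rng_def)

lemma rng_and: "rng S \<Longrightarrow> rng (S AND Z)"
  unfolding rng_def by (metis and.commute and.left_commute)

lemma rng_bit: "rng S \<Longrightarrow> bit S i \<longleftrightarrow> i \<in> bits S"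
  unfolding rng_def bits_def by (metis bit_and_iff bit_full mem_Collect_eq)

lemma rng_eqI: "rng S \<Longrightarrow> rng T \<Longrightarrow> bits S = bits T \<Longrightarrow> S = T"
  by (rule bit_eqI) (simp add: rng_bit)

lemma bits_0: "bits 0 = {}" by (simp add: bits_def)

lemma rng_0: "rng 0" by (simp add: rng_def)

lemma pows_eq: "pows = map (\<lambda>v. 2 ^ v) [0..<24]" by code_simp

lemma and_pow: "S AND 2 ^ v = (if bit S v then 2 ^ v else (0::int))"
  by (rule bit_eqI) (auto simp: bit_and_iff bit_exp_iff)

lemma and_pow_0: "S AND 2 ^ v = (0::int) \<longleftrightarrow> \<not> bit S v"
  by (simp add: and_pow)

lemma and_pow_pow: "S AND 2 ^ v = (2 ^ v :: int) \<longleftrightarrow> bit S v"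
  by (simp add: and_pow)

lemma count_eq: "count S = card (bits S)"
proof -
  have "count S = length (filter (bit S) [0..<24])"
    by (simp add: count_def pows_eq filter_map o_def and_pow_0)
  also have "\<dots> = card {i. i < 24 \<and> bit S i}"
    by (simp add: length_filter_conv_card cong: conj_cong)
  finally show ?thesis by (simp add: bits_def)
qed

text \<open>The version of \<open>simplicial\<close> for vertex sets; it passes to subsets of
  \<open>B\<close>, as an induction over the vertices demands.\<close>

definition simp_on :: "nat set \<Rightarrow> int set \<Rightarrow> bool" where
  "simp_on B K \<longleftrightarrow> (\<forall>v\<in>B. \<exists>Z\<in>K. \<not> bit Z v \<and> (\<forall>w\<in>B - {v}. bit Z w))"

lemma simplicial_simp_on: assumes "simplicial S K" shows "simp_on (bits S) (set K)"
  unfolding simp_on_def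
proof
  fix v assume v: "v \<in> bits S"
  then have "S AND 2 ^ v \<noteq> 0" by (simp add: bits_def and_pow_0)
  moreover have "2 ^ v \<in> set pows" using v by (simp add: pows_eq bits_def)
  ultimately obtain Z where Z: "Z \<in> set K" "S AND Z = S XOR 2 ^ v"
    using assms unfolding simplicial_def list_all_iff list_ex_iff by blast
  have "bit (S AND Z) w \<longleftrightarrow> bit (S XOR 2 ^ v) w" for w using Z(2) by simp
  then have *: "bit S w \<and> bit Z w \<longleftrightarrow> bit S w \<noteq> (w = v)" for w
    by (auto simp: bit_and_iff bit_xor_iff bit_exp_iff)
  show "\<exists>Z\<in>set K. \<not> bit Z v \<and> (\<forall>w\<in>bits S - {v}. bit Z w)"
    using Z(1) * v by (intro bexI[of _ Z]) (auto simp: bits_def)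
qed

lemma rng_meet: "rng S \<Longrightarrow> rng (meet S Zs)"
  unfolding meet_def by (induction Zs arbitrary: S) (auto simp: rng_and)

lemma bit_img: "bit (img ms S) j \<longleftrightarrow> (\<exists>i<length ms. bit S i \<and> bit (ms ! i) j)"
proof (induction ms arbitrary: S)
  case (Cons m ms)
  have "bit (img (m # ms) S) j \<longleftrightarrow> (bit S 0 \<and> bit m j) \<or> (\<exists>i<length ms. bit S (Suc i) \<and> bit (ms ! i) j)"
    by (auto simp: bit_or_iff Cons.IH bit_Suc bit_0)
  also have "\<dots> \<longleftrightarrow> (\<exists>i<length (m # ms). bit S i \<and> bit ((m # ms) ! i) j)"
    by (auto simp: less_Suc_eq_0_disj)
  finally show ?case .
qed simp

lemma defined_iff: "defined ms S \<Longrightarrow> i < length ms \<Longrightarrow> bit S i \<Longrightarrow> ms ! i \<noteq> 0"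
proof (induction ms arbitrary: S i)
  case (Cons m ms)
  show ?case
  proof (cases i)
    case 0 then show ?thesis using Cons.prems by (simp add: bit_0)
  next
    case (Suc k) then show ?thesis using Cons.prems Cons.IH[of "S div 2" k] by (simp add: bit_Suc)
  qed
qed simp

section \<open>Generated cones and functionals on spans\<close>

definition cn :: "'a::real_vector set \<Rightarrow> 'a set" where
  "cn A = {\<Sum>y\<in>A. a y *\<^sub>R y | a. \<forall>y\<in>A. 0 \<le> a y}"

lemma cn_mono: assumes "A \<subseteq> B" "finite B" shows "cn A \<subseteq> cn B"
proof
  fix p assume "p \<in> cn A"
  then obtain a where a: "\<forall>y\<in>A. 0 \<le> a y" "p = (\<Sum>y\<in>A. a y *\<^sub>R y)" by (auto simp: cn_def)
  have "(\<Sum>y\<in>B. (if y \<in> A then a y else 0) *\<^sub>R y) = (\<Sum>y\<in>A. (if y \<in> A then a y else 0) *\<^sub>R y)"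
    using assms by (intro sum.mono_neutral_right) auto
  also have "\<dots> = p" unfolding a(2) by (intro sum.cong) auto
  finally show "p \<in> cn B" unfolding cn_def using a(1) by (intro CollectI exI[of _ "\<lambda>y. if y \<in> A then a y else 0"]) auto
qed

lemma cn_add_ray: assumes "p \<in> cn A" "finite A" "y \<in> A" "0 \<le> t" shows "t *\<^sub>R y + p \<in> cn A"
proof -
  obtain a where a: "\<forall>y\<in>A. 0 \<le> a y" "p = (\<Sum>y\<in>A. a y *\<^sub>R y)" using assms(1) by (auto simp: cn_def)
  have "(\<Sum>z\<in>A. (a z + (if z = y then t else 0)) *\<^sub>R z) = p + (\<Sum>z\<in>A. (if z = y then t else 0) *\<^sub>R z)"
    unfolding a(2) by (simp add: scaleR_add_left sum.distrib)
  also have "(\<Sum>z\<in>A. (if z = y then t else 0) *\<^sub>R z) = (\<Sum>z\<in>A. if z = y then t *\<^sub>R z else 0)"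
    by (intro sum.cong) auto
  also have "\<dots> = t *\<^sub>R y" using assms(2,3) by simp
  finally show ?thesis unfolding cn_def using a(1) assms(4)
    by (intro CollectI exI[of _ "\<lambda>z. a z + (if z = y then t else 0)"]) (auto simp: add.commute)
qed

lemma cn_image: assumes "linear g" "inj g" "p \<in> cn A" shows "g p \<in> cn (g ` A)"
proof -
  obtain a where a: "\<forall>y\<in>A. 0 \<le> a y" "p = (\<Sum>y\<in>A. a y *\<^sub>R y)" using assms(3) by (auto simp: cn_def)
  have "g p = (\<Sum>y\<in>A. a y *\<^sub>R g y)" unfolding a(2) linear_sum[OF assms(1)] linear_scale[OF assms(1)] ..
  also have "\<dots> = (\<Sum>y\<in>g ` A. a (inv g y) *\<^sub>R y)"
    using assms(2) by (subst sum.reindex) (auto intro: inj_on_subset)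
  finally show ?thesis unfolding cn_def using a(1) assms(2) by (intro CollectI exI[of _ "\<lambda>y. a (inv g y)"]) auto
qed

lemma dim_drop:
  fixes f :: "'a::euclidean_space \<Rightarrow> real"
  assumes "linear f" "\<And>y. y \<in> A \<Longrightarrow> f y = 0" "f z \<noteq> 0" "insert z A \<subseteq> span B"
  shows "dim A + 1 \<le> dim B"
proof -
  have "\<And>y. y \<in> span A \<Longrightarrow> f y = 0" using linear_eq_0_on_span[OF assms(1)] assms(2) by blast
  then have "z \<notin> span A" using assms(3) by blast
  then have "dim (insert z A) = dim A + 1" by (simp add: dim_insert)
  moreover have "dim (insert z A) \<le> dim B" by (rule dim_mono[OF assms(4)])
  ultimately show ?thesis by simp
qed

text \<open>A further point of the kernel would raise the dimension to that of \<open>B\<close> and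
  leave no room for \<open>z\<close>, which lies outside the kernel.\<close>

lemma kernel_span:
  fixes f :: "'a::euclidean_space \<Rightarrow> real"
  assumes "linear f" "\<And>y. y \<in> A \<Longrightarrow> f y = 0" "f z \<noteq> 0" "insert z A \<subseteq> span B" "dim B \<le> dim A + 1"
    "p \<in> span B" "f p = 0"
  shows "p \<in> span A"
proof (rule ccontr)
  assume "p \<notin> span A"
  then have "dim (insert p A) = dim A + 1" by (simp add: dim_insert)
  moreover have "dim (insert p A) + 1 \<le> dim B"
    by (rule dim_drop[OF assms(1) _ assms(3)]) (use assms in auto)
  ultimately show False using assms(5) by simp
qed

text \<open>Available are only the signs of linear functionals at nonzero points and an upper bound
  for the dimension; exact dimensions of faces have to follow from chains of incidences.\<close>

locale config =
  fixes x :: "nat \<Rightarrow> 'a::euclidean_space" and FS :: "int set" and l :: "int \<Rightarrow> 'a \<Rightarrow> real"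
  assumes linear_l: "Z \<in> FS \<Longrightarrow> linear (l Z)"
    and l_zero: "Z \<in> FS \<Longrightarrow> i < 24 \<Longrightarrow> bit Z i \<Longrightarrow> l Z (x i) = 0"
    and l_pos: "Z \<in> FS \<Longrightarrow> i < 24 \<Longrightarrow> \<not> bit Z i \<Longrightarrow> 0 < l Z (x i)"
    and x_nz: "i < 24 \<Longrightarrow> x i \<noteq> 0"
    and dim_x: "dim (x ` {..<24}) \<le> 8"
begin

definition pts :: "int \<Rightarrow> 'a set" where "pts S = x ` bits S"

text \<open>The substantial half of a description by inequalities. It is preserved when
  \<open>K\<close> grows, so a node can work with its own list of inequalities on all faces below
  it.\<close>

definition Gp :: "int \<Rightarrow> int set \<Rightarrow> bool" where
  "Gp S K \<longleftrightarrow> (\<forall>p\<in>span (pts S). (\<forall>Z\<in>K. 0 \<le> l Z p) \<longrightarrow> p \<in> cn (pts S))"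

lemma finite_pts [simp]: "finite (pts S)" by (simp add: pts_def)

lemma l_nonneg: "Z \<in> FS \<Longrightarrow> i < 24 \<Longrightarrow> 0 \<le> l Z (x i)"
  using l_zero l_pos by (metis less_eq_real_def)

lemma pts_and: "pts (S AND Z) \<subseteq> pts S" "pts (S AND Z) \<subseteq> pts Z"
  by (auto simp: pts_def bits_and)

lemma l_pts: "Z \<in> FS \<Longrightarrow> y \<in> pts Z \<Longrightarrow> l Z y = 0"
  by (auto simp: pts_def bits_def l_zero)

lemma Gp_mono: "Gp S K \<Longrightarrow> K \<subseteq> K' \<Longrightarrow> Gp S K'"
  unfolding Gp_def by blast

lemma step_dim:
  assumes "rng S" "Z \<in> FS" "S AND Z \<noteq> S" shows "dim (pts (S AND Z)) + 1 \<le> dim (pts S)"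
proof -
  have "bits (S AND Z) \<noteq> bits S" using rng_eqI[of "S AND Z" S] assms rng_and by blast
  then obtain i where "i \<in> bits S" "i \<notin> bits Z" unfolding bits_and by blast
  then have i: "i \<in> bits S" "\<not> bit Z i" by (auto simp: bits_def)
  show ?thesis
  proof (rule dim_drop[OF linear_l[OF assms(2)]])
    show "l Z (x i) \<noteq> 0" using l_pos[OF assms(2), of i] i by (auto simp: bits_def)
    show "l Z y = 0" if "y \<in> pts (S AND Z)" for y using that l_pts[OF assms(2)] pts_and(2) by blast
    show "insert (x i) (pts (S AND Z)) \<subseteq> span (pts S)"
      using i pts_and(1)[of S Z] span_superset[of "pts S"] by (auto simp: pts_def)
  qed
qed

lemma chain_dim:
  "rng S \<Longrightarrow> chain Zs S \<Longrightarrow> set Zs \<subseteq> FS \<Longrightarrow> dim (pts (meet S Zs)) + length Zs \<le> dim (pts S)"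
proof (induction Zs arbitrary: S)
  case (Cons Z Zs)
  have "dim (pts (meet (S AND Z) Zs)) + length Zs \<le> dim (pts (S AND Z))"
    using Cons.prems by (intro Cons.IH rng_and) auto
  moreover have "dim (pts (S AND Z)) + 1 \<le> dim (pts S)" using Cons.prems by (intro step_dim) auto
  ultimately show ?case by (simp add: meet_def)
qed (simp add: meet_def)

lemma flag_dim:
  assumes "flag S n up down" "set up \<subseteq> FS" "set down \<subseteq> FS"
  shows "rng S" "dim (pts S) = n" "bits S \<noteq> {}"
proof -
  have f: "chain up full" "meet full up = S" "length up + n = 8" "chain down S" "meet S down \<noteq> 0" "Suc (length down) = n"
    using assms(1) by (auto simp: flag_def)
  show S: "rng S" using rng_meet[OF rng_full] f(2) by metis
  have "dim (pts S) + length up \<le> dim (pts full)" using chain_dim[OF rng_full f(1) assms(2)] f(2) by simp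
  moreover have "dim (pts full) \<le> 8" using dim_x by (simp add: pts_def bits_full)
  ultimately have le: "dim (pts S) \<le> n" using f(3) by simp
  have ne: "bits (meet S down) \<noteq> {}"
    using rng_eqI[OF rng_meet[OF S] rng_0] f(5) bits_0 by metis
  then obtain i where i: "i \<in> bits (meet S down)" by blast
  \<comment> \<open>The nonempty bottom of the lower chain contributes one dimension; this is the
    \<open>Suc\<close> in \<open>flag\<close>.\<close>
  have "\<not> pts (meet S down) \<subseteq> {0}" using i x_nz[of i] by (auto simp: pts_def bits_def)
  then have d0: "0 < dim (pts (meet S down))" by (metis dim_eq_0 gr0I)
  have c: "dim (pts (meet S down)) + length down \<le> dim (pts S)" by (rule chain_dim[OF S f(4) assms(3)])
  then show "dim (pts S) = n" using f(6) le d0 by linarith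
  have "0 < dim (pts S)" using c d0 by linarith
  then show "bits S \<noteq> {}" by (auto simp: pts_def)
qed

lemma simp_on_dim:
  assumes "finite B" "B \<subseteq> {..<24}" "simp_on B K" "K \<subseteq> FS" shows "card B \<le> dim (x ` B)"
  using assms(1-3)
proof (induction B rule: finite_induct)
  case (insert v B)
  have "simp_on B K" using insert.prems(2) unfolding simp_on_def by blast
  then have IH: "card B \<le> dim (x ` B)" using insert by auto
  obtain Z where Z: "Z \<in> K" "\<not> bit Z v" "\<forall>w\<in>insert v B - {v}. bit Z w" using insert.prems(2) unfolding simp_on_def by blast
  have "dim (x ` B) + 1 \<le> dim (x ` insert v B)"
  proof (rule dim_drop[OF linear_l[of Z]])
    show "Z \<in> FS" using Z assms(4) by blast
    show "l Z (x v) \<noteq> 0" using l_pos[of Z v] Z assms(4) insert.prems(1) by auto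
    show "l Z y = 0" if "y \<in> x ` B" for y using that Z assms(4) insert l_zero[of Z] by auto
    show "insert (x v) (x ` B) \<subseteq> span (x ` insert v B)" by (auto intro: span_base)
  qed
  then show ?case using IH insert by simp
qed simp

text \<open>The functional opposite to a vertex isolates the coefficient of that vertex, up to a
  positive factor.\<close>

lemma simp_on_Gp: assumes "simp_on (bits S) K" "K \<subseteq> FS" shows "Gp S K"
  unfolding Gp_def
proof (intro ballI impI)
  fix p assume "p \<in> span (pts S)" and pos: "\<forall>Z\<in>K. 0 \<le> l Z p"
  then obtain u where u: "p = (\<Sum>y\<in>pts S. u y *\<^sub>R y)" by (auto simp: span_finite)
  have "0 \<le> u y" if "y \<in> pts S" for y
  proof -
    obtain v where v: "v \<in> bits S" "y = x v" using \<open>y \<in> pts S\<close> by (auto simp: pts_def)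
    obtain Z where Z: "Z \<in> K" "\<not> bit Z v" "\<forall>w\<in>bits S - {v}. bit Z w" using assms(1) v unfolding simp_on_def by blast
    have ZF: "Z \<in> FS" using Z assms(2) by blast
    have lv: "0 < l Z y" using l_pos[OF ZF _ Z(2)] v by (auto simp: bits_def)
    have "l Z p = (\<Sum>z\<in>pts S. u z * l Z z)"
      unfolding u linear_sum[OF linear_l[OF ZF]] linear_scale[OF linear_l[OF ZF]] by simp
    also have "\<dots> = (\<Sum>z\<in>pts S. if z = y then u z * l Z z else 0)"
    proof (intro sum.cong refl)
      fix z assume "z \<in> pts S"
      then obtain w where w: "w \<in> bits S" "z = x w" by (auto simp: pts_def)
      show "u z * l Z z = (if z = y then u z * l Z z else 0)"
        using w v Z l_zero[OF ZF, of w] by (cases "w = v") (auto simp: bits_def)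
    qed
    also have "\<dots> = u y * l Z y" using that by simp
    finally have "0 \<le> u y * l Z y" using pos Z(1) by auto
    then show ?thesis using lv by (simp add: zero_le_mult_iff)
  qed
  then show "p \<in> cn (pts S)" unfolding cn_def u by blast
qed

text \<open>Subtracting the largest admissible multiple of a vertex moves a point into a facet.\<close>

lemma shoot_Gp:
  assumes K: "finite K" "K \<subseteq> FS" and v: "v \<in> bits S" and ex: "\<exists>Z\<in>K. \<not> bit Z v"
    and fac: "\<And>Z. Z \<in> K \<Longrightarrow> \<not> bit Z v \<Longrightarrow> dim (pts S) \<le> dim (pts (S AND Z)) + 1 \<and> Gp (S AND Z) K"
  shows "Gp S K"
  unfolding Gp_def
proof (intro ballI impI)
  fix p assume p: "p \<in> span (pts S)" and pos: "\<forall>Z\<in>K. 0 \<le> l Z p"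
  define K' where "K' = {Z \<in> K. \<not> bit Z v}"
  have K': "finite K'" "K' \<noteq> {}" using K ex by (auto simp: K'_def)
  have v24: "v < 24" using v by (simp add: bits_def)
  have lv: "0 < l Z (x v)" if "Z \<in> K'" for Z using l_pos[of Z v] that K(2) v24 by (auto simp: K'_def)
  define t where "t = Min ((\<lambda>Z. l Z p / l Z (x v)) ` K')"
  have "t \<in> (\<lambda>Z. l Z p / l Z (x v)) ` K'" unfolding t_def using K' by (intro Min_in) auto
  then obtain Z where Z: "Z \<in> K'" "t = l Z p / l Z (x v)" by blast
  have t_le: "t \<le> l Y p / l Y (x v)" if "Y \<in> K'" for Y unfolding t_def using K' that by (intro Min_le) auto
  have t0: "0 \<le> t" unfolding Z(2) using lv[OF Z(1)] pos Z(1) by (auto simp: K'_def)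
  define q where "q = p - t *\<^sub>R x v"
  have lq: "l Y q = l Y p - t * l Y (x v)" if "Y \<in> K" for Y
    unfolding q_def using linear_l[of Y] that K(2) by (auto simp: linear_diff linear_scale)
  have "0 \<le> l Y q" if "Y \<in> K" for Y
  proof (cases "bit Y v")
    case True
    then show ?thesis using lq[OF that] l_zero[of Y v] pos that K(2) v24 by auto
  next
    case False
    then have "Y \<in> K'" using that by (simp add: K'_def)
    then have "t * l Y (x v) \<le> l Y p" using t_le lv by (simp add: field_simps)
    then show ?thesis using lq[OF that] by simp
  qed
  moreover have "q \<in> span (pts (S AND Z))"
  proof (rule kernel_span[of "l Z" _ "x v" "pts S"])
    show "linear (l Z)" using Z K(2) linear_l by (auto simp: K'_def)
    show "l Z (x v) \<noteq> 0" using lv[OF Z(1)] by simp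
    show "l Z y = 0" if "y \<in> pts (S AND Z)" for y
      using l_pts[of Z y] pts_and(2)[of S Z] that Z(1) K(2) by (auto simp: K'_def)
    show "insert (x v) (pts (S AND Z)) \<subseteq> span (pts S)"
      using v pts_and(1)[of S Z] span_superset[of "pts S"] by (auto simp: pts_def)
    show "dim (pts S) \<le> dim (pts (S AND Z)) + 1" using fac Z(1) by (auto simp: K'_def)
    show "q \<in> span (pts S)" unfolding q_def using v
      by (intro span_diff span_scale p span_base) (simp add: pts_def)
    show "l Z q = 0" using lq[of Z] Z lv[OF Z(1)] by (simp add: K'_def)
  qed
  moreover have "Gp (S AND Z) K" using fac Z(1) by (auto simp: K'_def)
  ultimately have "q \<in> cn (pts (S AND Z))" unfolding Gp_def by blast
  then have "q \<in> cn (pts S)" using cn_mono[OF pts_and(1)] by auto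
  then have "t *\<^sub>R x v + q \<in> cn (pts S)" using v t0 by (intro cn_add_ray) (auto simp: pts_def)
  then show "p \<in> cn (pts S)" by (simp add: q_def)
qed

lemma subl_iff: "subl K L \<longleftrightarrow> set K \<subseteq> set L"
  by (auto simp: subl_def list_all_iff)

definition node_facets :: "node \<Rightarrow> bool" where
  "node_facets nd \<longleftrightarrow> (case nd of (S, n, up, down, m, K) \<Rightarrow> set up \<subseteq> FS \<and> set down \<subseteq> FS \<and> set K \<subseteq> FS)"

definition node_sound :: "node \<Rightarrow> bool" where
  "node_sound nd \<longleftrightarrow> (case nd of (S, n, up, down, m, K) \<Rightarrow> Gp S (set K) \<and> dim (pts S) = n \<and> rng S)"

lemma child_ok_sound:
  assumes "child_ok nds n K f" "set K \<subseteq> FS" "\<And>nd. nd \<in> set nds \<Longrightarrow> node_sound nd"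
  shows "Gp f (set K) \<and> n \<le> dim (pts f) + 1"
  using assms(1) unfolding child_ok_def
proof
  assume a: "simplicial f K \<and> Suc (count f) = n"
  then have "simp_on (bits f) (set K)" using simplicial_simp_on by blast
  then show ?thesis using a simp_on_Gp simp_on_dim[of "bits f" "set K"] assms(2)
    by (auto simp: count_eq pts_def) (auto simp: bits_def)
next
  assume "list_ex (\<lambda>(S, n', _, _, _, K'). S = f \<and> Suc n' = n \<and> subl K' K) nds"
  then obtain n' up down m K' where "(f, n', up, down, m, K') \<in> set nds" "Suc n' = n" "set K' \<subseteq> set K"
    unfolding list_ex_iff subl_iff by fastforce
  then show ?thesis using assms(3)[of "(f, n', up, down, m, K')"] Gp_mono by (auto simp: node_sound_def)
qed

lemma nodes_sound:
  "nodes_ok nds \<Longrightarrow> (\<And>nd. nd \<in> set nds \<Longrightarrow> node_facets nd) \<Longrightarrow> nd \<in> set nds \<Longrightarrow> node_sound nd"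
proof (induction nds arbitrary: nd)
  case (Cons nd' nds)
  have IH: "node_sound nd" if "nd \<in> set nds" for nd using Cons that by auto
  obtain S n up down m K where nd': "nd' = (S, n, up, down, m, K)" by (metis prod_cases6)
  have F: "set up \<subseteq> FS" "set down \<subseteq> FS" "set K \<subseteq> FS" using Cons.prems(2)[of nd'] by (auto simp: nd' node_facets_def)
  have ok: "flag S n up down" "m \<in> set pows" "S AND m = m" "\<exists>Z\<in>set K. Z AND m = 0"
    "\<And>Z. Z \<in> set K \<Longrightarrow> Z AND m = m \<or> child_ok nds n K (S AND Z)"
    using Cons.prems(1) by (auto simp: nd' node_ok_def list_all_iff list_ex_iff)
  note fl = flag_dim[OF ok(1) F(1,2)]
  obtain v where v: "v < 24" "m = 2 ^ v" using ok(2) by (auto simp: pows_eq)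
  have "Gp S (set K)"
  proof (rule shoot_Gp)
    show "finite (set K)" "set K \<subseteq> FS" using F by auto
    show "v \<in> bits S" using ok(3) v by (simp add: and_pow_pow bits_def)
    show "\<exists>Z\<in>set K. \<not> bit Z v" using ok(4) v by (simp add: and_pow_0)
    fix Z assume Z: "Z \<in> set K" "\<not> bit Z v"
    then have "child_ok nds n K (S AND Z)" using ok(5)[of Z] v by (simp add: and_pow_pow)
    from child_ok_sound[OF this F(3) IH]
    show "dim (pts S) \<le> dim (pts (S AND Z)) + 1 \<and> Gp (S AND Z) (set K)" using fl(2) by auto
  qed
  then have "node_sound nd'" using fl by (auto simp: nd' node_sound_def)
  then show ?case using Cons.prems(3) IH by (metis set_ConsD)
qed simp

text \<open>On the span of \<open>B\<close> both functionals have the span of \<open>A\<close> as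
  kernel and are positive at the same \<open>z\<close>, so they are positive multiples of each
  other. This compares the functional of a facet with that of its image under a symmetry, which come
  from independent choices of group elements.\<close>

lemma proportional:
  assumes "linear (f :: 'a \<Rightarrow> real)" "linear f'" "\<And>y. y \<in> A \<Longrightarrow> f y = 0" "\<And>y. y \<in> A \<Longrightarrow> f' y = 0" "0 < f z" "0 < (f' z :: real)"
    "insert z A \<subseteq> span B" "dim B \<le> dim A + 1" "p \<in> span B" "0 \<le> f p"
  shows "0 \<le> f' (p :: 'a)"
proof -
  define c where "c = f p / f z"
  have "f (p - c *\<^sub>R z) = 0" using assms(1,5) by (simp add: linear_diff linear_scale c_def)
  moreover have "p - c *\<^sub>R z \<in> span B" using assms(7,9) by (intro span_diff span_scale) auto
  ultimately have "p - c *\<^sub>R z \<in> span A"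
    using kernel_span[OF assms(1,3) _ assms(7,8), of "p - c *\<^sub>R z"] assms(5) by auto
  then have "f' (p - c *\<^sub>R z) = 0" using linear_eq_0_on_span[OF assms(2,4)] by blast
  then have "f' p = c * f' z" using assms(2) by (simp add: linear_diff linear_scale)
  then show ?thesis using assms(5,6,10) by (simp add: c_def)
qed

end

section \<open>The perfect form of type E8\<close>

no_notation fps_nth (infixl "$" 75)

declare One_nat_def [simp del]

section \<open>Integral vectors and matrices, and the group action\<close>

definition zc :: "zvec \<Rightarrow> complex ^ 2" where
  "zc v = (\<chi> i. if i = 1 then ival zeta (fst v) else ival zeta (snd v))"

definition zm :: "zvec \<times> zvec \<Rightarrow> cmat" where
  "zm M = (\<chi> i. if i = 1 then zc (fst M) else zc (snd M))"

lemma vectors_over_O5: "vectors_over O5 = range zc"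
proof
  show "range zc \<subseteq> vectors_over O5" by (auto simp: vectors_over_def O5_eq zc_def)
  show "vectors_over O5 \<subseteq> range zc"
  proof
    fix v assume "v \<in> vectors_over O5"
    then obtain a b where "v $ 1 = ival zeta a" "v $ 2 = ival zeta b"
      unfolding vectors_over_def O5_eq by blast
    then have "v = zc (a, b)" by (auto simp: zc_def vec_eq_iff forall_2)
    then show "v \<in> range zc" by blast
  qed
qed

lemma matrices_over_O5: "matrices_over O5 = range zm"
proof
  show "range zm \<subseteq> matrices_over O5" by (auto simp: matrices_over_def O5_eq zc_def zm_def)
  show "matrices_over O5 \<subseteq> range zm"
  proof
    fix g assume "g \<in> matrices_over O5"
    then have *: "g $ i $ j \<in> range (ival zeta)" for i j unfolding matrices_over_def O5_eq by blast
    obtain a b where "g $ 1 $ 1 = ival zeta a" "g $ 1 $ 2 = ival zeta b" using *[of 1 1] *[of 1 2] by blast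
    moreover obtain c d where "g $ 2 $ 1 = ival zeta c" "g $ 2 $ 2 = ival zeta d" using *[of 2 1] *[of 2 2] by blast
    ultimately have "g = zm ((a, b), (c, d))" by (auto simp: zc_def zm_def vec_eq_iff forall_2)
    then show "g \<in> range zm" by blast
  qed
qed

lemma O5_F5: "O5 \<subseteq> F5" by (auto simp: O5_def)

lemma F5_closed: "a \<in> F5 \<Longrightarrow> b \<in> F5 \<Longrightarrow> a + b \<in> F5 \<and> a * b \<in> F5"
  unfolding F5_eq by (auto simp: cval_add[symmetric] cval_mul[OF zeta_prim5, symmetric])

lemma O5_closed: "a \<in> O5 \<Longrightarrow> b \<in> O5 \<Longrightarrow> a + b \<in> O5 \<and> a * b \<in> O5"
  unfolding O5_eq by (auto simp: cval_add[symmetric] cval_mul[OF zeta_prim5, symmetric] cint_add[symmetric] cint_mult[symmetric])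

lemma O5_01: "0 \<in> O5" "1 \<in> O5"
proof -
  have "ival zeta (of_int 0) = 0" "ival zeta (of_int 1) = 1" unfolding cint_of_int cval_of_int by simp_all
  then show "0 \<in> O5" "1 \<in> O5" unfolding O5_eq by (metis rangeI)+
qed

text \<open>The embeddings are controlled only on \<open>F5\<close>, which explains the membership
  hypotheses in the lemmas on vectors and matrices. Both places are treated alike through
  \<open>Iota_cval\<close>.\<close>

definition Iota :: "(complex \<Rightarrow> complex) \<Rightarrow> bool" where
  "Iota f \<longleftrightarrow> f = iota1 \<or> f = iota2"

lemma Iota_cval: assumes "Iota f" shows "\<exists>w. prim5 w \<and> (\<forall>x. f (cval zeta x) = cval w x)"
  using assms iota1_cval iota2_cval zeta_prim5 prim5_cube unfolding Iota_def by metis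

lemma Iota_add: assumes "Iota f" "a \<in> F5" "b \<in> F5" shows "f (a + b) = f a + f b"
  using Iota_cval[OF assms(1)] assms(2,3) unfolding F5_eq by (auto simp: cval_add[symmetric])

lemma Iota_mult: assumes "Iota f" "a \<in> F5" "b \<in> F5" shows "f (a * b) = f a * f b"
proof -
  obtain w where w: "prim5 w" "\<And>x. f (cval zeta x) = cval w x" using Iota_cval[OF assms(1)] by blast
  obtain x y where "a = cval zeta x" "b = cval zeta y" using assms(2,3) unfolding F5_eq by blast
  then show ?thesis using w(2)[of "x * y"] by (simp add: w cval_mul[OF w(1)] cval_mul[OF zeta_prim5])
qed

lemma Iota_01: assumes "Iota f" shows "f 0 = 0" "f 1 = 1"
proof -
  obtain w where w: "prim5 w" "\<And>x. f (cval zeta x) = cval w x" using Iota_cval[OF assms(1)] by blast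
  show "f 0 = 0" "f 1 = 1" using w(2)[of 0] w(2)[of 1] by simp_all
qed

lemma Iotas: "Iota iota1" "Iota iota2" by (auto simp: Iota_def)

lemma map_matrix_mult:
  assumes "Iota f" "g \<in> matrices_over F5" "h \<in> matrices_over F5"
  shows "map_matrix f (g ** h) = map_matrix f g ** map_matrix f h"
proof -
  have c: "g $ i $ k * h $ k $ j \<in> F5" for i j k using assms F5_closed by (auto simp: matrices_over_def)
  have m: "g $ i $ k \<in> F5" "h $ k $ j \<in> F5" for i j k using assms by (auto simp: matrices_over_def)
  show ?thesis
    by (simp add: vec_eq_iff matrix_matrix_mult_def map_matrix_def sum_2 Iota_add[OF assms(1) c c] Iota_mult[OF assms(1) m])
qed

lemma map_vector_mult:
  assumes "Iota f" "g \<in> matrices_over F5" "v \<in> vectors_over F5"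
  shows "map_vector f (g *v v) = map_matrix f g *v map_vector f v"
proof -
  have m: "g $ i $ k \<in> F5" "v $ k \<in> F5" for i k using assms by (auto simp: matrices_over_def vectors_over_def)
  have c: "g $ i $ k * v $ k \<in> F5" for i k using m F5_closed by blast
  show ?thesis
    by (simp add: vec_eq_iff matrix_vector_mult_def map_matrix_def map_vector_def sum_2 Iota_add[OF assms(1) c c] Iota_mult[OF assms(1) m])
qed

lemma outer_mult: "outer (B *v u) = B ** outer u ** ctranspose B"
  by (simp add: vec_eq_iff outer_def ctranspose_def matrix_matrix_mult_def matrix_vector_mult_def sum_2 algebra_simps)

lemma act_q: assumes "g \<in> matrices_over F5" "v \<in> vectors_over F5" shows "act g (q v) = q (g *v v)"
  by (simp add: act_def q_def map_vector_mult[OF _ assms] Iotas outer_mult)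

lemma ctranspose_mult: "ctranspose (A ** B) = ctranspose B ** ctranspose A"
  by (simp add: vec_eq_iff ctranspose_def matrix_matrix_mult_def sum_2 algebra_simps)

lemma act_act: assumes "g \<in> matrices_over F5" "h \<in> matrices_over F5" shows "act g (act h p) = act (g ** h) p"
  by (cases p) (simp add: act_def map_matrix_mult[OF _ assms] Iotas ctranspose_mult matrix_mul_assoc)

lemma act_id: "act (mat 1) p = p"
proof -
  have "map_matrix f (mat 1 :: cmat) = mat 1" if "Iota f" for f
    using Iota_01[OF that] by (simp add: vec_eq_iff map_matrix_def mat_def)
  moreover have "ctranspose (mat 1 :: cmat) = mat 1" by (simp add: vec_eq_iff ctranspose_def mat_def)
  ultimately show ?thesis by (cases p) (simp add: act_def Iotas)
qed

lemma linear_act: "linear (act g)"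
proof (rule linearI)
  fix a b :: "cmat \<times> cmat" and t :: real
  show "act g (a + b) = act g a + act g b"
    by (cases a; cases b) (simp add: act_def vec_eq_iff matrix_matrix_mult_def sum_2 algebra_simps)
  show "act g (t *\<^sub>R a) = t *\<^sub>R act g a"
    by (cases a) (simp add: act_def vec_eq_iff matrix_matrix_mult_def sum_2 algebra_simps)
qed

lemma GL2_O5_matrices: "g \<in> GL2_O5 \<Longrightarrow> g \<in> matrices_over O5" "g \<in> GL2_O5 \<Longrightarrow> g \<in> matrices_over F5"
  using O5_F5 by (auto simp: GL2_O5_def matrices_over_def)

lemma matrices_mult: "g \<in> matrices_over O5 \<Longrightarrow> h \<in> matrices_over O5 \<Longrightarrow> g ** h \<in> matrices_over O5"
  using O5_closed by (simp add: matrices_over_def matrix_matrix_mult_def sum_2)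

lemma GL2_O5_mult: assumes "g \<in> GL2_O5" "h \<in> GL2_O5" shows "g ** h \<in> GL2_O5"
proof -
  obtain g' h' where *: "g' \<in> matrices_over O5" "g ** g' = mat 1" "g' ** g = mat 1" "h' \<in> matrices_over O5" "h ** h' = mat 1" "h' ** h = mat 1"
    using assms by (auto simp: GL2_O5_def)
  have "(g ** h) ** (h' ** g') = g ** (h ** h') ** g'" "(h' ** g') ** (g ** h) = h' ** (g' ** g) ** h"
    by (simp_all add: matrix_mul_assoc)
  then have "(g ** h) ** (h' ** g') = mat 1" "(h' ** g') ** (g ** h) = mat 1" using * by simp_all
  then show ?thesis unfolding GL2_O5_def using matrices_mult * assms GL2_O5_matrices by blast
qed

lemma GL2_O5_inverse: assumes "g \<in> GL2_O5" shows "\<exists>h\<in>GL2_O5. g ** h = mat 1 \<and> h ** g = mat 1"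
  using assms by (auto simp: GL2_O5_def)

lemma GL2_O5_id: "mat 1 \<in> GL2_O5"
proof -
  have "(mat 1 :: cmat) \<in> matrices_over O5" using O5_01 by (simp add: matrices_over_def mat_def)
  then show ?thesis unfolding GL2_O5_def by (intro CollectI conjI bexI[of _ "mat 1"]) auto
qed

section \<open>Hermitian matrices of integral vectors and values of the form\<close>

definition hm :: "complex \<Rightarrow> int cyc \<times> int cyc \<times> int cyc \<Rightarrow> cmat" where
  "hm w c = (case c of (p, r, t) \<Rightarrow> (\<chi> i j. if i = 1 then (if j = 1 then ival w p else ival w r)
      else (if j = 1 then cnj (ival w r) else ival w t)))"

lemma map_vector_zc: assumes "\<And>x. f (cval zeta x) = cval w x"
  shows "map_vector f (zc v) $ 1 = ival w (fst v)" "map_vector f (zc v) $ 2 = ival w (snd v)"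
  by (simp_all add: map_vector_def zc_def assms)

lemma outer_hm: assumes w: "prim5 w" and f: "\<And>x. f (cval zeta x) = cval w x"
  shows "outer (map_vector f (zc v)) = hm w (herm_coords v)"
  by (cases v) (simp add: vec_eq_iff forall_2 outer_def map_vector_zc[where w = w, OF f] hm_def cint_mult cint_conj
      cval_mul[OF w] cval_conj[OF w])

lemma q_zc: "q (zc v) = (hm zeta (herm_coords v), hm (zeta ^ 3) (herm_coords v))"
  unfolding q_def outer_hm[OF zeta_prim5 iota1_cval] outer_hm[OF prim5_cube[OF zeta_prim5] iota2_cval] ..

lemma zm_zapply: "zm M *v zc v = zc (zapply M v)"
proof -
  obtain a b c d x y where "M = ((a, b), (c, d))" "v = (x, y)" by (metis surj_pair)
  then show ?thesis
    by (simp add: vec_eq_iff forall_2 matrix_vector_mult_def sum_2 zm_def zc_def cint_add cint_mult cval_add cval_mul[OF zeta_prim5])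
qed

lemma zm_F5: "zm M \<in> matrices_over F5" and zc_F5: "zc v \<in> vectors_over F5"
proof -
  have "zm M \<in> matrices_over O5" "zc v \<in> vectors_over O5" by (simp_all add: matrices_over_O5 vectors_over_O5)
  then show "zm M \<in> matrices_over F5" "zc v \<in> vectors_over F5"
    using O5_F5 by (auto simp: matrices_over_def vectors_over_def)
qed

lemma act_zm: "act (zm M) (q (zc v)) = q (zc (zapply M v))"
  by (simp add: act_q zm_F5 zc_F5 zm_zapply)

text \<open>The Hermitian matrix with diagonal entries \<open>alpha / 5\<close> and off-diagonal entry \<open>conj beta / 5\<close>
  makes \<open>O5\<^sup>2\<close>, with half its trace form, the root lattice \<open>E\<^sub>8\<close>.\<close>

definition alpha :: "int cyc" where "alpha = Cyc 2 0 (-1) (-1)"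
definition beta :: "int cyc" where "beta = Cyc 0 1 2 2"

definition form_at :: "complex \<Rightarrow> cmat \<Rightarrow> real" where
  "form_at w A = (Re (ival w alpha) * (Re (A $ 1 $ 1) + Re (A $ 2 $ 2)) + 2 * Re (ival w beta * A $ 1 $ 2)) / 5"

definition form :: "cmat \<times> cmat \<Rightarrow> real" where
  "form p = form_at zeta (fst p) + form_at (zeta ^ 3) (snd p)"

lemma form_at_linear:
  "form_at w (A + B) = form_at w A + form_at w B" "form_at w (t *\<^sub>R A) = t * form_at w A"
  unfolding form_at_def add_divide_distrib[symmetric] times_divide_eq_right
  by (rule arg_cong[of _ _ "\<lambda>y. y / 5"], simp add: algebra_simps)+

lemma linear_form: "linear form"
  by (rule linearI) (simp_all add: form_def form_at_linear algebra_simps)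

lemma real_cval: assumes "prim5 w" "cyc_conj x = x" shows "Im (cval w x) = 0"
  using cval_conj[OF assms(1), of x] assms(2) by (simp add: complex_eq_iff)

text \<open>The four conjugates form two complex conjugate pairs, represented by w and w^3, so the
  two real parts add up to half the trace.\<close>

lemma trace_cval: assumes w: "prim5 w" shows "Re (cval w x) + Re (cval (w ^ 3) x) = of_rat (cyc_trace x) / 2"
proof -
  have "cval w x + cval (w ^ 3) x + cnj (cval w x) + cnj (cval (w ^ 3) x) = of_rat (cyc_trace x)"
    using arg_cong[OF trace_eq[of x], of "cval w"]
    by (simp add: cval_add cval_gal[OF w] cval_conj[OF w] cval_conj[OF prim5_cube[OF w]])
  from arg_cong[OF this, of Re] show ?thesis
    by (cases "cyc_trace x") (simp add: of_rat_rat)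
qed

lemma form_hm:
  assumes "p = Cyc m 0 k k" "t = Cyc m' 0 k' k'"
  shows "form (hm zeta (p, r, t), hm (zeta ^ 3) (p, r, t)) = of_int (form_coords (p, r, t))"
proof -
  have real: "Re (ival w alpha) * Re (ival w (Cyc n 0 j j)) = Re (ival w (alpha * Cyc n 0 j j))" if "prim5 w" for w n j
  proof -
    have "Im (ival w alpha) = 0" by (rule real_cval[OF that]) (simp add: alpha_def)
    then show ?thesis by (simp add: cint_mult cval_mul[OF that])
  qed
  define T where "T z = Re (ival zeta z) + Re (ival (zeta ^ 3) z)" for z
  have T: "T z = of_rat (cyc_trace (cint z)) / 2" for z unfolding T_def by (rule trace_cval[OF zeta_prim5])
  have "5 * form (hm zeta (p, r, t), hm (zeta ^ 3) (p, r, t)) = T (alpha * p) + T (alpha * t) + 2 * T (beta * r)"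
    unfolding form_def form_at_def hm_def T_def assms
    by (simp add: distrib_left real[OF zeta_prim5] real[OF prim5_cube[OF zeta_prim5]] cint_mult[of beta]
        cval_mul[OF zeta_prim5] cval_mul[OF prim5_cube[OF zeta_prim5]] add_divide_distrib diff_divide_distrib del: cval.simps cyc.map)
  also have "\<dots> = of_int (5 * form_coords (p, r, t))"
    by (cases r) (simp add: T assms alpha_def beta_def Let_def of_rat_diff of_rat_add of_rat_mult of_rat_minus field_simps)
  finally show ?thesis by simp
qed

lemma mult_conj_form: "\<exists>m k. x * cyc_conj x = Cyc m 0 k (k :: 'a::comm_ring_1)"
proof -
  obtain a b c d where x: "x = Cyc a b c d" by (cases x)
  show ?thesis
    by (rule exI[of _ "a * a + b * b + c * c + d * d - (a * b + b * c + c * d)"],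
        rule exI[of _ "a * c + a * d + b * d - (a * b + b * c + c * d)"])
      (simp add: x Let_def algebra_simps)
qed

lemma form_q: "form (q (zc v)) = of_int (form_coords (herm_coords v))"
proof (cases v)
  case (Pair x y)
  obtain m k m' k' where "x * cyc_conj x = Cyc m 0 k k" "y * cyc_conj y = Cyc m' 0 k' k'"
    using mult_conj_form by metis
  then show ?thesis unfolding q_zc Pair herm_coords.simps by (rule form_hm)
qed

text \<open>Positive definiteness at each place: \<open>alpha\<close> is a root of X^2 - 5 X + 5,
  both roots of which exceed 1, and the squared modulus of \<open>beta\<close> is alpha^2 - alpha,
  so the determinant alpha^2 - |beta|^2 is \<open>alpha\<close> itself.\<close>

lemma alpha_beta: assumes w: "prim5 w"
  shows "cmod (ival w beta) < Re (ival w alpha)"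
proof -
  have im: "Im (ival w alpha) = 0" by (rule real_cval[OF w]) (simp add: alpha_def)
  define a where "a = Re (ival w alpha)"
  have a: "ival w alpha = of_real a" using im by (simp add: complex_eq_iff a_def)
  have "alpha * alpha = of_int 5 * alpha - of_int 5" by (simp add: alpha_def of_int_cyc Let_def)
  from arg_cong[OF this, of "ival w"] have "of_real (a * a) = (of_real (5 * a - 5) :: complex)"
    by (simp add: cint_mult cint_diff cint_of_int cval_mul[OF w] cval_diff cval_of_int a del: of_real_diff of_int_numeral) simp
  then have eq: "a * a = 5 * a - 5" by (simp only: of_real_eq_iff)
  have a1: "a > 1"
  proof (rule ccontr)
    assume "\<not> a > 1"
    \<comment> \<open>The product expands to a^2 - 5 a + 4, which is -1 by
      \<open>eq\<close>.\<close>
    then have "0 \<le> (1 - a) * (4 - a)" by (intro mult_nonneg_nonneg) auto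
    then show False using eq by (simp add: algebra_simps)
  qed
  have "beta * cyc_conj beta = alpha * alpha - alpha" by (simp add: alpha_def beta_def Let_def)
  from arg_cong[OF this, of "ival w"] have "ival w beta * cnj (ival w beta) = of_real (a * a - a)"
    by (simp add: cint_mult cint_diff cint_conj cval_mul[OF w] cval_diff cval_conj[OF w] a)
  then have "of_real ((cmod (ival w beta))\<^sup>2) = (of_real (a * a - a) :: complex)"
    by (simp only: complex_norm_square)
  then have "(cmod (ival w beta))\<^sup>2 = a * a - a" by (simp only: of_real_eq_iff)
  also have "\<dots> < a\<^sup>2" using a1 by (simp add: power2_eq_square)
  finally have "cmod (ival w beta) < a" by (rule power2_less_imp_less) (use a1 in simp)
  then show ?thesis by (simp only: a_def)
qed

lemma norm_vec2: "norm (v :: 'a::real_normed_vector ^ 2) \<le> norm (v $ 1) + norm (v $ 2)"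
  unfolding norm_vec_def by (rule order_trans[OF L2_set_le_sum]) (auto simp: sum_2)

text \<open>In terms of the moduli s and t of the entries of \<open>u\<close> the mixed term is at
  most 2 b s t, hence at most b (s^2 + t^2), while the norm of the matrix is at most 2 (s^2 + t^2).
  The 10 is this 2 times the 5 in \<open>form_at\<close>.\<close>

lemma form_outer:
  assumes w: "prim5 w"
  shows "(Re (ival w alpha) - cmod (ival w beta)) / 10 * norm (outer u) \<le> form_at w (outer u)"
proof -
  define a b where "a = Re (ival w alpha)" and "b = cmod (ival w beta)"
  define s t where "s = cmod (u $ 1)" and "t = cmod (u $ 2)"
  have st: "0 \<le> s" "0 \<le> t" by (simp_all add: s_def t_def)
  have ab: "b < a" "0 \<le> b" using alpha_beta[OF w] by (simp_all add: a_def b_def)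
  have "norm (outer u) \<le> norm (outer u $ 1) + norm (outer u $ 2)" by (rule norm_vec2)
  also have "\<dots> \<le> (norm (outer u $ 1 $ 1) + norm (outer u $ 1 $ 2)) + (norm (outer u $ 2 $ 1) + norm (outer u $ 2 $ 2))"
    by (intro add_mono norm_vec2)
  also have "\<dots> = (s + t)\<^sup>2" unfolding outer_def vec_lambda_beta real_normed_div_algebra_class.norm_mult complex_mod_cnj s_def t_def
    by (simp add: power2_eq_square algebra_simps)
  also have "\<dots> \<le> 2 * (s\<^sup>2 + t\<^sup>2)" using sum_squares_bound[of s t] by (simp add: power2_eq_square algebra_simps)
  finally have n: "norm (outer u) \<le> 2 * (s\<^sup>2 + t\<^sup>2)" .
  have "(a - b) / 10 * norm (outer u) \<le> (a - b) / 10 * (2 * (s\<^sup>2 + t\<^sup>2))"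
    using ab n by (intro mult_left_mono) auto
  also have "\<dots> = (a * (s\<^sup>2 + t\<^sup>2) - b * (s\<^sup>2 + t\<^sup>2)) / 5" by (simp add: field_simps)
  also have "\<dots> \<le> (a * (s\<^sup>2 + t\<^sup>2) - b * (2 * (s * t))) / 5"
    using ab(2) sum_squares_bound[of s t] by (intro divide_right_mono diff_left_mono mult_left_mono) (auto simp: mult_ac)
  also have "\<dots> \<le> form_at w (outer u)"
  proof -
    have "\<bar>Re (ival w beta * outer u $ 1 $ 2)\<bar> \<le> cmod (ival w beta * outer u $ 1 $ 2)" by (rule abs_Re_le_cmod)
    also have "\<dots> = b * (s * t)" unfolding outer_def vec_lambda_beta real_normed_div_algebra_class.norm_mult complex_mod_cnj s_def t_def b_def ..
    finally have r: "- (b * (s * t)) \<le> Re (ival w beta * outer u $ 1 $ 2)" by linarith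
    have d: "Re (outer u $ 1 $ 1) = s\<^sup>2" "Re (outer u $ 2 $ 2) = t\<^sup>2"
      unfolding outer_def vec_lambda_beta s_def t_def cmod_power2 by (simp_all add: power2_eq_square)
    have "a * (s\<^sup>2 + t\<^sup>2) - b * (2 * (s * t)) \<le> a * (s\<^sup>2 + t\<^sup>2) + 2 * Re (ival w beta * outer u $ 1 $ 2)" using r by linarith
    then show ?thesis unfolding form_at_def d a_def[symmetric] by (intro divide_right_mono) auto
  qed
  finally show ?thesis by (simp add: a_def b_def)
qed

section \<open>The group action on the lattice points\<close>

definition Vs :: "(cmat \<times> cmat) set" where "Vs = (C1 \<inter> \<Lambda>) - {0}"
definition GG :: "(cmat \<times> cmat \<Rightarrow> cmat \<times> cmat) set" where "GG = act ` GL2_O5"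
definition pnt :: "nat \<Rightarrow> cmat \<times> cmat" where "pnt i = q (zc (vtab ! i))"

lemma q_O5_Lambda: "v \<in> vectors_over O5 \<Longrightarrow> q v \<in> \<Lambda>"
  unfolding \<Lambda>_def by (rule group_closure.base) auto

lemma Lambda_add: "a \<in> \<Lambda> \<Longrightarrow> b \<in> \<Lambda> \<Longrightarrow> a + b \<in> \<Lambda>"
  unfolding \<Lambda>_def by (rule group_closure_add)

lemma Lambda_scale: "a \<in> \<Lambda> \<Longrightarrow> real n *\<^sub>R a \<in> \<Lambda>"
proof (induction n)
  case 0 show ?case by (simp add: \<Lambda>_def)
next
  case (Suc n) then show ?case by (simp add: scaleR_add_left Lambda_add)
qed

lemma Lambda_induct [consumes 1, case_names zero q diff]:
  assumes "p \<in> \<Lambda>" "P 0" "\<And>v. P (q (zc v))" "\<And>a b. P a \<Longrightarrow> P b \<Longrightarrow> P (a - b)"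
  shows "P p"
  using assms(1) unfolding \<Lambda>_def
proof (induction p rule: group_closure.induct)
  case (base s) then show ?case using assms(2,3) vectors_over_O5 by auto
next
  case (diff s t) then show ?case using assms(4) by blast
qed

lemma form_Lambda: "p \<in> \<Lambda> \<Longrightarrow> form p \<in> \<int>"
  by (induction rule: Lambda_induct) (auto simp: form_q linear_diff[OF linear_form] linear_0[OF linear_form])

lemma GL2_zm: assumes "g \<in> GL2_O5" obtains M where "g = zm M"
  using GL2_O5_matrices(1)[OF assms] matrices_over_O5 by auto

lemma act_Lambda: assumes "g \<in> GL2_O5" "p \<in> \<Lambda>" shows "act g p \<in> \<Lambda>"
proof -
  obtain M where M: "g = zm M" using GL2_zm[OF assms(1)] .
  show ?thesis using assms(2)
  proof (induction rule: Lambda_induct)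
    case zero show ?case by (simp add: linear_0[OF linear_act] \<Lambda>_def)
  next
    case (q v) show ?case unfolding M act_zm by (rule q_O5_Lambda) (simp add: vectors_over_O5)
  next
    case (diff a b) then show ?case unfolding linear_diff[OF linear_act] \<Lambda>_def by (rule group_closure.diff)
  qed
qed

lemma act_inverse: assumes "g \<in> GL2_O5" shows "\<exists>h\<in>GL2_O5. (\<forall>p. act g (act h p) = p) \<and> (\<forall>p. act h (act g p) = p)"
proof -
  obtain h where h: "h \<in> GL2_O5" "g ** h = mat 1" "h ** g = mat 1" using GL2_O5_inverse[OF assms] by blast
  then show ?thesis using act_act assms GL2_O5_matrices(2) act_id by metis
qed

lemma act_C1: assumes "g \<in> GL2_O5" "p \<in> C1" shows "act g p \<in> C1"
proof -
  obtain t v where p: "p = t *\<^sub>R q v" "t > 0" "v \<in> vectors_over F5" "v \<noteq> 0" using assms(2) by (auto simp: C1_def)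
  have gF: "g \<in> matrices_over F5" using GL2_O5_matrices assms(1) by blast
  obtain h where "h ** g = mat 1" using GL2_O5_inverse[OF assms(1)] by blast
  then have "g *v v \<noteq> 0" using p(4) by (metis matrix_vector_mul_assoc matrix_vector_mul_lid matrix_vector_mult_0_right)
  moreover have "g *v v \<in> vectors_over F5"
    using gF p(3) F5_closed by (simp add: vectors_over_def matrices_over_def matrix_vector_mult_def sum_2)
  moreover have "act g p = t *\<^sub>R q (g *v v)" unfolding p(1) linear_scale[OF linear_act] act_q[OF gF p(3)] ..
  ultimately show ?thesis using p(2) unfolding C1_def by blast
qed

lemma act_Vs: assumes "g \<in> GL2_O5" "p \<in> Vs" shows "act g p \<in> Vs"
proof -
  obtain h where "\<forall>p. act h (act g p) = p" using act_inverse[OF assms(1)] by blast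
  then have "act g p \<noteq> 0" using assms(2) linear_0[OF linear_act] by (metis DiffE Vs_def singletonI)
  then show ?thesis using assms act_C1 act_Lambda by (auto simp: Vs_def)
qed

definition cbound :: real where
  "cbound = min ((Re (ival zeta alpha) - cmod (ival zeta beta)) / 10) ((Re (ival (zeta ^ 3) alpha) - cmod (ival (zeta ^ 3) beta)) / 10)"

lemma cbound_pos: "cbound > 0"
  using alpha_beta[OF zeta_prim5] alpha_beta[OF prim5_cube[OF zeta_prim5]] by (simp add: cbound_def)

lemma form_C1: assumes "p \<in> C1" shows "cbound * norm p \<le> form p"
proof -
  obtain t v where p: "p = t *\<^sub>R q v" "t > 0" using assms by (auto simp: C1_def)
  let ?A = "outer (map_vector iota1 v)" and ?B = "outer (map_vector iota2 v)"
  have "norm (q v) \<le> norm ?A + norm ?B" unfolding q_def by (rule norm_Pair_le)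
  then have "cbound * norm (q v) \<le> cbound * norm ?A + cbound * norm ?B"
    using mult_left_mono[of "norm (q v)" "norm ?A + norm ?B" cbound] cbound_pos by (simp add: distrib_left)
  also have "\<dots> \<le> (Re (ival zeta alpha) - cmod (ival zeta beta)) / 10 * norm ?A
      + (Re (ival (zeta ^ 3) alpha) - cmod (ival (zeta ^ 3) beta)) / 10 * norm ?B"
    unfolding cbound_def by (intro add_mono mult_right_mono min.cobounded1 min.cobounded2 norm_ge_zero)
  also have "\<dots> \<le> form_at zeta ?A + form_at (zeta ^ 3) ?B"
    by (intro add_mono form_outer zeta_prim5 prim5_cube)
  also have "\<dots> = form (q v)" by (simp add: form_def q_def)
  finally have "t * (cbound * norm (q v)) \<le> t * form (q v)" using p(2) by (intro mult_left_mono) auto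
  then show ?thesis unfolding p(1) linear_scale[OF linear_form] using p(2) by (simp add: mult_ac)
qed

lemma zm_GL2: assumes "cyc_norm (zdet M) = 1" shows "zm M \<in> GL2_O5"
proof -
  obtain a b c d where M: "M = ((a, b), (c, d))" by (metis surj_pair)
  \<comment> \<open>The product of the other three conjugates of the determinant, which is its
    inverse because the norm is 1.\<close>
  define u where "u = cyc_conj (zdet M) * cyc_gal (zdet M * cyc_conj (zdet M))"
  have u: "(a * d - b * c) * u = 1" using assms by (simp add: u_def M zdet_def cyc_norm_def mult.assoc)
  let ?h = "zm ((d * u, - (b * u)), (- (c * u), a * u))"
  have iu: "ival zeta (x * y) = ival zeta x * ival zeta y" "ival zeta (- x) = - ival zeta x" for x y
    by (simp_all add: cint_mult cint_uminus cval_mul[OF zeta_prim5] cval_neg)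
  have "ival zeta ((a * d - b * c) * u) = 1" unfolding u using cval_of_int[of zeta 1] cint_of_int[of 1] by simp
  then have e: "(ival zeta a * ival zeta d - ival zeta b * ival zeta c) * ival zeta u = 1"
    unfolding iu by (simp add: cint_diff cval_diff iu)
  have "zm M ** ?h = mat 1" "?h ** zm M = mat 1"
    using e by (simp_all add: vec_eq_iff forall_2 matrix_matrix_mult_def sum_2 zm_def zc_def M iu mat_def algebra_simps)
  then show ?thesis unfolding GL2_O5_def matrices_over_O5 by blast
qed

section \<open>From the tables to facet functionals\<close>

lemma vtab_length: "length vtab = 24" by (simp add: vtab_def)

lemma pows_nth: "i < 24 \<Longrightarrow> pows ! i = 2 ^ i" by (simp add: pows_eq)

lemma length_pows: "length pows = 24" by (simp add: pows_eq)

definition gact :: "nat \<Rightarrow> cmat \<times> cmat \<Rightarrow> cmat \<times> cmat" where "gact k = act (zm (fst (gens ! k)))"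

lemma gact_GG: assumes "k < length gens" shows "gact k \<in> GG"
proof -
  obtain M ms where g: "gens ! k = (M, ms)" by (metis surj_pair)
  then have "cyc_norm (zdet (fst (gens ! k))) = 1" using gens_det assms unfolding list_all_length by fastforce
  then show ?thesis unfolding gact_def GG_def using zm_GL2 by blast
qed

lemma herm_coords_q: "herm_coords v = herm_coords w \<Longrightarrow> q (zc v) = q (zc w)"
  by (simp add: q_zc)

lemma gens_nth:
  assumes "k < length gens" shows "length (snd (gens ! k)) = 24"
    "i < 24 \<Longrightarrow> snd (gens ! k) ! i \<noteq> 0 \<Longrightarrow> \<exists>j<24. snd (gens ! k) ! i = 2 ^ j \<and> gact k (pnt i) = pnt j"
proof -
  obtain M ms where g: "gens ! k = (M, ms)" by (metis surj_pair)
  have "gen_ok (M, ms)" using gens_ok assms g by (metis list_all_length)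
  then have len: "length ms = 24" and ok: "list_all (\<lambda>(v, m). m = 0 \<or> list_ex (\<lambda>(p, w). p = m \<and> herm_coords (zapply M v) = herm_coords w) (zip pows vtab)) (zip vtab ms)"
    by (simp_all add: gen_ok_def)
  show "length (snd (gens ! k)) = 24" using g len by simp
  assume i: "i < 24" "snd (gens ! k) ! i \<noteq> 0"
  have "list_ex (\<lambda>(p, w). p = ms ! i \<and> herm_coords (zapply M (vtab ! i)) = herm_coords w) (zip pows vtab)"
    using ok i g len unfolding list_all_length by (auto simp: vtab_length)
  then obtain j where j: "j < 24" "pows ! j = ms ! i" "herm_coords (zapply M (vtab ! i)) = herm_coords (vtab ! j)"
    unfolding list_ex_length by (auto simp: vtab_length length_pows)
  have "gact k (pnt i) = pnt j"
    unfolding gact_def pnt_def g fst_conv act_zm using herm_coords_q[OF j(3)] .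
  then show "\<exists>j<24. snd (gens ! k) ! i = 2 ^ j \<and> gact k (pnt i) = pnt j"
    using j g pows_nth by auto
qed

lemma stab_eq: "k < length gens \<Longrightarrow> stab k = snd (gens ! k)"
  by (simp add: stab_def gen_maps_def)

lemma orbit_induct_aux:
  assumes "orbit_ok (stab 0) (stab 1) bases acc es" "\<And>Y. Y \<in> set acc \<Longrightarrow> P Y" "\<And>Z. Z \<in> set bases \<Longrightarrow> P Z"
    "\<And>Y k. P Y \<Longrightarrow> k < 2 \<Longrightarrow> P (img (stab k) Y)"
  shows "\<forall>Z\<in>fst ` set es. P Z"
  using assms(1,2)
proof (induction es arbitrary: acc)
  case (Cons e es)
  obtain Z k Y where e: "e = (Z, k, Y)" by (metis prod_cases3)
  have "P Z"
  proof (cases "k = 2")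
    case True then show ?thesis using Cons.prems(1) assms(3) by (simp add: e)
  next
    case False
    then have "k < 2" "Y \<in> set acc" "Z = img (stab k) Y" using Cons.prems(1) by (auto simp: e split: if_splits)
    then show ?thesis using Cons.prems(2) assms(4) by blast
  qed
  moreover have "\<forall>Z\<in>fst ` set es. P Z"
    by (rule Cons.IH[of "Z # acc"]) (use Cons.prems \<open>P Z\<close> in \<open>auto simp: e\<close>)
  ultimately show ?case by (simp add: e)
qed simp

text \<open>Every entry of \<open>orbit\<close> is a base facet or arises from an earlier entry, so
  a property of the nine base facets that survives the two symmetries holds for all facets.\<close>

lemma facets_induct [consumes 1, case_names base step]:
  assumes "Z \<in> set facets" "\<And>Z. Z \<in> set bases \<Longrightarrow> P Z" "\<And>Y k. P Y \<Longrightarrow> k < 2 \<Longrightarrow> P (img (stab k) Y)"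
  shows "P Z"
  using orbit_induct_aux[OF orbit_ok, of P] assms by (auto simp: facets_def)

text \<open>Evaluation has checked that each of the 24 vertices occurs among the 24 images; a
  surjection of a finite set onto itself is a permutation.\<close>

lemma stab_perm:
  assumes "k < 2"
  obtains \<sigma> where "bij_betw \<sigma> {..<24::nat} {..<24}" "\<And>i. i < 24 \<Longrightarrow> gact k (pnt i) = pnt (\<sigma> i)"
    "\<And>Y. bits (img (stab k) Y) = \<sigma> ` bits Y"
proof -
  have k: "k < length gens" using assms length_gens by simp
  note g = gens_nth[OF k]
  have m: "List.member (stab k) p" if "p \<in> set pows" for p
  proof -
    have "k = 0 \<or> k = 1" using assms by linarith
    then show ?thesis using perm_ok that by (auto simp: list_all_iff)
  qed
  have ex: "\<exists>i<24. stab k ! i = 2 ^ j" if "j < 24" for j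
  proof -
    have "2 ^ j \<in> set pows" using that unfolding pows_eq by auto
    then have "2 ^ j \<in> set (stab k)" using m by simp
    then show ?thesis using g(1) stab_eq[OF k] by (metis in_set_conv_nth)
  qed
  define \<tau> where "\<tau> j = (SOME i. i < 24 \<and> stab k ! i = 2 ^ j)" for j
  have \<tau>: "\<tau> j < 24 \<and> stab k ! (\<tau> j) = 2 ^ j" if "j < 24" for j
    unfolding \<tau>_def using someI_ex[of "\<lambda>i. i < 24 \<and> stab k ! i = 2 ^ j"] ex[OF that] by blast
  have inj: "inj_on \<tau> {..<24}"
  proof (rule inj_onI)
    fix a b assume ab: "a \<in> {..<24}" "b \<in> {..<24}" "\<tau> a = \<tau> b"
    have t: "stab k ! \<tau> a = 2 ^ a" "stab k ! \<tau> b = 2 ^ b" using \<tau> ab(1,2) by blast+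
    have "(2::int) ^ a = 2 ^ b" unfolding t[symmetric] ab(3) ..
    then show "a = b" by (rule power_inject_exp[THEN iffD1, rotated]) simp
  qed
  have "\<tau> ` {..<24} \<subseteq> {..<24}" using \<tau> by auto
  then have sur: "\<tau> ` {..<24} = {..<24}" using endo_inj_surj[OF _ _ inj] by simp
  have nz: "stab k ! i \<noteq> 0" if i: "i < 24" for i
  proof -
    have "i \<in> \<tau> ` {..<24}" unfolding sur using i by simp
    then obtain j where "j < 24" "i = \<tau> j" by blast
    then have "stab k ! i = 2 ^ j" using \<tau> by blast
    then show ?thesis by simp
  qed
  have "\<forall>i\<in>{..<24}. \<exists>j. j < 24 \<and> stab k ! i = 2 ^ j \<and> gact k (pnt i) = pnt j"
    using g(2) nz unfolding stab_eq[OF k] by blast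
  from bchoice[OF this] obtain \<sigma> where \<sigma>: "\<And>i. i < 24 \<Longrightarrow> \<sigma> i < 24 \<and> stab k ! i = 2 ^ \<sigma> i \<and> gact k (pnt i) = pnt (\<sigma> i)"
    by blast
  have "{..<24} \<subseteq> \<sigma> ` {..<24}"
  proof
    fix j :: nat assume "j \<in> {..<24}"
    then have t: "\<tau> j < 24" "stab k ! \<tau> j = 2 ^ j" using \<tau> by blast+
    have "(2::int) ^ \<sigma> (\<tau> j) = 2 ^ j" using \<sigma>[OF t(1)] t(2) by metis
    then have "\<sigma> (\<tau> j) = j" by (rule power_inject_exp[THEN iffD1, rotated]) simp
    then show "j \<in> \<sigma> ` {..<24}" using t(1) by (metis imageI lessThan_iff)
  qed
  moreover have "\<sigma> ` {..<24} \<subseteq> {..<24}" using \<sigma> by auto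
  ultimately have "bij_betw \<sigma> {..<24} {..<24}"
    unfolding bij_betw_def using finite_surj_inj[of "{..<24}" \<sigma>] by auto
  moreover have "bits (img (stab k) Y) = \<sigma> ` bits Y" for Y
  proof -
    have "bit (img (stab k) Y) j \<longleftrightarrow> (\<exists>i<24. bit Y i \<and> j = \<sigma> i)" for j
      unfolding bit_img using g(1) \<sigma> by (auto simp: stab_eq[OF k] bit_exp_iff)
    then show ?thesis using \<sigma> unfolding bits_def by auto
  qed
  ultimately show ?thesis using that \<sigma> by blast
qed

definition pattern :: "(cmat \<times> cmat \<Rightarrow> cmat \<times> cmat) \<Rightarrow> int \<Rightarrow> bool" where
  "pattern g Z \<longleftrightarrow> (\<forall>i<24. if bit Z i then form (g (pnt i)) = 1 else 1 < form (g (pnt i)))"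

lemma GG_comp: assumes "g \<in> GG" "h \<in> GG" shows "g \<circ> h \<in> GG"
proof -
  obtain a b where ab: "g = act a" "h = act b" "a \<in> GL2_O5" "b \<in> GL2_O5" using assms by (auto simp: GG_def)
  have "g \<circ> h = act (a ** b)" unfolding ab(1,2) by (rule ext) (simp add: act_act GL2_O5_matrices(2) ab)
  then show ?thesis using GL2_O5_mult ab unfolding GG_def by blast
qed

lemma GG_inverse: "g \<in> GG \<Longrightarrow> \<exists>h\<in>GG. (\<forall>x. g (h x) = x) \<and> (\<forall>x. h (g x) = x)"
  using act_inverse unfolding GG_def by blast

lemma GG_linear: "g \<in> GG \<Longrightarrow> linear g" using linear_act by (auto simp: GG_def)

text \<open>For the image of \<open>Y\<close> under a symmetry the group element of \<open>Y\<close>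
  is preceded by the inverse symmetry; its values at the permuted vertices are the old ones.\<close>

lemma facet_functional: assumes "Z \<in> set facets" shows "\<exists>g\<in>GG. pattern g Z"
  using assms
proof (induction rule: facets_induct)
  case (base Z)
  then obtain n where n: "n < length bases" "Z = bases ! n" by (metis in_set_conv_nth)
  have nl: "n + 2 < length gens" using n(1) bases_ok by (auto simp: list_all2_lengthD dest!: list_all2_lengthD)
  have "base_ok (gens ! (n + 2)) Z" using bases_ok n nl by (auto simp: list_all2_conv_all_nth add.commute)
  then have "form_coords (herm_coords (zapply (fst (gens ! (n + 2))) (vtab ! i))) = 1 \<and> bit Z i \<or>
      1 < form_coords (herm_coords (zapply (fst (gens ! (n + 2))) (vtab ! i))) \<and> \<not> bit Z i" if "i < 24" for i
    using that unfolding base_ok_def list_all_length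
    by (auto simp: length_pows vtab_length pows_nth and_pow_0 split: prod.splits if_splits)
  then have "pattern (gact (n + 2)) Z"
    unfolding pattern_def gact_def pnt_def act_zm form_q by fastforce
  then show ?case using gact_GG[OF nl] by blast
next
  case (step Y k)
  then obtain g where g: "g \<in> GG" "pattern g Y" by blast
  obtain \<sigma> where \<sigma>: "bij_betw \<sigma> {..<24::nat} {..<24}" "\<And>i. i < 24 \<Longrightarrow> gact k (pnt i) = pnt (\<sigma> i)"
    "\<And>Y. bits (img (stab k) Y) = \<sigma> ` bits Y" using stab_perm[OF step(2)] by blast
  have "gact k \<in> GG" using gact_GG length_gens step(2) by simp
  then obtain h where h: "h \<in> GG" "\<And>x. h (gact k x) = x" using GG_inverse by blast
  have "pattern (g \<circ> h) (img (stab k) Y)"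
    unfolding pattern_def
  proof (intro allI impI)
    fix j :: nat assume j: "j < 24"
    then obtain i where i: "i < 24" "j = \<sigma> i" using \<sigma>(1) by (metis bij_betw_imp_surj_on imageE lessThan_iff)
    have "(g \<circ> h) (pnt j) = g (pnt i)" using \<sigma>(2)[OF i(1)] h(2) i(2) by (metis comp_apply)
    moreover have "bit (img (stab k) Y) j \<longleftrightarrow> bit Y i"
    proof -
      have "j \<in> bits (img (stab k) Y) \<longleftrightarrow> i \<in> bits Y"
        unfolding \<sigma>(3) i(2) using \<sigma>(1) i(1) by (auto simp: bij_betw_def bits_def inj_on_def)
      then show ?thesis using i(1) j by (simp add: bits_def)
    qed
    ultimately show "if bit (img (stab k) Y) j then form ((g \<circ> h) (pnt j)) = 1 else 1 < form ((g \<circ> h) (pnt j))"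
      using g(2) i(1) by (auto simp: pattern_def)
  qed
  then show ?case using GG_comp[OF g(1) h(1)] by blast
qed

definition hh :: "int \<Rightarrow> cmat \<times> cmat \<Rightarrow> cmat \<times> cmat" where "hh Z = (SOME g. g \<in> GG \<and> pattern g Z)"

lemma hh: assumes "Z \<in> set facets" shows "hh Z \<in> GG" "pattern (hh Z) Z"
  using someI_ex[of "\<lambda>g. g \<in> GG \<and> pattern g Z"] facet_functional[OF assms] unfolding hh_def by blast+

definition ll :: "int \<Rightarrow> cmat \<times> cmat \<Rightarrow> real" where "ll Z p = form (hh Z p) - form p"

lemma form_pnt: "i < 24 \<Longrightarrow> form (pnt i) = 1"
  using vtab_form by (simp add: pnt_def form_q list_all_length vtab_length)

lemma linear_ll: assumes "Z \<in> set facets" shows "linear (ll Z)"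
  unfolding ll_def
  using linear_compose_sub[OF linear_compose[OF GG_linear[OF hh(1)[OF assms]] linear_form] linear_form] by (simp add: o_def)

section \<open>Real coordinates and the configuration of vertices\<close>

definition herm2 :: "real \<times> complex \<times> real \<Rightarrow> cmat" where
  "herm2 c = (case c of (a, z, d) \<Rightarrow> (\<chi> i j. if i = 1 then (if j = 1 then of_real a else z) else (if j = 1 then cnj z else of_real d)))"

text \<open>The eight real parameters of a pair of Hermitian matrices. The ambient type has real
  dimension 16, so the bound 8 for the vertices has to come from this parametrisation.\<close>

definition hpair :: "(real \<times> complex \<times> real) \<times> (real \<times> complex \<times> real) \<Rightarrow> cmat \<times> cmat" where
  "hpair c = (herm2 (fst c), herm2 (snd c))"

lemma linear_hpair: "linear hpair"
  by (rule linearI) (auto simp: hpair_def herm2_def vec_eq_iff complex_eq_iff)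

lemma dim_hpair: "dim (range hpair) \<le> 8"
proof -
  have "dim (range hpair) \<le> dim (UNIV :: ((real \<times> complex \<times> real) \<times> (real \<times> complex \<times> real)) set)"
    by (rule dim_image_le[OF linear_hpair])
  then show ?thesis by (simp add: dim_UNIV)
qed

lemma subspace_hpair: "subspace (range hpair)"
  by (rule linear_subspace_image[OF linear_hpair]) simp

lemma q_hpair: "q v \<in> range hpair"
proof -
  have "outer u \<in> range herm2" for u
    by (rule range_eqI[of _ _ "((cmod (u $ 1))\<^sup>2, u $ 1 * cnj (u $ 2), (cmod (u $ 2))\<^sup>2)"])
      (auto simp: outer_def herm2_def vec_eq_iff forall_2 complex_norm_square simp flip: complex_norm_square of_real_power)
  then have "outer (map_vector iota1 v) \<in> range herm2" "outer (map_vector iota2 v) \<in> range herm2" by blast+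
  then obtain a b where "outer (map_vector iota1 v) = herm2 a" "outer (map_vector iota2 v) = herm2 b" by blast
  then have "q v = hpair (a, b)" by (simp add: q_def hpair_def)
  then show ?thesis by blast
qed

lemma Vs_hpair: "Vs \<subseteq> range hpair"
proof
  fix p assume "p \<in> Vs"
  then obtain t v where "p = t *\<^sub>R q v" by (auto simp: Vs_def C1_def)
  then show "p \<in> range hpair" using subspace_scale[OF subspace_hpair q_hpair] by simp
qed

lemma ll_pnt: assumes "Z \<in> set facets" "i < 24"
  shows "bit Z i \<Longrightarrow> ll Z (pnt i) = 0" "\<not> bit Z i \<Longrightarrow> 0 < ll Z (pnt i)"
  using hh(2)[OF assms(1)] assms(2) form_pnt by (auto simp: ll_def pattern_def)

lemma pnt_nz: "i < 24 \<Longrightarrow> pnt i \<noteq> 0"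
  using form_pnt linear_0[OF linear_form] by force

lemma pnt_hpair: "pnt i \<in> range hpair"
  unfolding pnt_def by (rule q_hpair)

lemma dim_pnt: "dim (pnt ` {..<24}) \<le> 8"
proof -
  have "dim (pnt ` {..<24}) \<le> dim (range hpair)" by (rule dim_subset) (use pnt_hpair in auto)
  then show ?thesis using dim_hpair by linarith
qed

interpretation cfg: config pnt "set facets" ll
  by (rule config.intro) (assumption | rule linear_ll ll_pnt pnt_nz dim_pnt)+

section \<open>From the base facets to the cone over the perfect facet\<close>

lemma nodes_sound: "nd \<in> set nodes \<Longrightarrow> cfg.node_sound nd"
  using cfg.nodes_sound[OF nodes_ok] nodes_in
  unfolding nodes_in_def list_all_iff cfg.node_facets_def cfg.subl_iff by fastforce

lemma stab_facets: "Y \<in> set facets \<Longrightarrow> k < 2 \<Longrightarrow> img (stab k) Y \<in> set facets"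
proof -
  assume Y: "Y \<in> set facets" and "k < 2"
  then have "k = 0 \<or> k = 1" by linarith
  then show ?thesis using facets_closed Y by (auto simp: closed_under_def list_all_iff)
qed

lemma stab_pts: assumes "k < 2" shows "cfg.pts (img (stab k) Y) = gact k ` cfg.pts Y"
proof -
  obtain \<sigma> where \<sigma>: "\<And>i. i < 24 \<Longrightarrow> gact k (pnt i) = pnt (\<sigma> i)"
    "\<And>Y. bits (img (stab k) Y) = \<sigma> ` bits Y" using stab_perm[OF assms] by metis
  have "gact k (pnt i) = pnt (\<sigma> i)" if "i \<in> bits Y" for i using \<sigma>(1)[of i] that by (simp add: bits_def)
  then show ?thesis unfolding cfg.pts_def \<sigma>(2) image_image by (intro image_cong) auto
qed

lemma gact_linear: "linear (gact k)" unfolding gact_def by (rule linear_act)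

lemma gact_inj: assumes "k < length gens" shows "inj (gact k)"
  using GG_inverse[OF gact_GG[OF assms]] by (metis injI)

lemma facets_dim: assumes "Z \<in> set facets" shows "8 \<le> dim (cfg.pts Z) + 1"
  using assms
proof (induction rule: facets_induct)
  case (base Z)
  then have "child_ok nodes 8 facets Z" using bases_children by (auto simp: list_all_iff)
  then show ?case using cfg.child_ok_sound[OF _ subset_refl nodes_sound] by blast
next
  case (step Y k)
  have "dim (gact k ` cfg.pts Y) = dim (cfg.pts Y)"
    by (rule dim_image_eq[OF gact_linear inj_on_subset[OF gact_inj subset_UNIV]]) (use length_gens step(2) in simp)
  then show ?case using step stab_pts by simp
qed

lemma facets_ex: "Z \<in> set facets \<Longrightarrow> \<exists>i<24. \<not> bit Z i"
  using facets_proper unfolding list_all_iff list_ex_iff by (fastforce simp: pows_eq and_pow_0)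

lemma pts_full: "cfg.pts full = pnt ` {..<24}"
  by (simp add: cfg.pts_def bits_full)

text \<open>The nodes treat only the base facets. A symmetry permutes the facets and, up to positive
  factors, their functionals, so a point over an image facet can be pulled back together with all
  its inequalities.\<close>

lemma facets_Gp: assumes "Z \<in> set facets" shows "cfg.Gp Z (set facets)"
  using assms
proof (induction rule: facets_induct)
  case (base Z)
  then have "child_ok nodes 8 facets Z" using bases_children by (auto simp: list_all_iff)
  then show ?case using cfg.child_ok_sound[OF _ subset_refl nodes_sound] by blast
next
  case (step Y k)
  have k: "k < length gens" using step(2) length_gens by simp
  show ?case unfolding cfg.Gp_def
  proof (intro ballI impI)
    fix p assume "p \<in> span (cfg.pts (img (stab k) Y))" and pos: "\<forall>Z\<in>set facets. 0 \<le> ll Z p"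
    then obtain p' where p': "p = gact k p'" "p' \<in> span (cfg.pts Y)"
      unfolding stab_pts[OF step(2)] linear_span_image[OF gact_linear] by blast
    have "0 \<le> ll Z p'" if Z: "Z \<in> set facets" for Z
    proof -
      let ?Z = "img (stab k) Z"
      have Z': "?Z \<in> set facets" using stab_facets[OF Z step(2)] .
      obtain \<sigma> where \<sigma>: "bij_betw \<sigma> {..<24::nat} {..<24}" "\<And>i. i < 24 \<Longrightarrow> gact k (pnt i) = pnt (\<sigma> i)"
        "\<And>Y. bits (img (stab k) Y) = \<sigma> ` bits Y" using stab_perm[OF step(2)] by metis
      obtain i where i: "i < 24" "\<not> bit Z i" using facets_ex[OF Z] by blast
      have \<sigma>i: "\<sigma> i < 24" "\<not> bit ?Z (\<sigma> i)"
      proof -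
        show "\<sigma> i < 24" using \<sigma>(1) i(1) by (auto simp: bij_betw_def)
        have "\<sigma> i \<notin> bits ?Z" unfolding \<sigma>(3) using \<sigma>(1) i by (auto simp: bij_betw_def bits_def inj_on_def)
        then show "\<not> bit ?Z (\<sigma> i)" using \<open>\<sigma> i < 24\<close> by (simp add: bits_def)
      qed
      show ?thesis
      proof (rule cfg.proportional[of "\<lambda>p. ll ?Z (gact k p)" "ll Z" "cfg.pts Z" "pnt i" "cfg.pts full" p'])
        show "linear (\<lambda>p. ll ?Z (gact k p))"
          using linear_compose[OF gact_linear linear_ll[OF Z']] by (simp add: o_def)
        show "linear (ll Z)" by (rule linear_ll[OF Z])
        show "ll ?Z (gact k y) = 0" if "y \<in> cfg.pts Z" for y
          using cfg.l_pts[OF Z', of "gact k y"] that stab_pts[OF step(2)] by blast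
        show "ll Z y = 0" if "y \<in> cfg.pts Z" for y using cfg.l_pts[OF Z that] .
        show "0 < ll ?Z (gact k (pnt i))" using cfg.l_pos[OF Z' \<sigma>i] \<sigma>(2)[OF i(1)] by simp
        show "0 < ll Z (pnt i)" using cfg.l_pos[OF Z i] .
        show "insert (pnt i) (cfg.pts Z) \<subseteq> span (cfg.pts full)"
          unfolding pts_full using i by (auto simp: cfg.pts_def bits_def intro: span_base)
        show "dim (cfg.pts full) \<le> dim (cfg.pts Z) + 1"
          using dim_pnt facets_dim[OF Z] unfolding pts_full by linarith
        have "cfg.pts Y \<subseteq> cfg.pts full" unfolding pts_full by (auto simp: cfg.pts_def bits_def)
        then show "p' \<in> span (cfg.pts full)" using p'(2) span_mono by blast
        show "0 \<le> ll ?Z (gact k p')" using pos Z' p'(1) by simp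
      qed
    qed
    then have "p' \<in> cn (cfg.pts Y)" using step(1) p'(2) unfolding cfg.Gp_def by blast
    then show "p \<in> cn (cfg.pts (img (stab k) Y))"
      unfolding stab_pts[OF step(2)] p'(1) by (rule cn_image[OF gact_linear gact_inj[OF k]])
  qed
qed

lemma full_and: assumes "Z \<in> set facets" shows "cfg.pts (full AND Z) = cfg.pts Z"
  by (auto simp: cfg.pts_def bits_and bits_full) (auto simp: bits_def)

lemma full_Gp: "cfg.Gp full (set facets)"
proof (rule cfg.shoot_Gp)
  show "finite (set facets)" "set facets \<subseteq> set facets" by auto
  show "0 \<in> bits full" by (simp add: bits_full)
  show "\<exists>Z\<in>set facets. \<not> bit Z 0" using facet_at_0 by (auto simp: list_ex_iff bit_0)
  fix Z assume Z: "Z \<in> set facets"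
  have "cfg.Gp (full AND Z) (set facets)"
    using facets_Gp[OF Z] unfolding cfg.Gp_def full_and[OF Z] .
  moreover have "dim (cfg.pts full) \<le> dim (cfg.pts (full AND Z)) + 1"
    unfolding full_and[OF Z] using dim_pnt facets_dim[OF Z] unfolding pts_full by linarith
  ultimately show "dim (cfg.pts full) \<le> dim (cfg.pts (full AND Z)) + 1 \<and> cfg.Gp (full AND Z) (set facets)" by blast
qed

lemma dim_full: "dim (cfg.pts full) = 8"
proof -
  obtain Z where Z: "Z \<in> set facets" using facet_at_0 by (auto simp: list_ex_iff)
  obtain i where i: "i < 24" "\<not> bit Z i" using facets_ex[OF Z] by blast
  then have "\<not> bit (full AND Z) i" "bit full i" by (simp_all add: bit_and_iff bit_full)
  then have "full AND Z \<noteq> full" by metis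
  from cfg.step_dim[OF rng_full Z this] have "8 \<le> dim (cfg.pts full)"
    using facets_dim[OF Z] unfolding full_and[OF Z] by linarith
  then show ?thesis using dim_pnt unfolding pts_full by linarith
qed

lemma span_full: "span (cfg.pts full) = range hpair"
proof (rule subspace_dim_equal)
  show "span (cfg.pts full) \<subseteq> range hpair"
    using pnt_hpair by (intro span_minimal subspace_hpair) (auto simp: pts_full)
  show "dim (range hpair) \<le> dim (span (cfg.pts full))" using dim_hpair dim_full by simp
qed (auto simp: subspace_hpair)

lemma pnt_Vs: "i < 24 \<Longrightarrow> pnt i \<in> Vs"
proof -
  assume i: "i < 24"
  let ?v = "zc (vtab ! i)"
  have O: "?v \<in> vectors_over O5" by (simp add: vectors_over_O5)
  then have "?v \<in> vectors_over F5" by (rule_tac zc_F5)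
  moreover have "?v \<noteq> 0"
  proof
    assume v0: "?v = 0"
    have "q 0 = 0" using Iota_01 Iotas by (simp add: q_def outer_def map_vector_def vec_eq_iff zero_prod_def)
    then show False using pnt_nz[OF i] v0 by (simp add: pnt_def)
  qed
  ultimately have "1 *\<^sub>R q ?v \<in> C1" unfolding C1_def by (intro CollectI exI[of _ 1] exI[of _ ?v]) auto
  then show ?thesis using q_O5_Lambda[OF O] pnt_nz[OF i] by (simp add: Vs_def pnt_def)
qed

lemma complete_form:
  assumes "p \<in> span Vs" "\<And>h. h \<in> hh ` set facets \<Longrightarrow> form p \<le> form (h p)"
  shows "\<exists>a. (\<forall>x\<in>pnt ` {..<24}. 0 \<le> a x) \<and> p = (\<Sum>x\<in>pnt ` {..<24}. a x *\<^sub>R x)"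
proof -
  have "p \<in> span (cfg.pts full)" unfolding span_full using assms(1) span_minimal[OF Vs_hpair subspace_hpair] by blast
  moreover have "0 \<le> ll Z p" if "Z \<in> set facets" for Z using assms(2) that by (simp add: ll_def)
  ultimately have "p \<in> cn (cfg.pts full)" using full_Gp unfolding cfg.Gp_def by blast
  then show ?thesis unfolding pts_full cn_def by blast
qed

lemma Vs_mult: assumes "v \<in> Vs" "n > 0" shows "real n *\<^sub>R v \<in> Vs"
proof -
  obtain t w where v: "v = t *\<^sub>R q w" "t > 0" "w \<in> vectors_over F5 - {0}" using assms(1) by (auto simp: Vs_def C1_def)
  have "real n *\<^sub>R v = (real n * t) *\<^sub>R q w" "real n * t > 0" using v assms(2) by simp_all
  then have "real n *\<^sub>R v \<in> C1" using v(3) unfolding C1_def by blast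
  then show ?thesis using assms Lambda_scale[of v n] by (simp add: Vs_def)
qed

lemma GG_id: "id \<in> GG"
proof -
  have "id = act (mat 1)" by (rule ext) (simp add: act_id)
  then show ?thesis using GL2_O5_id unfolding GG_def by blast
qed

lemma GG_Vs: "g \<in> GG \<Longrightarrow> v \<in> Vs \<Longrightarrow> g v \<in> Vs"
proof -
  assume "g \<in> GG" "v \<in> Vs"
  then obtain a where "g = act a" "a \<in> GL2_O5" by (auto simp: GG_def)
  then show ?thesis using act_Vs \<open>v \<in> Vs\<close> by simp
qed

lemma form_Vs: "v \<in> Vs \<Longrightarrow> form v \<in> \<int>" "v \<in> Vs \<Longrightarrow> cbound * norm v \<le> form v"
  unfolding Vs_def using form_Lambda form_C1 by blast+

interpretation vor: voronoi Vs GG form "pnt ` {..<24}" "hh ` set facets" cbound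
proof (rule voronoi.intro)
  show "\<exists>h\<in>GG. (\<forall>x. g (h x) = x) \<and> (\<forall>x. h (g x) = x)" if "g \<in> GG" for g by (rule GG_inverse[OF that])
  show "0 \<notin> Vs" by (simp add: Vs_def)
  show "pnt ` {..<24} \<subseteq> Vs" using pnt_Vs by auto
  show "form x = 1" if "x \<in> pnt ` {..<24}" for x using that form_pnt by auto
  show "hh ` set facets \<subseteq> GG" using hh(1) by auto
  show "\<exists>a. (\<forall>x\<in>pnt ` {..<24}. 0 \<le> a x) \<and> p = (\<Sum>x\<in>pnt ` {..<24}. a x *\<^sub>R x)"
    if "p \<in> span Vs" "\<And>h. h \<in> hh ` set facets \<Longrightarrow> form p \<le> form (h p)" for p
    using that by (rule complete_form)
qed (assumption | rule GG_linear GG_id GG_comp GG_Vs linear_form form_Vs cbound_pos Vs_mult finite_imageI finite_lessThan finite_set)+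

text \<open>The squared modulus of the determinant of \<open>v\<close> and \<open>w\<close>; at each
  place it is the determinant of the sum of their rank one matrices.\<close>

definition zcross :: "zvec \<Rightarrow> zvec \<Rightarrow> int cyc" where
  "zcross v w = (let d = fst v * snd w - snd v * fst w in d * cyc_conj d)"

text \<open>\<open>Jinv\<close> as a single cyclotomic integer, so that evaluation decides equality;
  \<open>cyc_gal\<close> carries the second factor to the other place.\<close>

definition Jlist :: "zvec list \<Rightarrow> int cyc" where
  "Jlist vs = (\<Sum>v\<leftarrow>vs. let r = (\<Sum>w\<leftarrow>vs. zcross v w) in r * r) *
     (let t = (\<Sum>v\<leftarrow>vs. \<Sum>w\<leftarrow>vs. zcross v w) in cyc_gal (t * t))"

definition vecs :: "int \<Rightarrow> zvec list" where
  "vecs S = map snd (filter (\<lambda>(p, v). S AND p \<noteq> 0) (zip pows vtab))"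

definition masks :: "nat \<Rightarrow> int list" where
  "masks n = map fst (filter (\<lambda>(R, n', _). n' = n) reps)"

lemma J_distinct: "list_all (\<lambda>n. distinct (map (\<lambda>R. Jlist (vecs R)) (masks n))) [2, 3, 4, 5, 6, 7]" by code_simp

lemma length_masks: "map (\<lambda>n. length (masks n)) [2, 3, 4, 5, 6, 7] = [2, 4, 9, 11, 10, 5]" by code_simp

lemma reps_single: "list_all (\<lambda>(R, n, _). n \<noteq> 1 \<or> List.member pows R) reps" by code_simp

lemma reps_dims: "list_all (\<lambda>(R, n, _). 1 \<le> n \<and> n \<le> 7) reps" by code_simp

text \<open>Each vertex is the intersection of the facets through it. Being cut out in this way
  separates the 24 points and makes each of them an extreme point.\<close>

lemma vertex_ok: "list_all (\<lambda>p. foldl (AND) full (filter (\<lambda>Z. Z AND p = p) facets) = p) pows" by code_simp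

section \<open>Faces of the perfect facet up to equivalence\<close>

definition cv :: "int \<Rightarrow> (cmat \<times> cmat) set" where "cv S = convex hull (cfg.pts S)"

lemma cv_full: "cv full = vor.P0" by (simp add: cv_def vor.P0_def pts_full)

lemma form_pts: "y \<in> cfg.pts S \<Longrightarrow> form y = 1"
  by (auto simp: cfg.pts_def bits_def form_pnt)

lemma form_sum: "form (\<Sum>y\<in>A. a y *\<^sub>R y) = (\<Sum>y\<in>A. a y * form y)"
  by (simp add: linear_sum[OF linear_form] linear_scale[OF linear_form])

lemma cv_eq: "cv S = {p \<in> cn (cfg.pts S). form p = 1}"
proof -
  have *: "form (\<Sum>y\<in>cfg.pts S. a y *\<^sub>R y) = sum a (cfg.pts S)" for a
    unfolding form_sum by (intro sum.cong) (auto simp: form_pts)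
  show ?thesis
  proof (intro set_eqI iffI)
    fix p assume "p \<in> cv S"
    then obtain u where "\<forall>y\<in>cfg.pts S. 0 \<le> u y" "sum u (cfg.pts S) = 1" "(\<Sum>y\<in>cfg.pts S. u y *\<^sub>R y) = p"
      unfolding cv_def convex_hull_finite[OF cfg.finite_pts] by blast
    then show "p \<in> {p \<in> cn (cfg.pts S). form p = 1}" using *[of u] unfolding cn_def by auto
  next
    fix p assume "p \<in> {p \<in> cn (cfg.pts S). form p = 1}"
    then obtain u where "\<forall>y\<in>cfg.pts S. 0 \<le> u y" "p = (\<Sum>y\<in>cfg.pts S. u y *\<^sub>R y)" "form p = 1"
      unfolding cn_def by blast
    then show "p \<in> cv S" using *[of u] unfolding cv_def convex_hull_finite[OF cfg.finite_pts] by auto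
  qed
qed

lemma pts_subset_full: "cfg.pts S \<subseteq> cfg.pts full"
  unfolding pts_full by (auto simp: cfg.pts_def bits_def)

lemma cv_subset_span: "cv S \<subseteq> span (cfg.pts S)"
  unfolding cv_def by (simp add: hull_minimal span_superset subspace_imp_convex)

lemma ll_cv_nonneg: assumes "Z \<in> set facets" "p \<in> cv S" shows "0 \<le> ll Z p"
proof -
  obtain a where a: "\<forall>y\<in>cfg.pts S. 0 \<le> a y" "p = (\<Sum>y\<in>cfg.pts S. a y *\<^sub>R y)"
    using assms(2) unfolding cv_eq cn_def by blast
  have "0 \<le> ll Z y" if "y \<in> cfg.pts S" for y using that cfg.l_nonneg[OF assms(1)] by (auto simp: cfg.pts_def bits_def)
  then show ?thesis using a(1) unfolding a(2) linear_sum[OF linear_ll[OF assms(1)]] linear_scale[OF linear_ll[OF assms(1)]]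
    by (intro sum_nonneg) simp
qed

text \<open>A nonnegative combination on which the functional vanishes gives no weight to the
  vertices off \<open>Z\<close>, where the functional is positive.\<close>

lemma cv_and: assumes Z: "Z \<in> set facets" shows "cv (S AND Z) = {p \<in> cv S. ll Z p = 0}"
proof
  show "cv (S AND Z) \<subseteq> {p \<in> cv S. ll Z p = 0}"
  proof
    fix p assume p: "p \<in> cv (S AND Z)"
    have "p \<in> cv S" using p hull_mono[OF cfg.pts_and(1)] unfolding cv_def by blast
    moreover have "ll Z p = 0"
    proof -
      have "p \<in> span (cfg.pts (S AND Z))" using p cv_subset_span by blast
      then show ?thesis
        using linear_eq_0_on_span[OF linear_ll[OF Z], of "cfg.pts (S AND Z)"] cfg.l_pts[OF Z] cfg.pts_and(2) by blast
    qed
    ultimately show "p \<in> {p \<in> cv S. ll Z p = 0}" by simp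
  qed
  show "{p \<in> cv S. ll Z p = 0} \<subseteq> cv (S AND Z)"
  proof
    fix p assume p: "p \<in> {p \<in> cv S. ll Z p = 0}"
    then obtain a where a: "\<forall>y\<in>cfg.pts S. 0 \<le> a y" "p = (\<Sum>y\<in>cfg.pts S. a y *\<^sub>R y)" and f: "form p = 1"
      unfolding cv_eq cn_def by blast
    have nn: "0 \<le> a y * ll Z y" if "y \<in> cfg.pts S" for y
      using that a(1) cfg.l_nonneg[OF Z] by (auto simp: cfg.pts_def bits_def)
    have "(\<Sum>y\<in>cfg.pts S. a y * ll Z y) = 0"
    proof -
      have "ll Z p = (\<Sum>y\<in>cfg.pts S. a y * ll Z y)"
        unfolding a(2) linear_sum[OF linear_ll[OF Z]] linear_scale[OF linear_ll[OF Z]] by simp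
      then show ?thesis using p by simp
    qed
    then have zero: "a y * ll Z y = 0" if "y \<in> cfg.pts S" for y
      using nn that by (simp add: sum_nonneg_eq_0_iff)
    have "a y = 0" if y: "y \<in> cfg.pts S - cfg.pts (S AND Z)" for y
    proof -
      obtain i where i: "i \<in> bits S" "y = pnt i" using y by (auto simp: cfg.pts_def)
      then have "\<not> bit Z i" using y by (auto simp: cfg.pts_def bits_and) (auto simp: bits_def)
      then have "0 < ll Z y" using cfg.l_pos[OF Z, of i] i by (simp add: bits_def)
      then show ?thesis using zero[of y] y by auto
    qed
    then have "p = (\<Sum>y\<in>cfg.pts (S AND Z). a y *\<^sub>R y)"
      unfolding a(2) using cfg.pts_and(1) by (intro sum.mono_neutral_right) auto
    then show "p \<in> cv (S AND Z)"
      unfolding cv_eq cn_def using a(1) f cfg.pts_and(1) by blast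
  qed
qed

lemma face_and: assumes "Z \<in> set facets" shows "cv (S AND Z) face_of cv S"
  unfolding cv_and[OF assms]
  by (rule exposed_face[OF _ linear_ll[OF assms]]) (auto simp: cv_def[symmetric] ll_cv_nonneg[OF assms], simp add: cv_def)

lemma face_meet: "set Zs \<subseteq> set facets \<Longrightarrow> cv (meet S Zs) face_of cv S"
proof (induction Zs arbitrary: S)
  case Nil show ?case by (simp add: meet_def cv_def face_of_refl)
next
  case (Cons Z Zs)
  have "cv (meet (S AND Z) Zs) face_of cv (S AND Z)" using Cons by simp
  then show ?case using face_of_trans[OF _ face_and[of Z S]] Cons.prems by (simp add: meet_def)
qed

text \<open>Let \<open>p\<close> be a relative interior point of \<open>P\<close>. If the only
  inequalities tight at \<open>p\<close> were those tight on all of \<open>S\<close>, the segment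
  from any \<open>x\<close> to \<open>p\<close> could be prolonged inside the polytope, and the face
  property would put every \<open>x\<close> into \<open>P\<close>. So some other inequality is tight
  at \<open>p\<close>, and it is then tight on \<open>P\<close>.\<close>

lemma face_step:
  assumes G: "cfg.Gp S K" "K \<subseteq> set facets" "finite K" and P: "P face_of cv S" "P \<noteq> {}" "P \<noteq> cv S"
  shows "\<exists>Z\<in>K. S AND Z \<noteq> S \<and> P face_of cv (S AND Z)"
proof -
  have PS: "P \<subseteq> cv S" using P(1) face_of_imp_subset by blast
  have "convex P" using P(1) face_of_imp_convex by blast
  then obtain p where p: "p \<in> rel_interior P" using rel_interior_eq_empty P(2) by blast
  then have pP: "p \<in> P" using rel_interior_subset by blast
  have "\<exists>Z\<in>K. S AND Z \<noteq> S \<and> ll Z p = 0"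
  proof (rule ccontr)
    assume no: "\<not> (\<exists>Z\<in>K. S AND Z \<noteq> S \<and> ll Z p = 0)"
    have "cv S \<subseteq> P"
    proof
      fix x assume x: "x \<in> cv S"
      have ev: "\<exists>e>0. 0 \<le> ll Z p + e * (ll Z p - ll Z x) \<and> (\<forall>e'. 0 < e' \<and> e' \<le> e \<longrightarrow> 0 \<le> ll Z p + e' * (ll Z p - ll Z x))" if Z: "Z \<in> K" for Z
      proof (cases "S AND Z = S")
        case True
        have ZF: "Z \<in> set facets" using Z G(2) by blast
        have "ll Z p = 0" "ll Z x = 0" using cv_and[OF ZF, of S] True x pP PS by auto
        then show ?thesis by (intro exI[of _ 1]) simp
      next
        case False
        have ZF: "Z \<in> set facets" using Z G(2) by blast
        have pos: "0 < ll Z p" using no Z False ll_cv_nonneg[OF ZF, of p S] pP PS by force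
        have x0: "0 \<le> ll Z x" by (rule ll_cv_nonneg[OF ZF x])
        \<comment> \<open>Any step up to this length keeps the functional nonnegative; the summand 1
          excludes a division by zero.\<close>
        define e where "e = ll Z p / (1 + ll Z x)"
        have e: "0 < e" using pos x0 by (simp add: e_def)
        have "0 \<le> ll Z p + e' * (ll Z p - ll Z x)" if "0 < e'" "e' \<le> e" for e'
        proof -
          have "e' * (1 + ll Z x) \<le> ll Z p" using that x0 by (simp add: e_def field_simps)
          moreover have "0 \<le> e' * ll Z p" using that pos by simp
          ultimately show ?thesis using that by (simp add: algebra_simps)
        qed
        then show ?thesis using e by (intro exI[of _ e]) auto
      qed
      then obtain E where E: "\<And>Z. Z \<in> K \<Longrightarrow> 0 < E Z \<and> (\<forall>e'. 0 < e' \<and> e' \<le> E Z \<longrightarrow> 0 \<le> ll Z p + e' * (ll Z p - ll Z x))" by metis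
      define e where "e = Min (insert 1 (E ` K))"
      have e0: "0 < e" unfolding e_def using E G(3) by (subst Min_gr_iff) auto
      have eE: "e \<le> E Z" if "Z \<in> K" for Z unfolding e_def using that G(3) by (intro Min_le) auto
      \<comment> \<open>The prolongation of the segment from \<open>x\<close> beyond
        \<open>p\<close>; it keeps the value 1 of the form, so membership in the cone puts it into
        the polytope.\<close>
      define y where "y = p + e *\<^sub>R (p - x)"
      have "y \<in> span (cfg.pts S)"
        unfolding y_def using pP PS x cv_subset_span by (intro span_add span_scale span_diff) auto
      moreover have "0 \<le> ll Z y" if Z: "Z \<in> K" for Z
      proof -
        have "linear (ll Z)" using linear_ll Z G(2) by blast
        then have "ll Z y = ll Z p + e * (ll Z p - ll Z x)" unfolding y_def by (simp add: linear_add linear_scale linear_diff)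
        then show ?thesis using E[OF Z] e0 eE[OF Z] by simp
      qed
      ultimately have "y \<in> cn (cfg.pts S)" using G(1) unfolding cfg.Gp_def by blast
      moreover have "form y = 1"
      proof -
        have "form p = 1" "form x = 1" using pP PS x unfolding cv_eq by auto
        then show ?thesis unfolding y_def by (simp add: linear_add[OF linear_form] linear_scale[OF linear_form] linear_diff[OF linear_form])
      qed
      ultimately have y: "y \<in> cv S" unfolding cv_eq by simp
      show "x \<in> P"
      proof (cases "x = p")
        case True then show ?thesis using pP by simp
      next
        case False
        have "p \<in> open_segment x y"
          unfolding in_segment
        proof (intro conjI exI[of _ "1 / (1 + e)"])
          have "(1 + e) *\<^sub>R p = e *\<^sub>R x + y" by (simp add: y_def algebra_simps)
          moreover have "p = (1 / (1 + e)) *\<^sub>R ((1 + e) *\<^sub>R p)" using e0 by simp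
          ultimately have "p = (1 / (1 + e)) *\<^sub>R (e *\<^sub>R x + y)" by metis
          also have "\<dots> = (e / (1 + e)) *\<^sub>R x + (1 / (1 + e)) *\<^sub>R y" by (simp add: scaleR_add_right)
          also have "e / (1 + e) = 1 - 1 / (1 + e)" using e0 by (simp add: field_simps)
          finally show "p = (1 - 1 / (1 + e)) *\<^sub>R x + (1 / (1 + e)) *\<^sub>R y" .
          have "y - x = (1 + e) *\<^sub>R (p - x)" by (simp add: y_def algebra_simps)
          then show "x \<noteq> y" using False e0 by auto
        qed (use e0 in auto)
        then show ?thesis using P(1) pP x y unfolding face_of_def by blast
      qed
    qed
    then show False using P(3) PS by blast
  qed
  then obtain Z where Z: "Z \<in> K" "S AND Z \<noteq> S" "ll Z p = 0" by blast
  have ZF: "Z \<in> set facets" using Z G(2) by blast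
  have "p \<in> cv (S AND Z)" using Z(3) pP PS unfolding cv_and[OF ZF] by blast
  then have "P \<subseteq> cv (S AND Z)"
    using subset_of_face_of[OF face_and[OF ZF] PS] p by (auto simp: disjnt_iff)
  then have "P face_of cv (S AND Z)" using face_of_subset[OF P(1)] face_of_imp_subset[OF face_and[OF ZF]] by blast
  then show ?thesis using Z by blast
qed

lemma gen_pts:
  assumes k: "k < length gens" and d: "defined (gen_maps ! k) S"
  shows "cfg.pts (img (gen_maps ! k) S) = gact k ` cfg.pts S"
proof -
  let ?ms = "gen_maps ! k"
  have ms: "?ms = snd (gens ! k)" using k by (simp add: gen_maps_def)
  note g = gens_nth[OF k, folded ms]
  have "\<exists>j<24. ?ms ! i = 2 ^ j \<and> gact k (pnt i) = pnt j" if "i \<in> bits S" for i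
    using g(2)[of i] defined_iff[OF d, of i] g(1) that by (auto simp: bits_def)
  then have "\<forall>i\<in>bits S. \<exists>j. j < 24 \<and> ?ms ! i = 2 ^ j \<and> gact k (pnt i) = pnt j" by blast
  from bchoice[OF this] obtain \<sigma> where \<sigma>: "\<And>i. i \<in> bits S \<Longrightarrow> \<sigma> i < 24 \<and> ?ms ! i = 2 ^ \<sigma> i \<and> gact k (pnt i) = pnt (\<sigma> i)" by blast
  have "bit (img ?ms S) j \<longleftrightarrow> (\<exists>i\<in>bits S. j = \<sigma> i)" for j
  proof -
    have "bit (img ?ms S) j \<longleftrightarrow> (\<exists>i\<in>bits S. bit (?ms ! i) j)" unfolding bit_img g(1) bits_def by auto
    also have "\<dots> \<longleftrightarrow> (\<exists>i\<in>bits S. j = \<sigma> i)" using \<sigma> by (auto simp: bit_exp_iff)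
    finally show ?thesis .
  qed
  then have "bits (img ?ms S) = \<sigma> ` bits S" using \<sigma> unfolding bits_def[of "img ?ms S"] by blast
  then show ?thesis unfolding cfg.pts_def using \<sigma> by (auto simp: image_image intro!: image_cong)
qed

section \<open>Equivalence of faces and descent to the representatives\<close>

definition geq :: "int \<Rightarrow> int \<Rightarrow> bool" where
  "geq S T \<longleftrightarrow> (\<exists>g\<in>GG. g ` cfg.pts S = cfg.pts T)"

lemma geq_refl: "geq S S"
  unfolding geq_def by (rule bexI[OF _ GG_id]) simp

lemma geq_trans: "geq S T \<Longrightarrow> geq T U \<Longrightarrow> geq S U"
proof -
  assume "geq S T" "geq T U"
  then obtain g h where g: "g \<in> GG" "g ` cfg.pts S = cfg.pts T" and h: "h \<in> GG" "h ` cfg.pts T = cfg.pts U"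
    unfolding geq_def by blast
  have "(h \<circ> g) ` cfg.pts S = cfg.pts U" unfolding image_comp[symmetric] g(2) h(2) ..
  then show ?thesis unfolding geq_def using GG_comp[OF h(1) g(1)] by blast
qed

lemma geq_sym: "geq S T \<Longrightarrow> geq T S"
proof -
  assume "geq S T"
  then obtain g where g: "g \<in> GG" "g ` cfg.pts S = cfg.pts T" unfolding geq_def by blast
  obtain h where h: "h \<in> GG" "\<forall>x. h (g x) = x" using GG_inverse[OF g(1)] by blast
  have "h ` cfg.pts T = cfg.pts S" unfolding g(2)[symmetric] image_image by (simp only: h(2)[rule_format] image_ident)
  then show ?thesis unfolding geq_def using h(1) by blast
qed

lemma GG_inj: "g \<in> GG \<Longrightarrow> inj g"
  by (rule vor.inj_G)

lemma geq_dim: assumes "geq S T" shows "dim (cfg.pts S) = dim (cfg.pts T)"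
proof -
  obtain g where g: "g \<in> GG" "g ` cfg.pts S = cfg.pts T" using assms unfolding geq_def by blast
  have "dim (g ` cfg.pts S) = dim (cfg.pts S)"
    by (rule dim_image_eq[OF GG_linear[OF g(1)] inj_on_subset[OF GG_inj[OF g(1)] subset_UNIV]])
  then show ?thesis using g(2) by simp
qed

lemma geq_cv: assumes "geq S T" shows "\<exists>g\<in>GG. g ` cv S = cv T"
proof -
  obtain g where g: "g \<in> GG" "g ` cfg.pts S = cfg.pts T" using assms unfolding geq_def by blast
  have "g ` cv S = cv T" unfolding cv_def g(2)[symmetric] by (rule convex_hull_linear_image[OF GG_linear[OF g(1)]])
  then show ?thesis using g(1) by blast
qed

lemma follow_geq: "follow gen_maps w S = Some T \<Longrightarrow> geq S T"
proof (induction w arbitrary: S)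
  case Nil then show ?case by (simp add: geq_refl)
next
  case (Cons k w)
  have lg: "length gen_maps = length gens" by (simp add: gen_maps_def)
  have k: "k < length gens" "defined (gen_maps ! k) S" "follow gen_maps w (img (gen_maps ! k) S) = Some T"
    using Cons.prems by (auto simp: lg split: if_splits)
  have "geq S (img (gen_maps ! k) S)"
    unfolding geq_def using gen_pts[OF k(1,2)] gact_GG[OF k(1)] by blast
  then show ?case using Cons.IH[OF k(3)] geq_trans by blast
qed

definition rset :: "int set" where "rset = fst ` set reps"

lemma rset_data:
  assumes "R \<in> rset"
  shows "\<exists>n up down Kw. (R, n, up, down, Kw) \<in> set reps \<and> 1 \<le> n \<and> n \<le> 7 \<and> dim (cfg.pts R) = n \<and> rng R \<and>
    (n = 1 \<longrightarrow> R \<in> set pows) \<and> (n \<noteq> 1 \<longrightarrow> cfg.Gp R (fst ` set Kw)) \<and> fst ` set Kw \<subseteq> set facets \<and>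
    (\<forall>Z\<in>fst ` set Kw. \<exists>R'\<in>rset. geq (R AND Z) R') \<and> bits R \<noteq> {} \<and> cv R face_of cv full"
proof -
  obtain n up down Kw where r: "(R, n, up, down, Kw) \<in> set reps" using assms by (auto simp: rset_def)
  have ok: "rep_ok facets gen_maps nodes (map fst reps) (R, n, up, down, Kw)"
    using reps_ok r unfolding list_all_iff by blast
  have f: "flag R n up down" "set up \<subseteq> set facets" "set down \<subseteq> set facets" "set (map fst Kw) \<subseteq> set facets"
    using ok by (auto simp: rep_ok_def cfg.subl_iff)
  note fd = cfg.flag_dim[OF f(1-3)]
  have G: "cfg.Gp R (fst ` set Kw)" if "n \<noteq> 1"
  proof -
    have "simplicial R (map fst Kw) \<or> list_ex (\<lambda>(S, _, _, _, _, K). S = R \<and> subl K (map fst Kw)) nodes"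
      using ok that by (simp add: rep_ok_def)
    then show ?thesis
    proof
      assume "simplicial R (map fst Kw)"
      from cfg.simp_on_Gp[OF simplicial_simp_on[OF this] f(4)] show ?thesis by simp
    next
      assume "list_ex (\<lambda>(S, _, _, _, _, K). S = R \<and> subl K (map fst Kw)) nodes"
      then obtain n' up' down' m K where
        nd: "(R, n', up', down', m, K) \<in> set nodes" and K: "set K \<subseteq> fst ` set Kw"
        unfolding list_ex_iff cfg.subl_iff by fastforce
      have "cfg.Gp R (set K)" using nodes_sound[OF nd] by (simp add: cfg.node_sound_def)
      then show ?thesis using cfg.Gp_mono[OF _ K] by blast
    qed
  qed
  have eq: "\<exists>R'\<in>rset. geq (R AND Z) R'" if "Z \<in> fst ` set Kw" for Z
  proof -
    obtain w where w: "(Z, w) \<in> set Kw" using \<open>Z \<in> fst ` set Kw\<close> by auto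
    have "list_all (\<lambda>(Z, w). case follow gen_maps w (R AND Z) of None \<Rightarrow> False | Some R' \<Rightarrow> List.member (map fst reps) R') Kw"
      using ok by (simp add: rep_ok_def)
    then have "case follow gen_maps w (R AND Z) of None \<Rightarrow> False | Some R' \<Rightarrow> List.member (map fst reps) R'"
      using w unfolding list_all_iff by blast
    then obtain R' where "follow gen_maps w (R AND Z) = Some R'" "R' \<in> set (map fst reps)"
      by (auto split: option.splits)
    then show ?thesis using follow_geq by (auto simp: rset_def)
  qed
  have "cv R face_of cv full" using face_meet[OF f(2), of full] f(1) by (simp add: flag_def)
  moreover have "1 \<le> n" "n \<le> 7" using reps_dims r by (auto simp: list_all_iff)
  moreover have "n = 1 \<Longrightarrow> R \<in> set pows" using reps_single r by (fastforce simp: list_all_iff)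
  moreover have "fst ` set Kw \<subseteq> set facets" using f(4) by simp
  ultimately show ?thesis
    by (intro exI[of _ n] exI[of _ up] exI[of _ down] exI[of _ Kw] conjI impI ballI r fd G eq)
qed

lemma bits_pow: "v < 24 \<Longrightarrow> bits (2 ^ v) = {v}"
  by (auto simp: bits_def bit_exp_iff)

text \<open>Induction on dimension: a proper face of a representative lies in one of its
  intersections \<open>R AND Z\<close>, which a stored word moves to a representative of smaller
  dimension. A representative of dimension 1 is a single vertex and ends the descent.\<close>

lemma rep_faces:
  "R \<in> rset \<Longrightarrow> P face_of cv R \<Longrightarrow> P \<noteq> {} \<Longrightarrow> \<exists>R'\<in>rset. \<exists>g\<in>GG. g ` P = cv R'"
proof (induction "dim (cfg.pts R)" arbitrary: R P rule: less_induct)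
  case less
  obtain n and Kw :: "(int \<times> nat list) list" where R: "dim (cfg.pts R) = n" "rng R"
    "n = 1 \<longrightarrow> R \<in> set pows" "n \<noteq> 1 \<longrightarrow> cfg.Gp R (fst ` set Kw)" "fst ` set Kw \<subseteq> set facets"
    "\<forall>Z\<in>fst ` set Kw. \<exists>R'\<in>rset. geq (R AND Z) R'"
    using rset_data[OF less.prems(1)] by blast
  show ?case
  proof (cases "P = cv R")
    case True
    then have "id ` P = cv R" by simp
    then show ?thesis using less.prems(1) GG_id by blast
  next
    case False
    have "n \<noteq> 1"
    proof
      assume "n = 1"
      then obtain v where v: "v < 24" "R = 2 ^ v" using R(3) unfolding pows_eq by auto
      then have "cv R = {pnt v}" by (simp add: cv_def cfg.pts_def bits_pow)
      then have "P = cv R" using face_of_imp_subset[OF less.prems(2)] less.prems(3) by auto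
      then show False using False by simp
    qed
    then obtain Z where Z: "Z \<in> fst ` set Kw" "R AND Z \<noteq> R" "P face_of cv (R AND Z)"
      using face_step[OF R(4)[rule_format] R(5) _ less.prems(2,3) False] by auto
    obtain R' where R': "R' \<in> rset" "geq (R AND Z) R'" using R(6) Z(1) by blast
    obtain g where g: "g \<in> GG" "g ` cv (R AND Z) = cv R'" using geq_cv[OF R'(2)] by blast
    have "dim (cfg.pts R') < dim (cfg.pts R)"
      using cfg.step_dim[OF R(2) _ Z(2)] Z(1) R(5) geq_dim[OF R'(2)] by force
    moreover have "g ` P face_of cv R'"
      using face_of_linear_image[OF GG_linear[OF g(1)] GG_inj[OF g(1)], of P "cv (R AND Z)"] Z(3) g(2) by simp
    ultimately obtain R'' h where "R'' \<in> rset" "h \<in> GG" "h ` (g ` P) = cv R''"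
      using less.hyps[of R' "g ` P"] R'(1) less.prems(3) by blast
    moreover from this(3) have "(h \<circ> g) ` P = cv R''" by (simp only: image_comp)
    ultimately show ?thesis using GG_comp[OF _ g(1)] by blast
  qed
qed

text \<open>A base facet is moved by its word in \<open>base_words\<close>; every other facet is led
  back to a base facet by the symmetries.\<close>

lemma facet_rep: assumes "Z \<in> set facets" shows "\<exists>R\<in>rset. geq Z R"
  using assms
proof (induction rule: facets_induct)
  case (base Z)
  then have "Z \<in> set (map fst base_words)" unfolding base_words_bases .
  then obtain w where w: "(Z, w) \<in> set base_words" by auto
  then obtain R where "follow gen_maps w Z = Some R" "R \<in> set (map fst reps)"
  proof -
    have "case follow gen_maps w Z of None \<Rightarrow> False | Some R' \<Rightarrow> List.member (map fst reps) R'"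
      using base_words_ok w unfolding list_all_iff by blast
    then show ?thesis using that by (auto split: option.splits)
  qed
  then show ?case using follow_geq by (auto simp: rset_def)
next
  case (step Y k)
  have "geq Y (img (stab k) Y)"
    unfolding geq_def using stab_pts[OF step(2)] gact_GG length_gens step(2) by auto
  then show ?case using step(1) geq_sym geq_trans by blast
qed

lemma P0_faces:
  assumes "P face_of vor.P0" "P \<noteq> {}"
  shows "\<exists>R\<in>insert full rset. \<exists>g\<in>GG. g ` P = cv R"
proof (cases "P = cv full")
  case True
  then have "id ` P = cv full" by simp
  then show ?thesis using GG_id by blast
next
  case False
  obtain Z where Z: "Z \<in> set facets" "P face_of cv (full AND Z)"
    using face_step[OF full_Gp subset_refl finite_set assms[folded cv_full] False] by blast
  have "cv (full AND Z) = cv Z" unfolding cv_def full_and[OF Z(1)] ..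
  obtain R where R: "R \<in> rset" "geq Z R" using facet_rep[OF Z(1)] by blast
  obtain g where g: "g \<in> GG" "g ` cv Z = cv R" using geq_cv[OF R(2)] by blast
  have "g ` P face_of cv R"
    using face_of_linear_image[OF GG_linear[OF g(1)] GG_inj[OF g(1)], of P "cv Z"] Z(2) g(2) \<open>cv (full AND Z) = cv Z\<close> by simp
  from rep_faces[OF R(1) this] assms(2) obtain R' h where "R' \<in> rset" "h \<in> GG" "h ` (g ` P) = cv R'" by blast
  moreover from this(3) have "(h \<circ> g) ` P = cv R'" by (simp only: image_comp)
  ultimately show ?thesis using GG_comp[OF _ g(1)] by blast
qed

section \<open>Counting classes of cones\<close>

definition D1 :: "cmat \<times> cmat \<Rightarrow> cmat \<times> cmat \<Rightarrow> complex" where "D1 p p' = det (fst p + fst p')"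
definition D2 :: "cmat \<times> cmat \<Rightarrow> cmat \<times> cmat \<Rightarrow> complex" where "D2 p p' = det (snd p + snd p')"

text \<open>A group element multiplies the determinants at each place by the squared modulus of its
  own determinant there. The two factors have product 1, and each place enters with degree two, so
  they cancel.\<close>

definition Jinv :: "(cmat \<times> cmat) set \<Rightarrow> complex" where
  "Jinv A = (\<Sum>p\<in>A. (\<Sum>p'\<in>A. D1 p p')\<^sup>2) * (\<Sum>p\<in>A. \<Sum>p'\<in>A. D2 p p')\<^sup>2"

lemma det_ctranspose: "det (ctranspose B) = cnj (det B)"
  by (simp add: det_2 ctranspose_def)

lemma det_sandwich: "det (B ** A ** ctranspose B) = of_real ((cmod (det B))\<^sup>2) * det A"
  unfolding det_mul det_ctranspose complex_norm_square by (simp add: mult_ac)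

lemma D_act:
  "D1 (act g p) (act g p') = of_real ((cmod (det (map_matrix iota1 g)))\<^sup>2) * D1 p p'"
  "D2 (act g p) (act g p') = of_real ((cmod (det (map_matrix iota2 g)))\<^sup>2) * D2 p p'"
proof -
  have f: "fst (act g r) = map_matrix iota1 g ** fst r ** ctranspose (map_matrix iota1 g)"
    "snd (act g r) = map_matrix iota2 g ** snd r ** ctranspose (map_matrix iota2 g)" for r
    by (simp_all add: act_def split: prod.splits)
  have "fst (act g p) + fst (act g p') = fst (act g (p + p'))" "snd (act g p) + snd (act g p') = snd (act g (p + p'))"
    by (simp_all add: linear_add[OF linear_act])
  then show "D1 (act g p) (act g p') = of_real ((cmod (det (map_matrix iota1 g)))\<^sup>2) * D1 p p'"
    "D2 (act g p) (act g p') = of_real ((cmod (det (map_matrix iota2 g)))\<^sup>2) * D2 p p'"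
    unfolding D1_def D2_def by (simp_all only: f det_sandwich fst_add snd_add)
qed

lemma det_zm: "det (zm M) = ival zeta (zdet M)" "det (map_matrix iota1 (zm M)) = ival zeta (zdet M)"
  "det (map_matrix iota2 (zm M)) = ival (zeta ^ 3) (zdet M)"
proof -
  obtain a b c d where M: "M = ((a, b), (c, d))" by (metis surj_pair)
  note w = zeta_prim5 prim5_cube[OF zeta_prim5]
  show "det (zm M) = ival zeta (zdet M)" "det (map_matrix iota1 (zm M)) = ival zeta (zdet M)"
    "det (map_matrix iota2 (zm M)) = ival (zeta ^ 3) (zdet M)"
    by (simp_all add: det_2 M zm_def zc_def zdet_def map_matrix_def iota1_cval iota2_cval cint_diff cint_mult
        cval_diff cval_mul[OF w(1)] cval_mul[OF w(2)])
qed

lemma ival_inj: "ival zeta x = ival zeta y \<Longrightarrow> x = y"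
proof -
  assume "ival zeta x = ival zeta y"
  then have "cint x = cint y" by (rule cval_inj[OF zeta_prim5])
  then show ?thesis by (cases x; cases y) simp
qed

text \<open>The product is the norm of the determinant. This is a unit of the integers, and as a
  product of squares it is not negative.\<close>

lemma det_unit: assumes "g \<in> GL2_O5"
  shows "(cmod (det (map_matrix iota1 g)))\<^sup>2 * (cmod (det (map_matrix iota2 g)))\<^sup>2 = 1"
proof -
  obtain h where h: "h \<in> GL2_O5" "g ** h = mat 1" using GL2_O5_inverse[OF assms] by blast
  obtain M where M: "g = zm M" using GL2_zm[OF assms] .
  obtain M' where M': "h = zm M'" using GL2_zm[OF h(1)] .
  have "det (zm M) * det (zm M') = 1" using h(2) unfolding M M' by (metis det_I det_mul)
  then have "ival zeta (zdet M * zdet M') = ival zeta 1"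
    using cint_of_int[of 1] by (simp add: det_zm cint_mult cval_mul[OF zeta_prim5])
  then have "zdet M * zdet M' = 1" by (rule ival_inj)
  then have "cyc_norm (zdet M) * cyc_norm (zdet M') = cyc_norm 1" by (simp only: cyc_norm_mult[symmetric])
  moreover have "cyc_norm (1 :: int cyc) = 1" by (simp add: cyc_norm_def one_cyc_def Let_def)
  moreover obtain n where n: "cyc_norm (zdet M) = of_int n" using norm_const_int by blast
  moreover obtain n' where "cyc_norm (zdet M') = of_int n'" using norm_const_int by blast
  ultimately have nn: "n * n' = 1" by (simp add: of_int_cyc one_cyc_def Let_def)
  note w = zeta_prim5 prim5_cube[OF zeta_prim5]
  have "of_real ((cmod (det (map_matrix iota1 g)))\<^sup>2 * (cmod (det (map_matrix iota2 g)))\<^sup>2) = ival zeta (cyc_norm (zdet M))"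
    unfolding M det_zm of_real_mult complex_norm_square cyc_norm_def
    by (simp only: cint_mult cint_conj cint_gal cval_mul[OF w(1)] cval_mul[OF w(2)] cval_gal[OF w(1)] cval_conj[OF w(1)] cval_conj[OF w(2)])
  also have "\<dots> = of_real (of_int n)" unfolding n cint_of_int cval_of_int by simp
  finally have eq: "(cmod (det (map_matrix iota1 g)))\<^sup>2 * (cmod (det (map_matrix iota2 g)))\<^sup>2 = of_int n"
    by (simp only: of_real_eq_iff)
  have "0 \<le> (cmod (det (map_matrix iota1 g)))\<^sup>2 * (cmod (det (map_matrix iota2 g)))\<^sup>2" by simp
  then have "0 \<le> n" unfolding eq by simp
  then have "n = 1" using nn by (metis zmult_eq_1_iff not_one_le_zero neg_0_le_iff_le)
  then show ?thesis using eq by simp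
qed

lemma Jinv_GG: assumes "g \<in> GG" shows "Jinv (g ` A) = Jinv A"
proof -
  obtain a where a: "g = act a" "a \<in> GL2_O5" using assms by (auto simp: GG_def)
  define s t where "s = complex_of_real ((cmod (det (map_matrix iota1 a)))\<^sup>2)"
    and "t = complex_of_real ((cmod (det (map_matrix iota2 a)))\<^sup>2)"
  have st: "s * t = 1" unfolding s_def t_def of_real_mult[symmetric] det_unit[OF a(2)] by simp
  have inj: "inj_on g A" using inj_on_subset[OF GG_inj[OF assms] subset_UNIV] .
  have d: "D1 (g p) (g p') = s * D1 p p'" "D2 (g p) (g p') = t * D2 p p'" for p p'
    unfolding a(1) D_act s_def t_def by simp_all
  have "Jinv (g ` A) = (\<Sum>p\<in>A. (s * (\<Sum>p'\<in>A. D1 p p'))\<^sup>2) * (t * (\<Sum>p\<in>A. \<Sum>p'\<in>A. D2 p p'))\<^sup>2"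
    unfolding Jinv_def sum.reindex[OF inj] o_def d by (simp add: sum_distrib_left)
  also have "\<dots> = (s * t)\<^sup>2 * Jinv A"
    unfolding Jinv_def power_mult_distrib sum_distrib_left[symmetric] by (simp add: mult_ac)
  finally show ?thesis using st by simp
qed

section \<open>Evaluation of the invariant at the vertices\<close>

lemma det_outer_add: "det (outer u + outer u') = (u $ 1 * u' $ 2 - u $ 2 * u' $ 1) * cnj (u $ 1 * u' $ 2 - u $ 2 * u' $ 1)"
  by (simp add: det_2 outer_def algebra_simps)

lemma D_q: "D1 (q (zc v)) (q (zc v')) = ival zeta (zcross v v')" "D2 (q (zc v)) (q (zc v')) = ival (zeta ^ 3) (zcross v v')"
  unfolding D1_def D2_def q_def fst_conv snd_conv det_outer_add
    map_vector_zc[where w = zeta, OF iota1_cval] map_vector_zc[where w = "zeta ^ 3", OF iota2_cval] zcross_def Let_def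
  by (simp_all add: cint_mult cint_diff cint_conj cval_diff cval_mul[OF zeta_prim5] cval_conj[OF zeta_prim5]
      cval_mul[OF prim5_cube[OF zeta_prim5]] cval_conj[OF prim5_cube[OF zeta_prim5]])

lemma ival_sum_list: "ival w (\<Sum>v\<leftarrow>vs. f v) = (\<Sum>v\<leftarrow>vs. ival w (f v))"
proof (induction vs)
  case Nil show ?case using cint_of_int[of 0] by simp
qed (simp add: cint_add cval_add)

lemma bits_meet: "i \<in> bits (meet S Zs) \<longleftrightarrow> i \<in> bits S \<and> (\<forall>Z\<in>set Zs. i \<in> bits Z)"
  unfolding meet_def by (induction Zs arbitrary: S) (auto simp: bits_and)

lemma vertex_meet: assumes "i < 24" obtains Zs where "set Zs \<subseteq> set facets" "meet full Zs = 2 ^ i"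
proof -
  have "2 ^ i \<in> set pows" using assms unfolding pows_eq by auto
  then have "meet full (filter (\<lambda>Z. Z AND 2 ^ i = 2 ^ i) facets) = 2 ^ i"
    using vertex_ok unfolding list_all_iff meet_def by blast
  then show ?thesis using that[of "filter (\<lambda>Z. Z AND 2 ^ i = 2 ^ i) facets"] by auto
qed

lemma inj_pnt: "inj_on pnt {..<24}"
proof (rule inj_onI, rule ccontr)
  fix i j :: nat assume ij: "i \<in> {..<24}" "j \<in> {..<24}" "pnt i = pnt j" "i \<noteq> j"
  obtain Zs where Zs: "set Zs \<subseteq> set facets" "meet full Zs = 2 ^ i" using vertex_meet ij(1) by auto
  have "i \<in> bits (meet full Zs)" "j \<notin> bits (meet full Zs)" unfolding Zs(2) using ij bits_pow[of i] by auto
  then obtain Z where Z: "Z \<in> set Zs" "i \<in> bits Z" "j \<notin> bits Z" using ij(2) bits_full unfolding bits_meet by blast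
  have ZF: "Z \<in> set facets" using Z(1) Zs(1) by blast
  have "ll Z (pnt i) = 0" using ll_pnt(1)[OF ZF, of i] Z(2) by (simp add: bits_def)
  moreover have "0 < ll Z (pnt j)" using ll_pnt(2)[OF ZF, of j] Z(3) ij(2) by (simp add: bits_def)
  ultimately show False using ij(3) by simp
qed

lemma vecs_eq: "vecs S = map (\<lambda>i. vtab ! i) (filter (bit S) [0..<24])"
proof -
  have "zip pows vtab = map (\<lambda>i. (2 ^ i, vtab ! i)) [0..<24]"
    by (rule nth_equalityI) (auto simp: length_pows vtab_length pows_nth)
  then show ?thesis by (simp add: vecs_def filter_map o_def and_pow_0)
qed

lemma sum_pts: "(\<Sum>p\<in>cfg.pts S. f p) = (\<Sum>v\<leftarrow>vecs S. f (q (zc v)))"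
proof -
  have "(\<Sum>p\<in>cfg.pts S. f p) = (\<Sum>i\<in>bits S. f (pnt i))"
    unfolding cfg.pts_def by (subst sum.reindex) (auto intro: inj_on_subset[OF inj_pnt] simp: bits_def)
  also have "bits S = set (filter (bit S) [0..<24])" by (auto simp: bits_def)
  also have "(\<Sum>i\<in>set (filter (bit S) [0..<24]). f (pnt i)) = (\<Sum>i\<leftarrow>filter (bit S) [0..<24]. f (pnt i))"
    by (rule sum_list_distinct_conv_sum_set[symmetric]) simp
  finally show ?thesis unfolding vecs_eq map_map o_def pnt_def[symmetric] .
qed

lemma Jinv_pts: "Jinv (cfg.pts S) = ival zeta (Jlist (vecs S))"
proof -
  note w = zeta_prim5
  have "Jinv (cfg.pts S) = (\<Sum>v\<leftarrow>vecs S. (\<Sum>v'\<leftarrow>vecs S. ival zeta (zcross v v'))\<^sup>2) *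
      (\<Sum>v\<leftarrow>vecs S. \<Sum>v'\<leftarrow>vecs S. ival (zeta ^ 3) (zcross v v'))\<^sup>2"
    unfolding Jinv_def sum_pts D_q ..
  also have "\<dots> = ival zeta (Jlist (vecs S))"
    by (simp only: Jlist_def Let_def cint_mult cint_gal cval_mul[OF w] cval_gal[OF w] cval_mul[OF prim5_cube[OF w]] ival_sum_list power2_eq_square)
  finally show ?thesis .
qed

text \<open>Recovers the vertices from the convex set alone, so that a group element mapping one
  face onto another also maps the vertices of the first onto those of the second.\<close>

lemma extreme_cv: "{x. x extreme_point_of cv S} = cfg.pts S"
proof
  show "{x. x extreme_point_of cv S} \<subseteq> cfg.pts S" unfolding cv_def using extreme_point_of_convex_hull by blast
  show "cfg.pts S \<subseteq> {x. x extreme_point_of cv S}"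
  proof
    fix x assume x: "x \<in> cfg.pts S"
    then obtain i where i: "i < 24" "x = pnt i" by (auto simp: cfg.pts_def bits_def)
    obtain Zs where Zs: "set Zs \<subseteq> set facets" "meet full Zs = 2 ^ i" using vertex_meet[OF i(1)] by blast
    have "cv (2 ^ i) = {x}" by (simp add: cv_def cfg.pts_def bits_pow[OF i(1)] i(2))
    then have "{x} face_of cv full" using face_meet[OF Zs(1), of full] Zs(2) by simp
    then have "x extreme_point_of cv full" by (simp add: face_of_singleton)
    moreover have "cv S \<subseteq> cv full" unfolding cv_def by (rule hull_mono[OF pts_subset_full])
    moreover have "x \<in> cv S" using x unfolding cv_def by (rule hull_inc)
    ultimately show "x \<in> {x. x extreme_point_of cv S}" unfolding extreme_point_of_def by blast
  qed
qed

section \<open>The cone of positive semidefinite pairs\<close>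

lemma linear_ge: assumes "linear (L :: 'a::euclidean_space \<Rightarrow> real)" shows "closed {p. 0 \<le> L p}" "convex {p. 0 \<le> L p}"
proof -
  have "continuous_on UNIV L" using assms by (simp add: linear_continuous_on linear_conv_bounded_linear)
  then show "closed {p. 0 \<le> L p}" by (intro closed_Collect_le continuous_on_const) auto
  show "convex {p. 0 \<le> L p}" using assms by (auto simp: convex_def linear_add linear_scale)
qed

definition hform :: "complex ^ 2 \<Rightarrow> cmat \<Rightarrow> real" where
  "hform x A = Re (\<Sum>i\<in>UNIV. \<Sum>j\<in>UNIV. cnj (x $ i) * A $ i $ j * x $ j)"

lemma hform_linear: "hform x (A + B) = hform x A + hform x B" "hform x (t *\<^sub>R A) = t * hform x A"
  by (simp_all add: hform_def sum_2 algebra_simps)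

lemma Cbar_eq: "Cbar = \<V> \<inter> (\<Inter>x. {p. 0 \<le> hform x (fst p)} \<inter> {p. 0 \<le> hform x (snd p)})"
  by (auto simp: Cbar_def \<V>_def pos_semidef_def hform_def)

lemma Cbar_closed_convex: "closed Cbar" "convex Cbar"
proof -
  have "subspace \<V>"
    unfolding subspace_def \<V>_def hermitian_def
    by (auto simp: ctranspose_def vec_eq_iff zero_prod_def)
  then have V: "closed \<V>" "convex \<V>" by (simp_all add: closed_subspace subspace_imp_convex)
  have l: "linear (\<lambda>p. hform x (fst p))" "linear (\<lambda>p. hform x (snd p))" for x
    by (rule linearI; simp add: hform_linear)+
  show "closed Cbar" unfolding Cbar_eq by (intro closed_Int closed_INT ballI V linear_ge l)
  show "convex Cbar" unfolding Cbar_eq by (intro convex_Int convex_INT V linear_ge l)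
qed

lemma outer_psd: "pos_semidef (outer u)"
  unfolding pos_semidef_def
proof (intro conjI allI)
  show "hermitian (outer u)" by (simp add: hermitian_def ctranspose_def outer_def vec_eq_iff mult.commute)
  fix x :: "complex ^ 2"
  let ?z = "cnj (x $ 1) * u $ 1 + cnj (x $ 2) * u $ 2"
  have "(\<Sum>i\<in>UNIV. \<Sum>j\<in>UNIV. cnj (x $ i) * outer u $ i $ j * x $ j) = ?z * cnj ?z"
    by (simp add: sum_2 outer_def algebra_simps)
  also have "\<dots> = of_real ((cmod ?z)\<^sup>2)" by (rule complex_norm_square[symmetric])
  finally show "0 \<le> Re (\<Sum>i\<in>UNIV. \<Sum>j\<in>UNIV. cnj (x $ i) * outer u $ i $ j * x $ j)" by simp
qed

lemma Vs_Cbar: "Vs \<subseteq> Cbar"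
proof
  fix p assume "p \<in> Vs"
  then obtain t v where p: "p = t *\<^sub>R q v" "t > 0" by (auto simp: Vs_def C1_def)
  have "q v \<in> Cbar" unfolding q_def Cbar_def \<V>_def using outer_psd by (auto simp: pos_semidef_def)
  then have "q v \<in> \<V>" "\<And>x. 0 \<le> hform x (fst (q v))" "\<And>x. 0 \<le> hform x (snd (q v))" unfolding Cbar_eq by auto
  moreover have "t *\<^sub>R q v \<in> \<V>" using \<open>q v \<in> \<V>\<close>
    unfolding \<V>_def hermitian_def by (auto simp: ctranspose_def vec_eq_iff)
  ultimately show "p \<in> Cbar" unfolding Cbar_eq p(1) using p(2) by (auto simp: hform_linear)
qed

text \<open>The lattice points are positive semidefinite and \<open>Cbar\<close> is closed and
  convex, so intersecting with it changes nothing.\<close>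

lemma polyhedron_eq: "voronoi_polyhedron = vor.Pi"
proof -
  have "closure (convex hull Vs) \<subseteq> Cbar"
    using Cbar_closed_convex Vs_Cbar by (intro closure_minimal hull_minimal)
  then show ?thesis unfolding vor.Pi_def unfolding voronoi_polyhedron_def Vs_def by blast
qed

section \<open>Classes of cones and their representatives\<close>

definition rset8 :: "int set" where "rset8 = insert full rset"

lemma rset8_face: assumes "R \<in> rset8" shows "cv R face_of vor.P0" "cv R \<noteq> {}"
proof -
  have "bits R \<noteq> {} \<and> cv R face_of cv full"
  proof (cases "R = full")
    case True
    have "0 \<in> bits full" by (simp add: bits_full)
    then show ?thesis using True by (auto simp: cv_def face_of_refl)
  next
    case False then show ?thesis using assms rset_data[of R] by (auto simp: rset8_def)
  qed
  then show "cv R face_of vor.P0" by (simp add: cv_full)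
  show "cv R \<noteq> {}" using \<open>bits R \<noteq> {} \<and> cv R face_of cv full\<close> by (simp add: cv_def cfg.pts_def)
qed

lemma rset8_voronoi: "R \<in> rset8 \<Longrightarrow> voronoi_face (cv R)"
  using rset8_face[of R] vor.face_P0_bounded[of "cv R"] by (simp add: voronoi_face_def polyhedron_eq)

text \<open>The cone contains the origin, so its affine dimension is the dimension of its span,
  which is that of the vertices.\<close>

lemma aff_dim_cv: assumes "cv R \<noteq> {}" shows "aff_dim (conic hull (cv R)) = int (dim (cfg.pts R))"
proof -
  have sub: "conic hull (cv R) \<subseteq> span (cfg.pts R)"
  proof
    fix p assume "p \<in> conic hull (cv R)"
    then obtain t y where "p = t *\<^sub>R y" "y \<in> cv R" unfolding conic_hull_explicit by blast
    then show "p \<in> span (cfg.pts R)" using cv_subset_span[of R] span_scale by blast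
  qed
  have sup: "cfg.pts R \<subseteq> conic hull (cv R)"
    unfolding cv_def by (meson hull_subset subset_trans)
  have "dim (conic hull (cv R)) = dim (cfg.pts R)"
    using dim_subset[OF sup] dim_mono[OF sub] by simp
  moreover have "0 \<in> conic hull (cv R)" using assms by (auto simp: conic_hull_contains_0)
  then have "0 \<in> affine hull (conic hull (cv R))" by (rule hull_inc)
  ultimately show ?thesis by (simp add: aff_dim_zero)
qed

lemma cv_cone: "R \<in> rset8 \<Longrightarrow> conic hull (cv R) \<in> voronoi_cones (dim (cfg.pts R))"
  unfolding voronoi_cones_def using rset8_voronoi rset8_face(2) aff_dim_cv by blast

lemma GG_face: assumes "g \<in> GG" "voronoi_face P" shows "voronoi_face (g ` P)"
  using assms vor.face_image vor.bounded_image by (simp add: voronoi_face_def polyhedron_eq)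

lemma GG_conic: "g \<in> GG \<Longrightarrow> conic hull (g ` S) = g ` (conic hull S)"
  by (rule conic_hull_linear_image[OF GG_linear])

lemma GG_cones: assumes "g \<in> GG" "\<sigma> \<in> voronoi_cones n" shows "g ` \<sigma> \<in> voronoi_cones n"
proof -
  obtain P where P: "\<sigma> = conic hull P" "voronoi_face P" "aff_dim (conic hull P) = int n"
    using assms(2) by (auto simp: voronoi_cones_def)
  have "aff_dim (g ` \<sigma>) = int n"
    using aff_dim_injective_linear_image[OF GG_linear[OF assms(1)] GG_inj[OF assms(1)]] P by simp
  then show ?thesis unfolding voronoi_cones_def
    using P GG_face[OF assms(1)] GG_conic[OF assms(1)] by (intro CollectI exI[of _ "g ` P"]) auto
qed

lemma cone_rep: assumes "\<sigma> \<in> voronoi_cones n"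
  shows "\<exists>R\<in>rset8. dim (cfg.pts R) = n \<and> (\<exists>g\<in>GG. g ` \<sigma> = conic hull (cv R))"
proof -
  obtain P where P: "\<sigma> = conic hull P" "voronoi_face P" using assms by (auto simp: voronoi_cones_def)
  then have PF: "P face_of vor.Pi" "P \<noteq> {}" "bounded P" by (auto simp: voronoi_face_def polyhedron_eq)
  obtain g where g: "g \<in> GG" "g ` P face_of vor.P0" using vor.bounded_face_equiv[OF PF] by blast
  obtain R h where R: "R \<in> rset8" "h \<in> GG" "h ` (g ` P) = cv R"
    using P0_faces[OF g(2)] PF(2) by (auto simp: rset8_def)
  have hg: "h \<circ> g \<in> GG" "(h \<circ> g) ` P = cv R" using GG_comp[OF R(2) g(1)] R(3) by (simp_all only: image_comp)
  then have im: "(h \<circ> g) ` \<sigma> = conic hull (cv R)" unfolding P(1) using GG_conic[OF hg(1), of P] by simp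
  have "conic hull (cv R) \<in> voronoi_cones n" using GG_cones[OF hg(1) assms] im by simp
  then have "aff_dim (conic hull (cv R)) = int n" by (auto simp: voronoi_cones_def)
  then have "dim (cfg.pts R) = n" using aff_dim_cv[OF rset8_face(2)[OF R(1)]] by simp
  then show ?thesis using R(1) hg(1) im by blast
qed

lemma cone_equiv_iff: "(\<sigma>, \<tau>) \<in> cone_equiv n \<longleftrightarrow> \<sigma> \<in> voronoi_cones n \<and> \<tau> \<in> voronoi_cones n \<and> (\<exists>g\<in>GG. \<tau> = g ` \<sigma>)"
  by (auto simp: cone_equiv_def GG_def)

lemma equiv_cones: "equiv (voronoi_cones n) (cone_equiv n)"
proof (rule equivI)
  show "cone_equiv n \<subseteq> voronoi_cones n \<times> voronoi_cones n" by (auto simp: cone_equiv_iff)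
  show "refl_on (voronoi_cones n) (cone_equiv n)"
    by (rule refl_onI) (use GG_id in \<open>auto simp: cone_equiv_iff intro!: bexI[of _ id]\<close>)
  show "sym (cone_equiv n)"
  proof (rule symI)
    fix \<sigma> \<tau> assume "(\<sigma>, \<tau>) \<in> cone_equiv n"
    then obtain g where g: "\<sigma> \<in> voronoi_cones n" "\<tau> \<in> voronoi_cones n" "g \<in> GG" "\<tau> = g ` \<sigma>" by (auto simp: cone_equiv_iff)
    obtain h where h: "h \<in> GG" "\<forall>x. h (g x) = x" using GG_inverse[OF g(3)] by blast
    have "\<sigma> = h ` \<tau>" unfolding g(4) image_image by (simp only: h(2)[rule_format] image_ident)
    then show "(\<tau>, \<sigma>) \<in> cone_equiv n" using g h(1) by (auto simp: cone_equiv_iff)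
  qed
  show "trans (cone_equiv n)"
  proof (rule transI)
    fix \<sigma> \<tau> \<rho> assume "(\<sigma>, \<tau>) \<in> cone_equiv n" "(\<tau>, \<rho>) \<in> cone_equiv n"
    then obtain g h where g: "\<sigma> \<in> voronoi_cones n" "\<rho> \<in> voronoi_cones n" "g \<in> GG" "h \<in> GG" "\<tau> = g ` \<sigma>" "\<rho> = h ` \<tau>"
      unfolding cone_equiv_iff by blast
    have "\<rho> = (h \<circ> g) ` \<sigma>" unfolding g(5,6) by (rule image_comp)
    then show "(\<sigma>, \<rho>) \<in> cone_equiv n" using g GG_comp[OF g(4,3)] unfolding cone_equiv_iff by blast
  qed
qed

text \<open>An equivalence of cones descends to their faces, from the faces to the extreme points
  and thus to the vertices, on which the invariant is computed.\<close>

lemma cone_equiv_Jinv: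
  assumes "R \<in> rset8" "T \<in> rset8" "(conic hull (cv R), conic hull (cv T)) \<in> cone_equiv n"
  shows "Jinv (cfg.pts R) = Jinv (cfg.pts T)"
proof -
  obtain g where g: "g \<in> GG" "conic hull (cv T) = g ` (conic hull (cv R))" using assms(3) by (auto simp: cone_equiv_iff)
  have e: "conic hull (g ` cv R) = conic hull (cv T)" using GG_conic[OF g(1)] g(2) by simp
  have f: "g ` cv R face_of vor.Pi" "bounded (g ` cv R)" "cv T face_of vor.Pi" "bounded (cv T)"
    using GG_face[OF g(1) rset8_voronoi[OF assms(1)]] rset8_voronoi[OF assms(2)] by (auto simp: voronoi_face_def polyhedron_eq)
  have "g ` cv R = cv T"
    using vor.bounded_face_cone_inj[OF f e] vor.bounded_face_cone_inj[OF f(3,4,1,2) e[symmetric]] by blast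
  moreover have "{y. y extreme_point_of (g ` cv R)} = g ` {x. x extreme_point_of cv R}"
  proof -
    have "g x extreme_point_of (g ` cv R) \<longleftrightarrow> x extreme_point_of cv R" for x
      using face_of_linear_image[OF GG_linear[OF g(1)] GG_inj[OF g(1)], of "{x}" "cv R"] by (simp add: face_of_singleton)
    moreover have "y \<in> g ` cv R" if "y extreme_point_of (g ` cv R)" for y
      using that by (simp add: extreme_point_of_def)
    ultimately show ?thesis by blast
  qed
  ultimately have "cfg.pts T = g ` cfg.pts R" using extreme_cv by metis
  then show ?thesis using Jinv_GG[OF g(1)] by simp
qed

lemma card_quotient_representatives:
  assumes "equiv A r" "\<And>i. i \<in> I \<Longrightarrow> f i \<in> A" "\<And>a. a \<in> A \<Longrightarrow> \<exists>i\<in>I. (a, f i) \<in> r"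
    "\<And>i j. i \<in> I \<Longrightarrow> j \<in> I \<Longrightarrow> (f i, f j) \<in> r \<Longrightarrow> i = j"
  shows "card (A // r) = card I"
proof -
  have "bij_betw (\<lambda>i. r `` {f i}) I (A // r)"
  proof (rule bij_betwI')
    fix i j assume "i \<in> I" "j \<in> I"
    then show "(r `` {f i} = r `` {f j}) = (i = j)"
      using assms(2,4) eq_equiv_class_iff[OF assms(1)] by metis
  next
    fix i assume "i \<in> I" then show "r `` {f i} \<in> A // r" using assms(2) quotientI by metis
  next
    fix X assume "X \<in> A // r"
    then obtain a where a: "a \<in> A" "X = r `` {a}" by (auto elim: quotientE)
    then obtain i where "i \<in> I" "(a, f i) \<in> r" using assms(3) by blast
    then show "\<exists>i\<in>I. X = r `` {f i}" using a equiv_class_eq[OF assms(1)] by metis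
  qed
  then show ?thesis using bij_betw_same_card by metis
qed

lemma rset8_classes:
  assumes "inj_on (\<lambda>R. Jlist (vecs R)) {R \<in> rset8. dim (cfg.pts R) = n}"
  shows "card (voronoi_classes n) = card {R \<in> rset8. dim (cfg.pts R) = n}"
  unfolding voronoi_classes_def
proof (rule card_quotient_representatives[OF equiv_cones, where f = "\<lambda>R. conic hull (cv R)"])
  fix R assume "R \<in> {R \<in> rset8. dim (cfg.pts R) = n}"
  then show "conic hull (cv R) \<in> voronoi_cones n" using cv_cone by blast
next
  fix \<sigma> assume s: "\<sigma> \<in> voronoi_cones n"
  then obtain R g where R: "R \<in> rset8" "dim (cfg.pts R) = n" "g \<in> GG" "g ` \<sigma> = conic hull (cv R)" using cone_rep by blast
  have "(\<sigma>, conic hull (cv R)) \<in> cone_equiv n"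
    using s R cv_cone[OF R(1)] unfolding cone_equiv_iff by blast
  then show "\<exists>R\<in>{R \<in> rset8. dim (cfg.pts R) = n}. (\<sigma>, conic hull (cv R)) \<in> cone_equiv n" using R by blast
next
  fix R T assume RT: "R \<in> {R \<in> rset8. dim (cfg.pts R) = n}" "T \<in> {R \<in> rset8. dim (cfg.pts R) = n}"
    "(conic hull (cv R), conic hull (cv T)) \<in> cone_equiv n"
  then have "Jinv (cfg.pts R) = Jinv (cfg.pts T)" using cone_equiv_Jinv by blast
  then have "Jlist (vecs R) = Jlist (vecs T)" unfolding Jinv_pts by (rule ival_inj)
  then show "R = T" using inj_onD[OF assms] RT by blast
qed

lemma reps_dim: assumes "(R, n, up, down, Kw) \<in> set reps" shows "dim (cfg.pts R) = n"
proof -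
  have "rep_ok facets gen_maps nodes (map fst reps) (R, n, up, down, Kw)"
    by (rule bspec[OF reps_ok[unfolded list_all_iff] assms])
  then have "flag R n up down" "set up \<subseteq> set facets" "set down \<subseteq> set facets"
    by (simp_all add: rep_ok_def cfg.subl_iff)
  then show ?thesis by (rule cfg.flag_dim(2))
qed

lemma rset8_dim: assumes "n \<noteq> 8" shows "{R \<in> rset8. dim (cfg.pts R) = n} = set (masks n)"
proof
  show "{R \<in> rset8. dim (cfg.pts R) = n} \<subseteq> set (masks n)"
  proof
    fix R assume R: "R \<in> {R \<in> rset8. dim (cfg.pts R) = n}"
    then have "R \<in> rset" using dim_full assms by (auto simp: rset8_def)
    then obtain n' up down Kw where r: "(R, n', up, down, Kw) \<in> set reps" unfolding rset_def by fastforce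
    have "n' = n" using reps_dim[OF r] R by simp
    then show "R \<in> set (masks n)" using r unfolding masks_def by force
  qed
  show "set (masks n) \<subseteq> {R \<in> rset8. dim (cfg.pts R) = n}"
  proof
    fix R assume "R \<in> set (masks n)"
    then obtain up down Kw where "(R, n, up, down, Kw) \<in> set reps" unfolding masks_def by auto
    then show "R \<in> {R \<in> rset8. dim (cfg.pts R) = n}" using reps_dim by (force simp: rset8_def rset_def)
  qed
qed

lemma card_classes: assumes "n \<in> set [2, 3, 4, 5, 6, 7]" shows "card (voronoi_classes n) = length (masks n)"
proof -
  have d: "distinct (map (\<lambda>R. Jlist (vecs R)) (masks n))" using J_distinct assms unfolding list_all_iff by blast
  then have "inj_on (\<lambda>R. Jlist (vecs R)) {R \<in> rset8. dim (cfg.pts R) = n}"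
    using assms rset8_dim[of n] by (auto simp: distinct_map)
  then have "card (voronoi_classes n) = card (set (masks n))" using rset8_classes rset8_dim[of n] assms by auto
  also have "\<dots> = length (masks n)" using d by (intro distinct_card) (simp add: distinct_map)
  finally show ?thesis .
qed

lemma card_classes_8: "card (voronoi_classes 8) = 1"
proof -
  have "{R \<in> rset8. dim (cfg.pts R) = 8} = {full}"
  proof
    show "{R \<in> rset8. dim (cfg.pts R) = 8} \<subseteq> {full}"
    proof
      fix R assume R: "R \<in> {R \<in> rset8. dim (cfg.pts R) = 8}"
      have "R \<notin> rset"
      proof
        assume "R \<in> rset"
        then obtain n where "n \<le> 7" "dim (cfg.pts R) = n" using rset_data by blast
        then show False using R by simp
      qed
      then show "R \<in> {full}" using R by (auto simp: rset8_def)
    qed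
  qed (simp add: rset8_def dim_full)
  then show ?thesis using rset8_classes[of 8] by simp
qed

theorem theorem6p4:
  shows "card (voronoi_classes 8) = 1 \<and>
         card (voronoi_classes 7) = 5 \<and>
         card (voronoi_classes 6) = 10 \<and>
         card (voronoi_classes 5) = 11 \<and>
         card (voronoi_classes 4) = 9 \<and>
         card (voronoi_classes 3) = 4 \<and>
         card (voronoi_classes 2) = 2"
  using card_classes_8 card_classes[of 7] card_classes[of 6] card_classes[of 5] card_classes[of 4]
    card_classes[of 3] card_classes[of 2] length_masks by simp

end
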